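(* Let $M,C,K$ be selfadjoint positive definite operators in a Hilbert space $\mathcal X$, with $M$ and $C$ bounded, and let $\mathcal A$, $\gamma$ and $\omega_0(\mathcal A)$ be as defined in the context. If $$\gamma>-\inf_{x\ne0}\frac{x^*Cx}{2x^*Mx},$$ then $$\gamma=\omega_0(\mathcal A)=\sup\Re\,\sigma(\mathcal A),$$ where $\sigma(\mathcal A)$ is the spectrum of $\mathcal A$ and $\sup\Re\,\sigma(\mathcal A)=\sup\{\Re\lambda:\lambda\in\sigma(\mathcal A)\}$.
   Context: $\mathcal X$ is a (nonzero) complex Hilbert space with scalar product $x^*y$, linear in the second and antilinear in the first variable. The operators $M,C,K$ are selfadjoint in $\mathcal X$ and positive definite, where a selfadjoint operator $T$ is called positive definite if $T\ge cI$ for some constant $c>0$. $M$ and $C$ are bounded; $K$ may be unbounded. $\mathcal D(\cdot)$ denotes the domain of an operator. The phase space operator of the second order system $M\ddot x+C\dot x+Kx=0$ is the operator in $\mathcal X\oplus\mathcal X$ $$\mathcal A=\begin{bmatrix}0&K^{1/2}M^{-1/2}\\-M^{-1/2}K^{1/2}&-M^{-1/2}CM^{-1/2}\end{bmatrix},\qquad \mathcal D(\mathcal A)=\mathcal D(K^{1/2})\oplus M^{1/2}\mathcal D(K^{1/2}).$$ It is maximal dissipative and generates a contractive strongly continuous semigroup $e^{\mathcal A t}$, $t\ge0$. Its type $\omega_0(\mathcal A)$ is the infimum of all real $\beta$ for which there is a constant $C_\beta$ with $\|e^{\mathcal A t}\|\le C_\beta e^{\beta t}$ for all $t\ge 0$.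 Define $$\gamma=\sup_{x\in\mathcal D(K^{1/2}),\,x\ne0}\Re\,\frac{-x^*Cx+\sqrt{(x^*Cx)^2-4\,(x^*Mx)\,\|K^{1/2}x\|^2}}{2x^*Mx},$$ where the square root of a negative number is taken with positive imaginary part. *)

theory Defs
  imports "HOL-Analysis.Analysis"
begin

section \<open>Complex Hilbert spaces\<close>

text \<open>
  The real inner product inherited from the class \<^class>\<open>real_inner\<close> is the real part of the complex
  one, so norm and topology are the usual ones. The complex inner product is antilinear in
  the first and linear in the second argument.
\<close>

class complex_hilbert = real_inner + complete_space +
  fixes scaleC :: "complex \<Rightarrow> 'a \<Rightarrow> 'a" (infixr \<open>*\<^sub>C\<close> 75)
    and cinner :: "'a \<Rightarrow> 'a \<Rightarrow> complex"
  assumes scaleC_add_right: "a *\<^sub>C (x + y) = a *\<^sub>C x + a *\<^sub>C y"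
    and scaleC_add_left: "(a + b) *\<^sub>C x = a *\<^sub>C x + b *\<^sub>C x"
    and scaleC_scaleC: "a *\<^sub>C (b *\<^sub>C x) = (a * b) *\<^sub>C x"
    and scaleC_complex_of_real: "complex_of_real r *\<^sub>C x = r *\<^sub>R x"
    and cinner_commute: "cinner x y = cnj (cinner y x)"
    and cinner_add_right: "cinner x (y + z) = cinner x y + cinner x z"
    and cinner_scaleC_right: "cinner x (a *\<^sub>C y) = a * cinner x y"
    and Re_cinner: "Re (cinner x y) = inner x y"

instantiation prod :: (complex_hilbert, complex_hilbert) complex_hilbert
begin

definition scaleC_prod_def: "a *\<^sub>C p = (a *\<^sub>C fst p, a *\<^sub>C snd p)"

definition cinner_prod_def: "cinner p q = cinner (fst p) (fst q) + cinner (snd p) (snd q)"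

instance
proof
  fix a b :: complex and r :: real and x y z :: "'a \<times> 'b"
  show "a *\<^sub>C (x + y) = a *\<^sub>C x + a *\<^sub>C y"
    by (simp add: scaleC_prod_def scaleC_add_right)
  show "(a + b) *\<^sub>C x = a *\<^sub>C x + b *\<^sub>C x"
    by (simp add: scaleC_prod_def scaleC_add_left)
  show "a *\<^sub>C (b *\<^sub>C x) = (a * b) *\<^sub>C x"
    by (simp add: scaleC_prod_def scaleC_scaleC)
  show "complex_of_real r *\<^sub>C x = r *\<^sub>R x"
    by (simp add: scaleC_prod_def scaleC_complex_of_real scaleR_prod_def)
  show "cinner x y = cnj (cinner y x)"
    using cinner_commute[of "fst x" "fst y"] cinner_commute[of "snd x" "snd y"]
    by (simp add: cinner_prod_def)
  show "cinner x (y + z) = cinner x y + cinner x z"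
    by (simp add: cinner_prod_def cinner_add_right)
  show "cinner x (a *\<^sub>C y) = a * cinner x y"
    by (simp add: cinner_prod_def scaleC_prod_def cinner_scaleC_right distrib_left)
  show "Re (cinner x y) = inner x y"
    by (simp add: cinner_prod_def inner_prod_def Re_cinner)
qed

end

section \<open>Possibly unbounded operators\<close>

text \<open>
  An operator is a partial function \<open>T :: 'a \<rightharpoonup> 'a\<close> with domain \<^term>\<open>dom T\<close>, so equality of
  operators includes equality of their domains, and \<open>S \<circ>\<^sub>m T\<close> is the operator product with its
  natural domain.
\<close>

abbreviation op_app :: "('a \<rightharpoonup> 'b) \<Rightarrow> 'a \<Rightarrow> 'b" (infixr \<open>\<cdot>\<close> 90)
  where "T \<cdot> x \<equiv> the (T x)"

definition linear_op :: "('a::complex_hilbert \<rightharpoonup> 'a) \<Rightarrow> bool" where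
  "linear_op T \<longleftrightarrow>
     0 \<in> dom T \<and>
     (\<forall>x\<in>dom T. \<forall>y\<in>dom T. x + y \<in> dom T \<and> T \<cdot> (x + y) = T \<cdot> x + T \<cdot> y) \<and>
     (\<forall>a. \<forall>x\<in>dom T. a *\<^sub>C x \<in> dom T \<and> T \<cdot> (a *\<^sub>C x) = a *\<^sub>C (T \<cdot> x))"

definition bounded_op :: "('a::complex_hilbert \<rightharpoonup> 'a) \<Rightarrow> bool" where
  "bounded_op T \<longleftrightarrow> dom T = UNIV \<and> (\<exists>B. \<forall>x. norm (T \<cdot> x) \<le> B * norm x)"

definition adjoint_op :: "('a::complex_hilbert \<rightharpoonup> 'a) \<Rightarrow> ('a \<rightharpoonup> 'a)" where
  "adjoint_op T = (\<lambda>y.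
     if \<exists>z. \<forall>x\<in>dom T. cinner y (T \<cdot> x) = cinner z x
     then Some (THE z. \<forall>x\<in>dom T. cinner y (T \<cdot> x) = cinner z x)
     else None)"

definition selfadjoint_op :: "('a::complex_hilbert \<rightharpoonup> 'a) \<Rightarrow> bool" where
  "selfadjoint_op T \<longleftrightarrow> linear_op T \<and> closure (dom T) = UNIV \<and> adjoint_op T = T"

text \<open>For selfadjoint operators the quadratic form below is real.\<close>

definition nonneg_op :: "('a::complex_hilbert \<rightharpoonup> 'a) \<Rightarrow> bool" where
  "nonneg_op T \<longleftrightarrow> (\<forall>x\<in>dom T. 0 \<le> Re (cinner x (T \<cdot> x)))"

definition posdef_op :: "('a::complex_hilbert \<rightharpoonup> 'a) \<Rightarrow> bool" where
  "posdef_op T \<longleftrightarrow> (\<exists>c>0. \<forall>x\<in>dom T. c * (norm x)\<^sup>2 \<le> Re (cinner x (T \<cdot> x)))"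

text \<open>
  The square root of a nonnegative selfadjoint operator exists and is unique; the choice
  operator merely selects it.
\<close>

definition sqrt_op :: "('a::complex_hilbert \<rightharpoonup> 'a) \<Rightarrow> ('a \<rightharpoonup> 'a)" where
  "sqrt_op T = (SOME S. selfadjoint_op S \<and> nonneg_op S \<and> S \<circ>\<^sub>m S = T)"

definition inverse_op :: "('a \<rightharpoonup> 'b) \<Rightarrow> ('b \<rightharpoonup> 'a)" where
  "inverse_op T = (\<lambda>y. if y \<in> ran T then Some (THE x. T x = Some y) else None)"

definition spectrum :: "('a::complex_hilbert \<rightharpoonup> 'a) \<Rightarrow> complex set" where
  "spectrum T = {l. \<not> (bij_betw (\<lambda>x. T \<cdot> x - l *\<^sub>C x) (dom T) UNIV \<and>
                        (\<exists>B. \<forall>x\<in>dom T. norm x \<le> B * norm (T \<cdot> x - l *\<^sub>C x)))}"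

section \<open>Strongly continuous semigroups\<close>

text \<open>Only the values at times \<open>t \<ge> 0\<close> are relevant.\<close>

definition c0_semigroup :: "(real \<Rightarrow> 'a::complex_hilbert \<Rightarrow> 'a) \<Rightarrow> bool" where
  "c0_semigroup U \<longleftrightarrow>
     (\<forall>t\<ge>0. bounded_linear (U t) \<and> (\<forall>a x. U t (a *\<^sub>C x) = a *\<^sub>C U t x)) \<and>
     U 0 = id \<and>
     (\<forall>s\<ge>0. \<forall>t\<ge>0. U (s + t) = U s \<circ> U t) \<and>
     (\<forall>x. continuous_on {0..} (\<lambda>t. U t x))"

definition generator :: "(real \<Rightarrow> 'a::complex_hilbert \<Rightarrow> 'a) \<Rightarrow> ('a \<rightharpoonup> 'a)" where
  "generator U = (\<lambda>x.
     if \<exists>y. ((\<lambda>t. (U t x - x) /\<^sub>R t) \<longlongrightarrow> y) (at_right 0)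
     then Some (Lim (at_right 0) (\<lambda>t. (U t x - x) /\<^sub>R t))
     else None)"

text \<open>
  \<open>exp_semigroup A t\<close> is $e^{At}$; for \<open>t \<ge> 0\<close> a semigroup is determined by its generator.
\<close>

definition exp_semigroup :: "('a::complex_hilbert \<rightharpoonup> 'a) \<Rightarrow> real \<Rightarrow> 'a \<Rightarrow> 'a" where
  "exp_semigroup A = (SOME U. c0_semigroup U \<and> generator U = A)"

definition semigroup_type :: "('a::complex_hilbert \<rightharpoonup> 'a) \<Rightarrow> ereal" where
  "semigroup_type A =
     Inf {ereal \<beta> |\<beta>. \<exists>c. \<forall>t\<ge>0. onorm (exp_semigroup A t) \<le> c * exp (\<beta> * t)}"

section \<open>Second order systems\<close>

definition phase_space_op ::
  "('a::complex_hilbert \<rightharpoonup> 'a) \<Rightarrow> ('a \<rightharpoonup> 'a) \<Rightarrow> ('a \<rightharpoonup> 'a) \<Rightarrow> ('a \<times> 'a \<rightharpoonup> 'a \<times> 'a)" where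
  "phase_space_op M C K =
     (let Kh = sqrt_op K; Mh = sqrt_op M; Mi = inverse_op Mh in
      (\<lambda>(x, y). if x \<in> dom Kh \<and> y \<in> (\<lambda>u. Mh \<cdot> u) ` dom Kh
         then Some (Kh \<cdot> Mi \<cdot> y, - (Mi \<cdot> Kh \<cdot> x) - Mi \<cdot> C \<cdot> Mi \<cdot> y)
         else None))"

text \<open>
  \<^const>\<open>csqrt\<close> maps a negative real number to the root with positive imaginary part.
\<close>

definition gamma :: "('a::complex_hilbert \<rightharpoonup> 'a) \<Rightarrow> ('a \<rightharpoonup> 'a) \<Rightarrow> ('a \<rightharpoonup> 'a) \<Rightarrow> ereal" where
  "gamma M C K =
     (SUP x \<in> dom (sqrt_op K) - {0}. ereal (Re
        ((- cinner x (C \<cdot> x) +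
          csqrt ((cinner x (C \<cdot> x))\<^sup>2 -
                 4 * cinner x (M \<cdot> x) * complex_of_real ((norm (sqrt_op K \<cdot> x))\<^sup>2)))
         / (2 * cinner x (M \<cdot> x)))))"

end

theory Submission
  imports Defs
begin

text \<open>
  Substituting \<open>x = e\<^sup>r\<^sup>t z\<close> into \<open>M x'' + C x' + K x = 0\<close> gives the same kind of equation for \<open>z\<close>, with
  damping \<open>C + 2 r M\<close> and stiffness \<open>K + r C + r\<^sup>2 M\<close>. Write \<open>q\<^sub>r(x) = x\<^sup>* K x + r x\<^sup>* C x + r\<^sup>2 x\<^sup>* M x\<close>
  with \<open>x\<^sup>* K x\<close> read as \<open>\<parallel>K\<^sup>1\<^sup>/\<^sup>2 x\<parallel>\<^sup>2\<close>; then \<open>\<gamma>\<close> is the supremum of the real parts of the upper roots of \<open>r \<mapsto> q\<^sub>r(x)\<close>. For \<open>r > \<gamma>\<close> the new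
  damping is nonnegative and the new stiffness is coercive, so the energy of \<open>z\<close> decreases; as this
  energy is equivalent to the squared norm of the phase space, \<open>e\<^sup>A\<^sup>t\<close> grows at most like \<open>e\<^sup>r\<^sup>t\<close>
  (\<open>semigroup_growth\<close>). For complex \<open>l\<close> with real part above \<open>\<gamma>\<close> the same two properties make the
  quadratic pencil \<open>K + l C + l\<^sup>2 M\<close>, multiplied by a suitable number, coercive, so \<open>l\<close> is in the
  resolvent set (\<open>right_half_plane_resolvent\<close>). Hence the type and the spectral bound are at most \<open>\<gamma>\<close>.

  The assumption \<open>\<gamma> > - inf x\<^sup>* C x / (2 x\<^sup>* M x)\<close> is what makes both bounds sharp. It excludes nonreal roots
  from the approximation of the supremum, so that \<open>\<gamma>\<close> is a limit of real roots, that is of zeros of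
  \<open>r \<mapsto> q\<^sub>r(x)\<close>. Therefore the form \<open>q\<^sub>\<gamma>\<close>, which is nonnegative, takes values arbitrarily small
  in comparison with \<open>x\<^sup>* K x\<close> (\<open>growth_rate_properties\<close>). A nonnegative bounded
  selfadjoint operator with a small form at \<open>x\<close> is itself small at \<open>x\<close>; this turns such \<open>x\<close> into approximate eigenvectors of \<open>A\<close> for the real number \<open>\<gamma>\<close>
  (\<open>approx_eigenvalue_phase_inverse\<close>). They put \<open>\<gamma>\<close> into the spectrum and keep \<open>e\<^sup>A\<^sup>t\<close> from decaying
  faster than \<open>e\<^sup>\<gamma>\<^sup>t\<close>.

  All unbounded operators are handled through their bounded inverses. With \<open>B\<close> the inverse of \<open>K\<^sup>1\<^sup>/\<^sup>2\<close> the
  operator \<open>A\<close> is the inverse of a bounded dissipative operator with dense range, and a pencil in the variable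
  \<open>u\<close> becomes a bounded pencil in \<open>x = K\<^sup>1\<^sup>/\<^sup>2 u\<close>. Two general facts are
  needed for this: positive definite selfadjoint operators have square roots (\<open>sqrt_op_exists\<close>), and the
  inverse of a bounded dissipative operator with dense range generates a strongly continuous semigroup
  (\<open>generates\<close>).
\<close>

section \<open>Coercive operators and orthogonality in real Hilbert spaces\<close>

instance complex_hilbert \<subseteq> banach ..

text \<open>
  The Lax-Milgram theorem. The equation \<open>T x = y\<close> is the fixed point equation of
  \<open>x \<mapsto> x - s (T x - y)\<close>, which is a contraction when the step \<open>s\<close> is small.
\<close>

lemma coercive_bij:
  fixes T :: "'a::{real_inner,banach} \<Rightarrow> 'a"
  assumes T: "bounded_linear T" and e: "e > 0"
    and co: "\<And>x. e * (norm x)\<^sup>2 \<le> inner x (T x)"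
  shows "bij T" and "\<And>x. e * norm x \<le> norm (T x)"
proof -
  interpret T: bounded_linear T by fact
  show low: "e * norm x \<le> norm (T x)" for x
  proof (cases "x = 0")
    case False
    have "e * norm x * norm x \<le> norm (T x) * norm x"
      using co[of x] norm_cauchy_schwarz[of x "T x"] by (simp add: power2_eq_square mult_ac)
    with False show ?thesis by simp
  qed simp
  obtain K where K: "K > 0" "\<And>x. norm (T x) \<le> norm x * K"
    using T.pos_bounded by blast
  (* Adding e to the bound K gives e \<le> b, which makes the contraction factor below
     the square root of a nonnegative number. The step e / b^2 minimises that factor. *)
  define b where "b = K + e"
  have b: "b > 0" "e \<le> b" "norm (T x) \<le> b * norm x" for x
    using K e by (auto simp: b_def algebra_simps intro: order_trans[OF K(2)])
  define q where "q = sqrt (1 - (e / b)\<^sup>2)"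
  have "(e / b)\<^sup>2 \<le> 1" "(e / b)\<^sup>2 > 0" using b e by (auto simp: power_le_one)
  then have q: "0 \<le> q" "q < 1" "q\<^sup>2 = 1 - (e / b)\<^sup>2" by (auto simp: q_def)
  have contr: "norm (x - (e / b\<^sup>2) *\<^sub>R T x) \<le> q * norm x" for x
  proof (rule power2_le_imp_le)
    have "(norm (x - (e / b\<^sup>2) *\<^sub>R T x))\<^sup>2
        = (norm x)\<^sup>2 - 2 * (e / b\<^sup>2) * inner x (T x) + (e / b\<^sup>2)\<^sup>2 * (norm (T x))\<^sup>2"
      by (simp only: power2_norm_eq_inner)
         (simp add: inner_diff_left inner_diff_right inner_commute power2_eq_square)
    also have "\<dots> \<le> (norm x)\<^sup>2 - 2 * (e / b\<^sup>2) * (e * (norm x)\<^sup>2) + (e / b\<^sup>2)\<^sup>2 * (b * norm x)\<^sup>2"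
      using co[of x] b e
      by (intro add_mono diff_mono mult_left_mono power_mono) auto
    also have "\<dots> = (q * norm x)\<^sup>2"
      unfolding power_mult_distrib q(3) using b(1) by (simp add: field_simps power2_eq_square)
    finally show "(norm (x - (e / b\<^sup>2) *\<^sub>R T x))\<^sup>2 \<le> (q * norm x)\<^sup>2" .
  qed (use q in simp)
  have "\<exists>x. T x = y" for y
  proof -
    have "\<exists>!x. x - (e / b\<^sup>2) *\<^sub>R (T x - y) = x"
    proof (rule banach_fix_type[OF q(1,2)], intro allI)
      fix x x'
      have "x - (e / b\<^sup>2) *\<^sub>R (T x - y) - (x' - (e / b\<^sup>2) *\<^sub>R (T x' - y))
          = (x - x') - (e / b\<^sup>2) *\<^sub>R T (x - x')"
        by (simp add: T.diff algebra_simps)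
      with contr[of "x - x'"] show "dist (x - (e / b\<^sup>2) *\<^sub>R (T x - y)) (x' - (e / b\<^sup>2) *\<^sub>R (T x' - y)) \<le> q * dist x x'"
        by (simp only: dist_norm)
    qed
    then show ?thesis using e b by auto
  qed
  moreover have "inj T"
    using low e by (intro injI) (metis T.diff eq_iff_diff_eq_0 mult_le_0_iff norm_le_zero_iff norm_zero not_less)
  ultimately show "bij T" by (auto simp: bij_def surj_def) metis
qed

text \<open>
  The projection theorem: a minimising sequence for the distance from \<open>y\<close> to \<open>V\<close> is a Cauchy
  sequence by the parallelogram law, and \<open>y\<close> minus its limit is orthogonal to \<open>V\<close>.
\<close>

lemma dense_if_orthogonal_trivial:
  fixes V :: "'a::{real_inner,banach} set"
  assumes V: "subspace V" and orth: "\<And>z. (\<And>v. v \<in> V \<Longrightarrow> inner z v = 0) \<Longrightarrow> z = 0"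
  shows "closure V = UNIV"
proof -
  have "y \<in> closure V" for y
  proof -
    define d where "d = infdist y V"
    have ne: "V \<noteq> {}" using V subspace_0 by blast
    have d: "d \<le> norm (y - v)" if "v \<in> V" for v
      using infdist_le[OF that, of y] by (simp add: d_def dist_norm)
    have d0: "d \<ge> 0" by (simp add: d_def infdist_nonneg)
    have "\<exists>v\<in>V. norm (y - v) < d + 1 / real (Suc n)" for n
    proof (rule ccontr)
      assume "\<not> ?thesis"
      then have "d + 1 / real (Suc n) \<le> infdist y V"
        unfolding infdist_def using ne by (auto intro!: cINF_greatest simp: dist_norm not_less)
      then show False by (simp add: d_def)
    qed
    then obtain v where v: "\<And>n. v n \<in> V" "\<And>n. norm (y - v n) < d + 1 / real (Suc n)"
      by metis
    have par: "(norm (v m - v n))\<^sup>2 \<le> 2 * (norm (y - v m))\<^sup>2 + 2 * (norm (y - v n))\<^sup>2 - 4 * d\<^sup>2" for m n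
    proof -
      have "(1/2) *\<^sub>R (v m + v n) \<in> V" using v V by (intro subspace_scale subspace_add)
      then have "d \<le> norm (y - (1/2) *\<^sub>R (v m + v n))" by (rule d)
      then have "d\<^sup>2 \<le> (norm (y - (1/2) *\<^sub>R (v m + v n)))\<^sup>2" using d0 by (simp add: power_mono)
      moreover have "4 * (norm (y - (1/2) *\<^sub>R (v m + v n)))\<^sup>2 + (norm (v m - v n))\<^sup>2
          = 2 * (norm (y - v m))\<^sup>2 + 2 * (norm (y - v n))\<^sup>2"
        by (simp only: power2_norm_eq_inner)
           (simp add: inner_diff_left inner_diff_right inner_add_left inner_add_right inner_commute algebra_simps)
      ultimately show ?thesis by linarith
    qed
    have bnd: "(norm (v m - v n))\<^sup>2 \<le> (8 * d + 4) / real (Suc N)" if "m \<ge> N" "n \<ge> N" for m n N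
    proof -
      have *: "(norm (y - v k))\<^sup>2 \<le> d\<^sup>2 + (2 * d + 1) / real (Suc N)" if "k \<ge> N" for k
      proof -
        have "norm (y - v k) \<le> d + 1 / real (Suc N)"
          using v(2)[of k] that by (intro order_trans[OF less_imp_le[OF v(2)]]) (simp add: frac_le)
        then have "(norm (y - v k))\<^sup>2 \<le> (d + 1 / real (Suc N))\<^sup>2" by (simp add: power_mono)
        also have "\<dots> = d\<^sup>2 + 2 * d / real (Suc N) + (1 / real (Suc N)) * (1 / real (Suc N))"
          by (simp add: power2_eq_square algebra_simps)
        also have "\<dots> \<le> d\<^sup>2 + 2 * d / real (Suc N) + (1 / real (Suc N)) * 1"
          by (intro add_left_mono mult_left_mono) auto
        finally show ?thesis by (simp add: add_divide_distrib)
      qed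
      have "2 * ((2 * d + 1) / real (Suc N)) + 2 * ((2 * d + 1) / real (Suc N)) = (8 * d + 4) / real (Suc N)"
        by (simp add: add_divide_distrib)
      then show ?thesis using par[of m n] *[OF that(1)] *[OF that(2)] by linarith
    qed
    have "Cauchy v"
    proof (rule metric_CauchyI)
      fix e :: real assume e: "e > 0"
      obtain N where N: "(8 * d + 4) / e\<^sup>2 < real N" using reals_Archimedean2 by blast
      have "(8 * d + 4) / real (Suc N) < e\<^sup>2"
        using N e by (simp add: field_simps) (smt (verit) zero_less_power)
      then have "dist (v m) (v n) < e" if "m \<ge> N" "n \<ge> N" for m n
        using bnd[OF that] e by (auto simp: dist_norm intro!: power_less_imp_less_base[of "norm (v m - v n)" 2 e])
      then show "\<exists>N. \<forall>m\<ge>N. \<forall>n\<ge>N. dist (v m) (v n) < e" by blast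
    qed
    then obtain w where w: "v \<longlonglongrightarrow> w" using Cauchy_convergent convergent_def by blast
    have wV: "w \<in> closure V" using v(1) w closure_sequential by blast
    have "norm (y - w) \<le> d"
    proof (rule LIMSEQ_le)
      show "(\<lambda>n. norm (y - v n)) \<longlonglongrightarrow> norm (y - w)" by (intro tendsto_intros w)
      show "(\<lambda>n. d + 1 / real (Suc n)) \<longlonglongrightarrow> d" 
        using tendsto_add[OF tendsto_const LIMSEQ_inverse_real_of_nat, of d] by (simp add: inverse_eq_divide)
      show "\<exists>N. \<forall>n\<ge>N. norm (y - v n) \<le> d + 1 / real (Suc n)" using v(2) less_imp_le by blast
    qed
    have min: "norm (y - w) \<le> norm (y - w - s)" if "s \<in> V" for s
    proof (rule order_trans[OF \<open>norm (y - w) \<le> d\<close>])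
      have "d \<le> norm (y - v n - s)" for n
        using d[of "v n + s"] v(1) that V by (simp add: subspace_add diff_diff_eq)
      moreover have "(\<lambda>n. norm (y - v n - s)) \<longlonglongrightarrow> norm (y - w - s)" by (intro tendsto_intros w)
      ultimately show "d \<le> norm (y - w - s)" by (intro LIMSEQ_le_const) auto
    qed
    have "y - w = 0"
    proof (rule orth)
      fix s assume s: "s \<in> V"
      show "inner (y - w) s = 0"
      proof (cases "s = 0")
        case False
        (* This t minimises the distance between y - w and the multiples of s. *)
        define t where "t = inner (y - w) s / inner s s"
        have "norm (y - w) \<le> norm (y - w - t *\<^sub>R s)" by (intro min subspace_scale V s)
        then have "(norm (y - w))\<^sup>2 \<le> (norm (y - w - t *\<^sub>R s))\<^sup>2" by (simp add: power_mono)
        also have "\<dots> = (norm (y - w))\<^sup>2 - 2 * t * inner (y - w) s + t * t * inner s s"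
          by (simp only: power2_norm_eq_inner)
             (simp add: inner_diff_left inner_diff_right inner_commute algebra_simps)
        also have "\<dots> = (norm (y - w))\<^sup>2 - (inner (y - w) s)\<^sup>2 / inner s s"
          using False by (simp add: t_def power2_eq_square)
        finally have "(inner (y - w) s)\<^sup>2 / inner s s \<le> 0" by simp
        moreover have "inner s s > 0" using False by simp
        ultimately show ?thesis by (simp add: divide_le_0_iff)
      qed simp
    qed
    then show ?thesis using wV by simp
  qed
  then show ?thesis by auto
qed

section \<open>Complex structure\<close>

lemma scaleC_one [simp]: "1 *\<^sub>C (x::'a::complex_hilbert) = x"
  using scaleC_complex_of_real[of 1 x] by simp

lemma scaleC_zero_left [simp]: "0 *\<^sub>C (x::'a::complex_hilbert) = 0"
  using scaleC_complex_of_real[of 0 x] by simp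

lemma scaleC_zero_right [simp]: "a *\<^sub>C (0::'a::complex_hilbert) = 0"
  using scaleC_scaleC[of a 0 "0::'a"] by simp

lemma scaleC_scaleR: "a *\<^sub>C (r *\<^sub>R (x::'a::complex_hilbert)) = r *\<^sub>R (a *\<^sub>C x)"
  unfolding scaleC_complex_of_real[symmetric] scaleC_scaleC by (simp add: mult.commute)

lemma norm_scaleC: "norm (a *\<^sub>C (x::'a::complex_hilbert)) = cmod a * norm x"
proof -
  have im: "Im (cinner x x) = 0"
    using arg_cong[OF cinner_commute[of x x], of Im] by simp
  have "inner (a *\<^sub>C x) (a *\<^sub>C x) = Re (a * cnj a * cnj (cinner x x))"
    unfolding Re_cinner[symmetric] cinner_scaleC_right
    by (subst cinner_commute[of "a *\<^sub>C x" x]) (simp add: cinner_scaleC_right im algebra_simps)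
  also have "\<dots> = (cmod a)\<^sup>2 * inner x x"
    unfolding cmod_power2 by (simp add: im power2_eq_square algebra_simps flip: Re_cinner)
  finally have "(norm (a *\<^sub>C x))\<^sup>2 = (cmod a * norm x)\<^sup>2"
    by (simp add: power2_norm_eq_inner power_mult_distrib)
  then show ?thesis by (simp add: power2_eq_iff_nonneg)
qed

lemma bounded_linear_scaleC: "bounded_linear (\<lambda>x. a *\<^sub>C (x::'a::complex_hilbert))"
  by (rule bounded_linear_intro[where K="cmod a"])
     (simp_all add: scaleC_add_right scaleC_scaleR norm_scaleC mult.commute)

lemma Im_cinner: "Im (cinner x y) = - inner x (\<i> *\<^sub>C y)"
  unfolding Re_cinner[symmetric] cinner_scaleC_right by simp

text \<open>
  The complex inner product is determined by its real part, so the real inner product suffices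
  for all questions of symmetry and orthogonality as long as both \<open>y\<close> and \<open>\<i> y\<close> are tested.
\<close>

lemma cinner_eqI:
  assumes "inner x y = inner x' y'" "inner x (\<i> *\<^sub>C y) = inner x' (\<i> *\<^sub>C y')"
  shows "cinner x y = cinner x' y'"
  using assms by (intro complex_eqI) (simp_all add: Re_cinner Im_cinner)

definition bounded_clinear :: "('a::complex_hilbert \<Rightarrow> 'b::complex_hilbert) \<Rightarrow> bool" where
  "bounded_clinear F \<longleftrightarrow> bounded_linear F \<and> (\<forall>a x. F (a *\<^sub>C x) = a *\<^sub>C F x)"

definition symmetric :: "('a::real_inner \<Rightarrow> 'a) \<Rightarrow> bool" where
  "symmetric F \<longleftrightarrow> (\<forall>x y. inner (F x) y = inner x (F y))"

lemma cinner_symmetric: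
  assumes "bounded_clinear F" "symmetric F"
  shows "cinner (F x) y = cinner x (F y)"
  using assms unfolding bounded_clinear_def symmetric_def by (intro cinner_eqI) metis+

lemma inner_eq_on_dense:
  fixes z :: "'a::real_inner"
  assumes "closure D = UNIV" "\<And>x. x \<in> D \<Longrightarrow> inner z x = inner z' x"
  shows "z = z'"
proof -
  have "closed {x. inner (z - z') x = 0}"
    by (intro closed_Collect_eq continuous_intros)
  then have "closure D \<subseteq> {x. inner (z - z') x = 0}"
    by (intro closure_minimal) (auto simp: inner_diff_left assms)
  then have "inner (z - z') (z - z') = 0" using assms(1) by blast
  then show ?thesis by simp
qed

lemma cinner_eq_on_dense:
  assumes "closure D = UNIV" "\<And>x. x \<in> D \<Longrightarrow> cinner z x = cinner z' x"
  shows "z = z'"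
  using assms by (intro inner_eq_on_dense[OF assms(1)]) (metis Re_cinner)

section \<open>Selfadjoint operators and their inverses\<close>

lemma map_eqI:
  assumes "\<And>x y. f x = Some y \<longleftrightarrow> g x = Some y"
  shows "f = g"
proof
  show "f x = g x" for x using assms[of x "the (f x)"] assms[of x "the (g x)"] by (cases "f x"; cases "g x") auto
qed

lemma adjoint_op_eq_Some:
  assumes "closure (dom T) = UNIV"
  shows "adjoint_op T y = Some z \<longleftrightarrow> (\<forall>x\<in>dom T. cinner y (T \<cdot> x) = cinner z x)"
proof -
  have "(THE z. \<forall>x\<in>dom T. cinner y (T \<cdot> x) = cinner z x) = z'"
    if "\<forall>x\<in>dom T. cinner y (T \<cdot> x) = cinner z' x" for z'
    using that by (intro the_equality) (auto intro!: cinner_eq_on_dense[OF assms])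
  then show ?thesis unfolding adjoint_op_def by (metis (mono_tags, lifting) option.distinct(1) option.sel)
qed

lemma selfadjoint_op_iff:
  assumes "selfadjoint_op T"
  shows "T y = Some z \<longleftrightarrow> (\<forall>x\<in>dom T. cinner y (T \<cdot> x) = cinner z x)"
  using assms adjoint_op_eq_Some[of T y z] unfolding selfadjoint_op_def by simp

lemma inverse_op_eq_Some:
  assumes "\<And>x y z. T x = Some z \<Longrightarrow> T y = Some z \<Longrightarrow> x = y"
  shows "inverse_op T y = Some x \<longleftrightarrow> T x = Some y"
proof -
  have "(THE x. T x = Some y) = x" if "T x = Some y" for x using assms that by blast
  then show ?thesis by (auto simp: inverse_op_def ran_def split: if_splits)
qed

lemma dom_eq_range:
  assumes "\<And>x y. T x = Some y \<longleftrightarrow> x = F y"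
  shows "dom T = range F"
  using assms by (auto simp: dom_def)

lemma linear_op_inverse:
  assumes F: "bounded_clinear F" and T: "\<And>x y. T x = Some y \<longleftrightarrow> x = F y"
  shows "linear_op T"
proof -
  interpret bounded_linear F using F by (simp add: bounded_clinear_def)
  have Fc: "F (a *\<^sub>C x) = a *\<^sub>C F x" for a x using F by (simp add: bounded_clinear_def)
  have T': "T (F y) = Some y" for y using T by simp
  show ?thesis unfolding linear_op_def dom_eq_range[of T F, OF T]
    by (auto simp: T' simp flip: add Fc) (metis rangeI zero)
qed

text \<open>
  The adjoint condition for \<open>T\<close>, written with \<open>x = F w\<close>, says that \<open>y\<close> and \<open>F z\<close> have the
  same inner products with every \<open>w\<close>.
\<close>

lemma selfadjoint_inverse:
  assumes F: "bounded_clinear F" "symmetric F" and d: "closure (range F) = UNIV"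
    and T: "\<And>x y. T x = Some y \<longleftrightarrow> x = F y"
  shows "selfadjoint_op T"
proof -
  note dom = dom_eq_range[of T F, OF T]
  have T': "T (F y) = Some y" for y using T by simp
  have "adjoint_op T y = Some z \<longleftrightarrow> T y = Some z" for y z
  proof -
    have "adjoint_op T y = Some z \<longleftrightarrow> (\<forall>w. cinner y w = cinner (F z) w)"
      by (subst adjoint_op_eq_Some) (auto simp: dom d T' cinner_symmetric[OF F])
    also have "\<dots> \<longleftrightarrow> y = F z" using cinner_eq_on_dense[of UNIV] by auto
    finally show ?thesis by (simp add: T)
  qed
  then have "adjoint_op T = T" by (rule map_eqI)
  then show ?thesis
    using linear_op_inverse[OF F(1) T] d by (simp add: selfadjoint_op_def dom)
qed

text \<open>
  Positive definiteness bounds \<open>K\<close> from below, so its range is closed because \<open>K\<close>, being an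
  adjoint, is closed. The range is also dense: a vector orthogonal to it lies in the domain of the adjoint
  of \<open>K\<close>, which is \<open>K\<close>, and is annihilated by it.
\<close>

lemma selfadjoint_posdef_inverse:
  assumes K: "selfadjoint_op K" "posdef_op K"
  obtains G where "bounded_clinear G" "symmetric G" "\<And>x. 0 \<le> inner x (G x)"
    "closure (range G) = UNIV" "\<And>x y. K x = Some y \<longleftrightarrow> x = G y"
proof -
  obtain c where c: "c > 0" "\<And>x y. K x = Some y \<Longrightarrow> c * (norm x)\<^sup>2 \<le> inner x y"
    using K(2) unfolding posdef_op_def Re_cinner by (metis domI option.sel)
  have lin: "linear_op K" and dense: "closure (dom K) = UNIV" using K(1) by (auto simp: selfadjoint_op_def)
  have add: "K (x + x') = Some (y + y')" if "K x = Some y" "K x' = Some y'" for x x' y y'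
    using lin that unfolding linear_op_def by (metis domD domI option.sel)
  have scC: "K (a *\<^sub>C x) = Some (a *\<^sub>C y)" if "K x = Some y" for a x y
    using lin that unfolding linear_op_def by (metis domD domI option.sel)
  have scR: "K (a *\<^sub>R x) = Some (a *\<^sub>R y)" if "K x = Some y" for a x y
    using scC[OF that, of "complex_of_real a"] by (simp add: scaleC_complex_of_real)
  have diff: "K (x - x') = Some (y - y')" if "K x = Some y" "K x' = Some y'" for x x' y y'
    using add[OF that(1) scR[OF that(2), of "-1"]] by simp
  have zero: "K 0 = Some 0" using lin scC[of 0 _ 0] unfolding linear_op_def by auto
  have low: "c * norm x \<le> norm y" if "K x = Some y" for x y
  proof (cases "x = 0")
    case False
    have "c * norm x * norm x \<le> norm y * norm x"
      using c(2)[OF that] norm_cauchy_schwarz[of x y] by (simp add: power2_eq_square mult_ac)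
    with False show ?thesis by simp
  qed simp
  have inj: "x = x'" if "K x = Some y" "K x' = Some y" for x x' y
    using low[OF diff[OF that]] c(1) by (simp add: mult_le_0_iff)
  have sub: "subspace (ran K)" unfolding subspace_def ran_def using zero add scR by blast
  have sym: "cinner y x' = cinner x y'" if "K x = Some y" "K x' = Some y'" for x x' y y'
    using selfadjoint_op_iff[OF K(1), of x y] that by (metis domI option.sel)
  have "closure (ran K) = UNIV"
  proof (rule dense_if_orthogonal_trivial[OF sub])
    fix z assume z: "\<And>v. v \<in> ran K \<Longrightarrow> inner z v = 0"
    have "cinner z y = cinner 0 x" if "K x = Some y" for x y
      using z[of y] z[of "\<i> *\<^sub>C y"] scC[OF that] that by (intro cinner_eqI) (auto simp: ran_def)
    then have "K z = Some 0" by (subst selfadjoint_op_iff[OF K(1)]) auto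
    then show "z = 0" using inj zero by blast
  qed
  moreover have "closed (ran K)"
    unfolding closed_sequential_limits
  proof (intro allI impI, elim conjE)
    fix Y y assume Y: "\<forall>n. Y n \<in> ran K" and lim: "Y \<longlonglongrightarrow> y"
    then obtain X where X: "\<And>n. K (X n) = Some (Y n)" unfolding ran_def by simp metis
    have "Cauchy X"
    proof (rule metric_CauchyI)
      fix e :: real assume "e > 0"
      then obtain N where N: "\<And>m n. m \<ge> N \<Longrightarrow> n \<ge> N \<Longrightarrow> dist (Y m) (Y n) < c * e"
        using LIMSEQ_imp_Cauchy[OF lim] c(1) by (meson metric_CauchyD mult_pos_pos)
      have "dist (X m) (X n) < e" if "m \<ge> N" "n \<ge> N" for m n
        using low[OF diff[OF X[of m] X[of n]]] N[OF that] c(1) by (smt (verit) dist_norm mult_less_cancel_left_pos)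
      then show "\<exists>N. \<forall>m\<ge>N. \<forall>n\<ge>N. dist (X m) (X n) < e" by blast
    qed
    then obtain x where x: "X \<longlonglongrightarrow> x" using Cauchy_convergent convergent_def by blast
    have inn: "inner x v = inner y u" if "K u = Some v" for u v
    proof (rule LIMSEQ_unique)
      show "(\<lambda>n. inner (X n) v) \<longlonglongrightarrow> inner x v" by (intro tendsto_intros x)
      have "inner (X n) v = inner (Y n) u" for n
        using sym[OF X that, of n] by (metis Re_cinner)
      then show "(\<lambda>n. inner (X n) v) \<longlonglongrightarrow> inner y u" using tendsto_inner[OF lim tendsto_const] by simp
    qed
    have "K x = Some y"
      unfolding selfadjoint_op_iff[OF K(1)] using inn scC by (auto intro!: cinner_eqI)
    then show "y \<in> ran K" by (auto simp: ran_def)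
  qed
  ultimately have "ran K = UNIV" by (simp add: closure_closed)
  then have "\<exists>x. K x = Some y" for y by (auto simp: ran_def set_eq_iff)
  then obtain G where G: "\<And>y. K (G y) = Some y" by metis
  have iff: "K x = Some y \<longleftrightarrow> x = G y" for x y using G inj by metis
  have Gbound: "norm (G y) \<le> norm y * (1 / c)" for y using low[OF G] c(1) by (simp add: field_simps)
  show thesis
  proof
    show "bounded_clinear G" unfolding bounded_clinear_def
      using add[OF G G] scR[OF G] scC[OF G] Gbound
      by (auto simp: iff intro!: bounded_linear_intro[where K="1 / c"])
    show "symmetric G" unfolding symmetric_def using sym[OF G G] by (metis Re_cinner inner_commute)
    show "0 \<le> inner x (G x)" for x using c(2)[OF G] c(1)
      by (metis inner_commute less_imp_le mult_nonneg_nonneg order_trans zero_le_power2)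
    show "closure (range G) = UNIV" using dense dom_eq_range[of K G, OF iff] by simp
  qed (rule iff)
qed

section \<open>Square roots\<close>

text \<open>
  A nonnegative symmetric operator is small wherever its form is small. This carries the step from
  small values of the form to approximate eigenvectors.
\<close>

lemma norm_sq_le_form:
  assumes G: "bounded_linear G" "symmetric G" "\<And>x. 0 \<le> inner x (G x)"
    and b: "b > 0" "\<And>x. norm (G x) \<le> b * norm x"
  shows "(norm (G x))\<^sup>2 \<le> b * inner x (G x)"
proof -
  interpret bounded_linear G by fact
  have s: "inner (G x) y = inner x (G y)" for x y using G(2) by (simp add: symmetric_def)
  have "inner (G x) (G (G x)) \<le> norm (G x) * norm (G (G x))" by (rule norm_cauchy_schwarz)
  also have "\<dots> \<le> norm (G x) * (b * norm (G x))" by (intro mult_left_mono b) auto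
  finally have 1: "inner (G x) (G (G x)) \<le> b * (norm (G x))\<^sup>2" by (simp add: power2_eq_square mult_ac)
  (* Nonnegativity at a gradient step from x; the step 1 / b is the best one for the bound b. *)
  have "0 \<le> inner (x - (1/b) *\<^sub>R G x) (G (x - (1/b) *\<^sub>R G x))" by (rule G(3))
  also have "\<dots> = inner x (G x) - (2/b) * (norm (G x))\<^sup>2 + (1/b)\<^sup>2 * inner (G x) (G (G x))"
    unfolding power2_norm_eq_inner
    by (simp add: diff scaleR inner_diff_left inner_diff_right s power2_eq_square algebra_simps)
  also have "\<dots> \<le> inner x (G x) - (2/b) * (norm (G x))\<^sup>2 + (1/b)\<^sup>2 * (b * (norm (G x))\<^sup>2)"
    by (intro add_left_mono mult_left_mono 1) auto
  also have "\<dots> = inner x (G x) - (norm (G x))\<^sup>2 / b"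
    using b by (simp add: power2_eq_square field_simps)
  finally show ?thesis using b by (simp add: field_simps)
qed

text \<open>
  \<open>nonneg_poly T F r\<close> holds if \<open>F = p(T)\<close> and \<open>r = p(1)\<close> for a polynomial \<open>p\<close> with nonnegative
  coefficients and \<open>p(0) = 0\<close>. For such \<open>p\<close> and a contraction \<open>T\<close>, \<open>p(1)\<close> bounds the norm of \<open>p(T)\<close>,
  which reduces convergence of polynomials in \<open>T\<close> to convergence of numbers.
\<close>

inductive nonneg_poly :: "('a::complex_hilbert \<Rightarrow> 'a) \<Rightarrow> ('a \<Rightarrow> 'a) \<Rightarrow> real \<Rightarrow> bool" for T where
  zero: "nonneg_poly T (\<lambda>x. 0) 0"
| base: "nonneg_poly T T 1"
| scale: "nonneg_poly T F r \<Longrightarrow> 0 \<le> c \<Longrightarrow> nonneg_poly T (\<lambda>x. c *\<^sub>R F x) (c * r)"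
| add: "nonneg_poly T F r \<Longrightarrow> nonneg_poly T G s \<Longrightarrow> nonneg_poly T (\<lambda>x. F x + G x) (r + s)"
| comp: "nonneg_poly T F r \<Longrightarrow> nonneg_poly T G s \<Longrightarrow> nonneg_poly T (\<lambda>x. F (G x)) (r * s)"

lemma nonneg_poly_bounded_clinear:
  assumes "nonneg_poly T F r" "bounded_clinear T"
  shows "bounded_clinear F"
  using assms
  by induction (auto simp: bounded_clinear_def scaleC_scaleR scaleC_add_right
      intro: bounded_linear_intros bounded_linear_compose)

lemma nonneg_poly_norm:
  assumes "nonneg_poly T F r" "\<And>x. norm (T x) \<le> norm x"
  shows "0 \<le> r \<and> (\<forall>x. norm (F x) \<le> r * norm x)"
  using assms
proof induction
  case (add F r G s)
  then show ?case by (auto simp: distrib_right intro!: norm_triangle_le add_mono)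
next
  case (comp F r G s)
  then show ?case by (metis (no_types, opaque_lifting) mult.assoc mult_left_mono mult_nonneg_nonneg order_trans)
qed (auto simp: mult_left_mono mult.assoc)

lemma nonneg_poly_commute:
  assumes "nonneg_poly T F r" "bounded_linear P" "\<And>x. P (T x) = T (P x)"
  shows "P (F x) = F (P x)"
  using assms
  by (induction arbitrary: x) (auto simp: linear_simps)

lemma nonneg_poly_symmetric:
  assumes F: "nonneg_poly T F r" and T: "bounded_clinear T" "symmetric T"
  shows "symmetric F"
  using F
proof induction
  case (comp F r G s)
  have bl: "bounded_linear F" "bounded_linear T"
    using nonneg_poly_bounded_clinear comp T by (auto simp: bounded_clinear_def)
  have "F (T x) = T (F x)" for x using nonneg_poly_commute[OF comp(1) bl(2)] by simp
  then have "F (G x) = G (F x)" for x using nonneg_poly_commute[OF comp(2) bl(1)] by simp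
  then show ?case using comp by (simp add: symmetric_def)
qed (use T in \<open>auto simp: symmetric_def inner_add_left inner_add_right\<close>)

text \<open>
  Scale \<open>G\<close> to \<open>1 - T\<close> with \<open>T\<close> a contraction. Then \<open>1 - Y\<close> is a square root of \<open>1 - T\<close> if
  \<open>2 Y = T + Y\<^sup>2\<close>, and \<open>Y\<close> is the limit of \<open>F\<^sub>n\<^sub>+\<^sub>1 = (T + F\<^sub>n\<^sup>2) / 2\<close> started at \<open>0\<close>. The differences
  \<open>F\<^sub>n\<^sub>+\<^sub>1 - F\<^sub>n\<close> are polynomials in \<open>T\<close> with nonnegative coefficients, so their norms are bounded by the
  increments of the scalar iteration \<open>r\<^sub>n\<^sub>+\<^sub>1 = (1 + r\<^sub>n\<^sup>2) / 2\<close>, which increases and stays below \<open>1\<close>.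
  The contraction property of \<open>Y\<close> makes \<open>1 - Y\<close> nonnegative.
\<close>

lemma bounded_sqrt_exists:
  fixes G :: "'a::complex_hilbert \<Rightarrow> 'a"
  assumes G: "bounded_clinear G" "symmetric G" "\<And>x. 0 \<le> inner x (G x)"
  obtains B where "bounded_clinear B" "symmetric B" "\<And>x. 0 \<le> inner x (B x)" "\<And>x. B (B x) = G x"
proof -
  interpret G: bounded_linear G using G by (simp add: bounded_clinear_def)
  have Gc: "G (a *\<^sub>C x) = a *\<^sub>C G x" for a x using G by (simp add: bounded_clinear_def)
  obtain b where b: "b > 0" "\<And>x. norm (G x) \<le> b * norm x"
    using G.pos_bounded by (metis mult.commute)
  define T where "T = (\<lambda>x. x - (1/b) *\<^sub>R G x)"
  have blT: "bounded_linear T" unfolding T_def by (intro bounded_linear_intros G.bounded_linear_axioms)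
  have Tc: "bounded_clinear T"
    using blT unfolding bounded_clinear_def
    by (simp add: T_def Gc scaleC_scaleR linear_simps(2)[OF bounded_linear_scaleC])
  have Ts: "symmetric T"
    using G(2) by (simp add: symmetric_def T_def inner_diff_left inner_diff_right)
  have Tn: "norm (T x) \<le> norm x" for x
  proof (rule power2_le_imp_le)
    have "(norm (T x))\<^sup>2 = (norm x)\<^sup>2 - (2/b) * inner x (G x) + (1/b)\<^sup>2 * (norm (G x))\<^sup>2"
      unfolding T_def by (simp only: power2_norm_eq_inner)
         (simp add: inner_diff_left inner_diff_right inner_commute power2_eq_square)
    also have "\<dots> \<le> (norm x)\<^sup>2 - (2/b) * inner x (G x) + (1/b)\<^sup>2 * (b * inner x (G x))"
      using norm_sq_le_form[OF G.bounded_linear_axioms G(2,3) b] by (intro add_left_mono mult_left_mono) auto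
    also have "\<dots> = (norm x)\<^sup>2 - inner x (G x) / b"
      using b by (simp add: power2_eq_square field_simps)
    also have "\<dots> \<le> (norm x)\<^sup>2" using G(3)[of x] b by simp
    finally show "(norm (T x))\<^sup>2 \<le> (norm x)\<^sup>2" .
  qed simp
  define F where "F = rec_nat (\<lambda>x. 0) (\<lambda>n f x. (1/2) *\<^sub>R (T x + f (f x)))"
  define r where "r = rec_nat (0::real) (\<lambda>n s. (1/2) * (1 + s * s))"
  have F0: "F 0 = (\<lambda>x. 0)" and FS: "F (Suc n) = (\<lambda>x. (1/2) *\<^sub>R (T x + F n (F n x)))" for n
    by (simp_all add: F_def)
  have r0: "r 0 = 0" and rS: "r (Suc n) = (1/2) * (1 + r n * r n)" for n
    by (simp_all add: r_def)
  have Fp: "nonneg_poly T (F n) (r n)" for n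
  proof (induction n)
    case (Suc n)
    show ?case unfolding FS rS
      by (intro nonneg_poly.scale nonneg_poly.add nonneg_poly.base nonneg_poly.comp Suc) auto
  qed (simp add: F0 r0 nonneg_poly.zero)
  have Fbl: "bounded_linear (F n)" and FcC: "F n (a *\<^sub>C x) = a *\<^sub>C F n x" for n a x
    using nonneg_poly_bounded_clinear[OF Fp Tc] by (auto simp: bounded_clinear_def)
  have Fcomm: "F m (F n x) = F n (F m x)" for m n x
    by (rule nonneg_poly_commute[OF Fp Fbl], rule nonneg_poly_commute[OF Fp blT, symmetric]) simp
  have Fd: "nonneg_poly T (\<lambda>x. F (Suc n) x - F n x) (r (Suc n) - r n)" for n
  proof (induction n)
    case 0
    have "nonneg_poly T (\<lambda>x. (1/2) *\<^sub>R T x) ((1/2) * 1)" by (intro nonneg_poly.intros) auto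
    then show ?case by (simp add: F0 FS r0 rS)
  next
    case (Suc n)
    (* F^2 - G^2 = (F - G) (F + G) for the commuting operators F and G. *)
    have "nonneg_poly T (\<lambda>x. (1/2) *\<^sub>R ((F (Suc n) (F (Suc n) x + F n x) - F n (F (Suc n) x + F n x))))
      ((1/2) * ((r (Suc n) - r n) * (r (Suc n) + r n)))"
      by (intro nonneg_poly.scale nonneg_poly.comp[OF Suc] nonneg_poly.add Fp) auto
    also have "(\<lambda>x. (1/2) *\<^sub>R ((F (Suc n) (F (Suc n) x + F n x) - F n (F (Suc n) x + F n x))))
        = (\<lambda>x. F (Suc (Suc n)) x - F (Suc n) x)"
    proof
      fix x
      have "(1/2) *\<^sub>R ((F (Suc n) (F (Suc n) x + F n x) - F n (F (Suc n) x + F n x)))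
          = (1/2) *\<^sub>R (F (Suc n) (F (Suc n) x) - F n (F n x))"
        by (simp add: linear_simps(1)[OF Fbl] Fcomm[of "Suc n" n])
      also have "\<dots> = F (Suc (Suc n)) x - F (Suc n) x"
        unfolding FS[of "Suc n"] FS[of n, THEN fun_cong, of x] by (simp add: algebra_simps)
      finally show "(1/2) *\<^sub>R ((F (Suc n) (F (Suc n) x + F n x) - F n (F (Suc n) x + F n x)))
          = F (Suc (Suc n)) x - F (Suc n) x" .
    qed
    also have "(1/2) * ((r (Suc n) - r n) * (r (Suc n) + r n)) = r (Suc (Suc n)) - r (Suc n)"
      unfolding rS[of "Suc n"] rS[of n] by (simp add: algebra_simps)
    finally show ?case .
  qed
  have r01: "0 \<le> r n \<and> r n \<le> 1" for n
  proof (induction n)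
    case (Suc n)
    then have "r n * r n \<le> 1 * 1" by (intro mult_mono) auto
    then show ?case by (simp add: rS)
  qed (simp add: r0)
  have rmono: "incseq r" using nonneg_poly_norm[OF Fd Tn] by (intro incseq_SucI) auto
  then have "Cauchy r"
    using r01 by (intro convergent_Cauchy Bseq_monoseq_convergent incseq_imp_monoseq BseqI'[of r 1]) (auto simp: abs_le_iff)
  have Fdist: "norm (F n x - F m x) \<le> (r n - r m) * norm x" if "m \<le> n" for m n x
    using that
  proof (induction n rule: dec_induct)
    case (step n)
    have "norm (F (Suc n) x - F m x) \<le> norm (F (Suc n) x - F n x) + norm (F n x - F m x)"
      by (rule order_trans[OF _ norm_triangle_ineq]) simp
    also have "\<dots> \<le> (r (Suc n) - r n) * norm x + (r n - r m) * norm x"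
      using nonneg_poly_norm[OF Fd Tn] step by (intro add_mono) auto
    finally show ?case by (simp add: algebra_simps)
  qed simp
  have Fn: "norm (F n x) \<le> norm x" for n x
    using nonneg_poly_norm[OF Fp Tn, of n] r01[of n]
    by (meson mult_left_le_one_le norm_ge_zero order_trans)
  have "Cauchy (\<lambda>n. F n x)" for x
  proof (rule metric_CauchyI)
    fix e :: real assume e: "e > 0"
    obtain N where N: "\<And>m n. m \<ge> N \<Longrightarrow> n \<ge> N \<Longrightarrow> dist (r m) (r n) < e / (norm x + 1)"
      using metric_CauchyD[OF \<open>Cauchy r\<close>, of "e / (norm x + 1)"] e by (auto simp: add_nonneg_pos)
    have *: "dist (F n x) (F m x) < e" if "N \<le> m" "m \<le> n" for m n
    proof -
      have "r n - r m < e / (norm x + 1)" using N[of n m] that by (simp add: dist_real_def)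
      then have "(r n - r m) * (norm x + 1) < e" by (subst (asm) pos_less_divide_eq) (simp_all add: add_nonneg_pos)
      moreover have "(r n - r m) * norm x \<le> (r n - r m) * (norm x + 1)"
        using rmono that by (intro mult_left_mono) (auto simp: incseq_def)
      ultimately show ?thesis using Fdist[OF that(2), of x] by (simp add: dist_norm)
    qed
    have "dist (F m x) (F n x) < e" if "N \<le> m" "N \<le> n" for m n
      using *[of m n] *[of n m] that by (metis dist_commute nle_le)
    then show "\<exists>N. \<forall>m\<ge>N. \<forall>n\<ge>N. dist (F m x) (F n x) < e" by blast
  qed
  then have "\<exists>y. (\<lambda>n. F n x) \<longlonglongrightarrow> y" for x using Cauchy_convergent convergent_def by blast
  then obtain Y where Y: "\<And>x. (\<lambda>n. F n x) \<longlonglongrightarrow> Y x" by metis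
  have Yn: "norm (Y x) \<le> norm x" for x
    by (rule LIMSEQ_le_const2[OF tendsto_norm[OF Y]]) (use Fn in auto)
  have Yadd: "Y (x + y) = Y x + Y y" for x y
    using LIMSEQ_unique[OF Y[of "x + y"]] tendsto_add[OF Y[of x] Y[of y]] by (simp add: linear_simps(1)[OF Fbl])
  have Ysc: "Y (a *\<^sub>C x) = a *\<^sub>C Y x" for a x
    using LIMSEQ_unique[OF Y[of "a *\<^sub>C x"]] bounded_linear.tendsto[OF bounded_linear_scaleC Y[of x], of a] by (simp add: FcC)
  have Yc: "bounded_clinear Y"
    unfolding bounded_clinear_def
    using Yadd Ysc Yn by (auto simp: scaleC_complex_of_real[symmetric] intro!: bounded_linear_intro[where K=1])
  then have Ybl: "bounded_linear Y" by (simp add: bounded_clinear_def)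
  have Ysym: "inner (Y x) y = inner x (Y y)" for x y
    using nonneg_poly_symmetric[OF Fp Tc Ts]
    by (intro LIMSEQ_unique[OF tendsto_inner[OF Y tendsto_const] ])
       (simp add: symmetric_def tendsto_inner[OF tendsto_const Y])
  have FF: "(\<lambda>n. F n (F n x)) \<longlonglongrightarrow> Y (Y x)" for x
  proof -
    have "(\<lambda>n. F n (F n x - Y x)) \<longlonglongrightarrow> 0"
    proof (rule Lim_null_comparison)
      show "\<forall>\<^sub>F n in sequentially. norm (F n (F n x - Y x)) \<le> norm (F n x - Y x)" using Fn by auto
      show "(\<lambda>n. norm (F n x - Y x)) \<longlonglongrightarrow> 0" using Y by (simp add: LIM_zero tendsto_norm_zero)
    qed
    from tendsto_add[OF this Y[of "Y x"]] show ?thesis by (simp add: linear_simps(2)[OF Fbl])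
  qed
  have Yeq: "2 *\<^sub>R Y x = T x + Y (Y x)" for x
  proof -
    have "(\<lambda>n. F (Suc n) x) \<longlonglongrightarrow> (1/2) *\<^sub>R (T x + Y (Y x))" unfolding FS by (intro tendsto_intros FF)
    then have "Y x = (1/2) *\<^sub>R (T x + Y (Y x))" using LIMSEQ_Suc[OF Y[of x]] LIMSEQ_unique by blast
    then show ?thesis by (metis mult_2_right real_scaleR_def scaleR_one scaleR_scaleR times_divide_eq_right divide_self_if zero_neq_numeral mult.commute)
  qed
  show thesis
  proof
    show "bounded_clinear (\<lambda>x. sqrt b *\<^sub>R (x - Y x))"
      using Yc unfolding bounded_clinear_def
      by (auto simp: scaleC_scaleR linear_simps(2)[OF bounded_linear_scaleC] intro!: bounded_linear_intros)
    show "symmetric (\<lambda>x. sqrt b *\<^sub>R (x - Y x))"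
      using Ysym by (simp add: symmetric_def inner_diff_left inner_diff_right)
    show "0 \<le> inner x (sqrt b *\<^sub>R (x - Y x))" for x
    proof -
      have "inner x (Y x) \<le> norm x * norm (Y x)" by (rule norm_cauchy_schwarz)
      also have "\<dots> \<le> norm x * norm x" by (intro mult_left_mono Yn) auto
      finally show ?thesis using b by (simp add: inner_diff_right power2_norm_eq_inner[symmetric] power2_eq_square)
    qed
    fix x
    have "sqrt b *\<^sub>R (sqrt b *\<^sub>R (x - Y x) - Y (sqrt b *\<^sub>R (x - Y x)))
        = b *\<^sub>R (x - Y x - Y (x - Y x))"
      using b by (simp add: linear_simps(5)[OF Ybl] flip: scaleR_diff_right)
    also have "x - Y x - Y (x - Y x) = x - 2 *\<^sub>R Y x + Y (Y x)"
      by (simp add: linear_simps(2)[OF Ybl] scaleR_2)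
    also have "\<dots> = (1/b) *\<^sub>R G x" unfolding Yeq by (simp add: T_def)
    finally show "sqrt b *\<^sub>R (sqrt b *\<^sub>R (x - Y x) - Y (sqrt b *\<^sub>R (x - Y x))) = G x" using b by simp
  qed
qed

text \<open>
  The square root of the bounded inverse is injective with dense range, and its inverse is the
  square root of \<open>K\<close>.
\<close>

lemma sqrt_op_exists:
  fixes K :: "'a::complex_hilbert \<rightharpoonup> 'a"
  assumes K: "selfadjoint_op K" "posdef_op K"
  shows "\<exists>S. selfadjoint_op S \<and> nonneg_op S \<and> S \<circ>\<^sub>m S = K"
proof -
  obtain G where G: "bounded_clinear G" "symmetric G" "\<And>x. 0 \<le> inner x (G x)"
    "closure (range G) = UNIV" "\<And>x y. K x = Some y \<longleftrightarrow> x = G y"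
    using selfadjoint_posdef_inverse[OF K] by blast
  obtain B where B: "bounded_clinear B" "symmetric B" "\<And>x. 0 \<le> inner x (B x)" "\<And>x. B (B x) = G x"
    using bounded_sqrt_exists[OF G(1-3)] by blast
  have inj: "x = y" if "B x = B y" for x y
    using G(5)[of "G x" x] G(5)[of "G x" y] that by (metis B(4) option.sel)
  define S where "S = inverse_op (\<lambda>x. Some (B x))"
  have S: "S x = Some y \<longleftrightarrow> x = B y" for x y
    unfolding S_def using inj by (subst inverse_op_eq_Some) auto
  have "closure (range B) = UNIV"
    using G(4) closure_mono[of "range G" "range B"] by (auto simp flip: B(4))
  then have "selfadjoint_op S" using selfadjoint_inverse[OF B(1,2) _ S] by blast
  moreover have "nonneg_op S"
    unfolding nonneg_op_def Re_cinner
  proof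
    fix x assume "x \<in> dom S"
    then obtain y where y: "x = B y" using S by blast
    then have "S x = Some y" using S by simp
    then show "0 \<le> inner x (S \<cdot> x)" using B(3)[of y] y by (simp add: inner_commute)
  qed
  moreover have "(S \<circ>\<^sub>m S) x = Some z \<longleftrightarrow> K x = Some z" for x z
    by (auto simp: map_comp_Some_iff S G(5) B(4))
  then have "S \<circ>\<^sub>m S = K" by (rule map_eqI)
  ultimately show ?thesis by blast
qed

lemma sqrt_op_properties:
  assumes "selfadjoint_op K" "posdef_op K"
  shows "selfadjoint_op (sqrt_op K)" "sqrt_op K \<circ>\<^sub>m sqrt_op K = K"
  using someI_ex[OF sqrt_op_exists[OF assms]] by (simp_all add: sqrt_op_def)

text \<open>
  From here on \<open>K\<^sup>1\<^sup>/\<^sup>2\<close> is accessible only through its bounded inverse \<open>B\<close>. Whatever square root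
  the choice operator picks, \<open>B = K\<^sup>1\<^sup>/\<^sup>2 K\<^sup>-\<^sup>1\<close>, and the bound on \<open>B\<close> comes from
  \<open>\<parallel>B y\<parallel>\<^sup>2 = y\<^sup>* K\<^sup>-\<^sup>1 y\<close>.
\<close>

lemma sqrt_op_inverse:
  fixes K :: "'a::complex_hilbert \<rightharpoonup> 'a"
  assumes K: "selfadjoint_op K" "posdef_op K"
  obtains B where "bounded_clinear B" "symmetric B" "closure (range B) = UNIV"
    "\<And>x y. sqrt_op K x = Some y \<longleftrightarrow> x = B y" "\<And>x y. K x = Some y \<longleftrightarrow> x = B (B y)"
proof -
  define S where "S = sqrt_op K"
  have sa: "selfadjoint_op S" and SS: "S \<circ>\<^sub>m S = K"
    using sqrt_op_properties[OF K] by (simp_all add: S_def)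
  have lin: "linear_op S" and dense: "closure (dom S) = UNIV" using sa by (auto simp: selfadjoint_op_def)
  obtain G where G: "bounded_clinear G" "symmetric G" "\<And>x. 0 \<le> inner x (G x)"
    "closure (range G) = UNIV" "\<And>x y. K x = Some y \<longleftrightarrow> x = G y"
    using selfadjoint_posdef_inverse[OF K] by blast
  have GS: "S x = Some u \<Longrightarrow> S u = Some y \<Longrightarrow> x = G y" for x u y
    using SS by (metis G(5) map_comp_Some_iff)
  have add: "S (x + x') = Some (y + y')" if "S x = Some y" "S x' = Some y'" for x x' y y'
    using lin that unfolding linear_op_def by (metis domD domI option.sel)
  have scC: "S (a *\<^sub>C x) = Some (a *\<^sub>C y)" if "S x = Some y" for a x y
    using lin that unfolding linear_op_def by (metis domD domI option.sel)
  have scR: "S (a *\<^sub>R x) = Some (a *\<^sub>R y)" if "S x = Some y" for a x y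
    using scC[OF that, of "complex_of_real a"] by (simp add: scaleC_complex_of_real)
  have diff: "S (x - x') = Some (y - y')" if "S x = Some y" "S x' = Some y'" for x x' y y'
    using add[OF that(1) scR[OF that(2), of "-1"]] by simp
  have zero: "S 0 = Some 0" using lin scC[of 0 _ 0] unfolding linear_op_def by auto
  have G0: "G 0 = 0" using G(1) linear_simps(3) unfolding bounded_clinear_def by blast
  have inj: "x = x'" if "S x = Some y" "S x' = Some y" for x x' y
    using GS[OF diff[OF that]] zero G0 by simp
  have sym: "inner y x' = inner x y'" if "S x = Some y" "S x' = Some y'" for x x' y y'
    using selfadjoint_op_iff[OF sa, of x y] that by (metis domI option.sel Re_cinner)
  define B where "B = (\<lambda>y. S \<cdot> (G y))"
  have SG: "S (G y) = Some (B y) \<and> S (B y) = Some y" for y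
  proof -
    have "(S \<circ>\<^sub>m S) (G y) = Some y" using SS G(5) by simp
    then show ?thesis by (auto simp: map_comp_Some_iff B_def)
  qed
  then have iff: "S x = Some y \<longleftrightarrow> x = B y" for x y using inj by metis
  obtain b where b: "b > 0" "\<And>x. norm (G x) \<le> norm x * b"
    using G(1) bounded_linear.pos_bounded unfolding bounded_clinear_def by blast
  have Bn: "norm (B y) \<le> norm y * sqrt b" for y
  proof (rule power2_le_imp_le)
    have "(norm (B y))\<^sup>2 = inner (G y) y"
      using sym[of "G y" "B y" "B y" y] SG[of y] by (simp add: power2_norm_eq_inner)
    also have "\<dots> \<le> (norm y * b) * norm y"
      using b(2)[of y] norm_cauchy_schwarz[of "G y" y] by (meson mult_right_mono norm_ge_zero order_trans)
    finally show "(norm (B y))\<^sup>2 \<le> (norm y * sqrt b)\<^sup>2"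
      unfolding power_mult_distrib using b by (simp add: power2_eq_square[of "norm y"] mult_ac)
  qed (use b in simp)
  have SB: "S (B y) = Some y" for y using SG by blast
  show thesis
  proof
    show "bounded_clinear B" unfolding bounded_clinear_def
      using add[OF SB SB] scR[OF SB] scC[OF SB] Bn
      by (auto simp: iff intro!: bounded_linear_intro[where K="sqrt b"])
    show "symmetric B" unfolding symmetric_def using sym[OF SB SB] by (metis inner_commute)
    show "closure (range B) = UNIV" using dense dom_eq_range[of S B, OF iff] by simp
    show "K x = Some y \<longleftrightarrow> x = B (B y)" for x y by (metis G(5) SG iff)
  qed (use iff S_def in auto)
qed

text \<open>
  For bounded \<open>M\<close> the square root \<open>R\<close> is bounded as well, and \<open>Q\<close> is its inverse.
\<close>

lemma sqrt_op_bounded: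
  fixes M :: "'a::complex_hilbert \<rightharpoonup> 'a"
  assumes M: "selfadjoint_op M" "posdef_op M" "bounded_op M"
  obtains R Q where "bounded_clinear R" "symmetric R" "bounded_linear Q"
    "\<And>x. sqrt_op M x = Some (R x)" "\<And>x. M x = Some (R (R x))" "\<And>x. Q (R x) = x" "\<And>x. R (Q x) = x"
proof -
  obtain Q where Q: "bounded_clinear Q" "symmetric Q" "closure (range Q) = UNIV"
    "\<And>x y. sqrt_op M x = Some y \<longleftrightarrow> x = Q y" "\<And>x y. M x = Some y \<longleftrightarrow> x = Q (Q y)"
    using sqrt_op_inverse[OF M(1,2)] by blast
  interpret Q: bounded_linear Q using Q by (simp add: bounded_clinear_def)
  obtain b where domM: "dom M = UNIV" and b0: "\<And>x. norm (M \<cdot> x) \<le> b * norm x"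
    using M(3) by (auto simp: bounded_op_def)
  define R where "R = (\<lambda>x. Q (M \<cdot> x))"
  have Ms: "M x = Some (M \<cdot> x)" for x using domM by (metis UNIV_I domIff option.collapse)
  have QR: "Q (R x) = x" for x using Q(5) Ms unfolding R_def by metis
  have inj: "x = y" if "Q x = Q y" for x y using Q(4) that by (metis option.sel)
  have RQ: "R (Q x) = x" for x using QR inj by blast
  have sqrtR: "sqrt_op M x = Some (R x)" for x by (simp add: Q(4) QR)
  have MR: "M x = Some (R (R x))" for x by (simp add: Q(5) QR)
  have Rs: "inner (R x) y = inner x (R y)" for x y
    using Q(2) unfolding symmetric_def by (metis QR)
  have Rn: "norm (R x) \<le> norm x * sqrt \<bar>b\<bar>" for x
  proof (rule power2_le_imp_le)
    have "(norm (R x))\<^sup>2 = inner x (M \<cdot> x)" by (simp add: power2_norm_eq_inner Rs MR)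
    also have "\<dots> \<le> norm x * (\<bar>b\<bar> * norm x)"
      using b0[of x] norm_cauchy_schwarz[of x "M \<cdot> x"]
      by (meson abs_ge_self mult_left_mono mult_right_mono norm_ge_zero order_trans)
    finally show "(norm (R x))\<^sup>2 \<le> (norm x * sqrt \<bar>b\<bar>)\<^sup>2"
      unfolding power_mult_distrib by (simp add: power2_eq_square[of "norm x"] mult_ac)
  qed simp
  show thesis
  proof
    have "R (x + y) = R x + R y" "R (r *\<^sub>R x) = r *\<^sub>R R x" for x y r
      by (rule inj, simp add: QR Q.add Q.scaleR)+
    moreover have "R (a *\<^sub>C x) = a *\<^sub>C R x" for x a
      using Q(1) by (intro inj[of "R (a *\<^sub>C x)"]) (simp add: QR bounded_clinear_def)
    ultimately show "bounded_clinear R" unfolding bounded_clinear_def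
      using Rn by (auto intro!: bounded_linear_intro[where K="sqrt \<bar>b\<bar>"])
    show "symmetric R" using Rs by (simp add: symmetric_def)
  qed (use Q.bounded_linear_axioms sqrtR MR QR RQ in auto)
qed

lemma selfadjoint_bounded:
  assumes C: "selfadjoint_op C" "bounded_op C"
  obtains F where "bounded_clinear F" "symmetric F" "\<And>x. C x = Some (F x)"
proof
  obtain b where dom: "dom C = UNIV" and b: "\<And>x. norm (C \<cdot> x) \<le> b * norm x"
    using C(2) by (auto simp: bounded_op_def)
  have lin: "linear_op C" using C(1) by (simp add: selfadjoint_op_def)
  have a: "C \<cdot> (x + y) = C \<cdot> x + C \<cdot> y" "C \<cdot> (c *\<^sub>C x) = c *\<^sub>C (C \<cdot> x)" for x y c
    using lin dom unfolding linear_op_def by simp_all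
  have "C \<cdot> (r *\<^sub>R x) = r *\<^sub>R (C \<cdot> x)" for r x
    using a(2)[of "complex_of_real r" x] by (simp add: scaleC_complex_of_real)
  then show "bounded_clinear (op_app C)"
    unfolding bounded_clinear_def using a b by (auto intro!: bounded_linear_intro[where K=b] simp: mult.commute)
  show CS: "C x = Some (C \<cdot> x)" for x using dom by (metis UNIV_I domIff option.collapse)
  have "cinner x (C \<cdot> y) = cinner (C \<cdot> x) y" for x y
    using selfadjoint_op_iff[OF C(1), of x "C \<cdot> x"] CS[of x] dom by auto
  then show "symmetric (op_app C)" unfolding symmetric_def by (metis Re_cinner)
qed

section \<open>Differential equations and strongly continuous semigroups\<close>

text \<open>
  The solution is the exponential series of \<open>t A\<close> applied to \<open>x\<close>, differentiated term by term.
\<close>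

lemma bounded_ode_exists:
  fixes A :: "'a::banach \<Rightarrow> 'a"
  assumes A: "bounded_linear A"
  obtains u where "u 0 = x" "\<And>t. (u has_vector_derivative A (u t)) (at t)"
proof -
  interpret A: bounded_linear A by fact
  obtain K where K: "K \<ge> 0" "\<And>x. norm (A x) \<le> norm x * K" using A.nonneg_bounded by blast
  define f where "f = (\<lambda>n t. (t ^ n / fact n) *\<^sub>R (A ^^ n) x)"
  define u where "u = (\<lambda>t::real. \<Sum>n. f n t)"
  have An: "norm ((A ^^ n) x) \<le> K ^ n * norm x" for n
  proof (induction n)
    case (Suc n)
    have "norm (A ((A ^^ n) x)) \<le> norm ((A ^^ n) x) * K" by (rule K)
    also have "\<dots> \<le> K ^ n * norm x * K" by (intro mult_right_mono Suc K)
    finally show ?case by (simp add: mult_ac)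
  qed simp
  have fn: "norm (f n t) \<le> inverse (fact n) * (T * K) ^ n * norm x" if "\<bar>t\<bar> \<le> T" for n t T
  proof -
    have "norm (f n t) = \<bar>t\<bar> ^ n / fact n * norm ((A ^^ n) x)"
      by (simp add: f_def power_abs)
    also have "\<dots> \<le> T ^ n / fact n * (K ^ n * norm x)"
      using that K by (intro mult_mono divide_right_mono power_mono An) auto
    finally show ?thesis by (simp add: power_mult_distrib field_simps)
  qed
  have summ: "summable (\<lambda>n. inverse (fact n) * (T * K) ^ n * norm x)" for T
    by (intro summable_mult2 summable_exp)
  have fsumm: "summable (\<lambda>n. f n t)" for t
    by (rule summable_comparison_test[OF _ summ[of "\<bar>t\<bar>"]]) (use fn[of t "\<bar>t\<bar>"] in auto)
  have ul: "uniform_limit {-T<..<T} (\<lambda>n t. \<Sum>i<n. f i t) u sequentially" for T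
    unfolding u_def by (rule Weierstrass_m_test[OF _ summ[of T]], rule fn) auto
  define f' where "f' = (\<lambda>n t. case n of 0 \<Rightarrow> 0 | Suc m \<Rightarrow> A (f m t))"
  have fd: "(f n has_vector_derivative f' n t) (at t within S)" for n t S
  proof (cases n)
    case (Suc m)
    have "((\<lambda>t. t ^ Suc m / fact (Suc m)) has_real_derivative (real (Suc m) * t ^ m) / fact (Suc m)) (at t within S)"
      by (rule derivative_eq_intros refl | simp del: power_Suc of_nat_Suc fact_Suc)+
    moreover have "(real (Suc m) * t ^ m) / fact (Suc m) = t ^ m / fact m"
      by (simp only: fact_Suc of_nat_mult mult_divide_mult_cancel_left)
    ultimately have "((\<lambda>t. (t ^ Suc m / fact (Suc m)) *\<^sub>R (A ^^ Suc m) x) has_vector_derivative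
        (t ^ m / fact m) *\<^sub>R (A ^^ Suc m) x) (at t within S)"
      using has_vector_derivative_scaleR[OF _ has_vector_derivative_const, of _ _ t S "(A ^^ Suc m) x"] by force
    then show ?thesis unfolding Suc f_def f'_def by (simp add: A.scaleR)
  qed (simp add: f_def f'_def)
  have "(u has_vector_derivative A (u t)) (at t)" for t
  proof -
    define T where "T = \<bar>t\<bar> + 1"
    define S where "S = {-T<..<T}"
    have tS: "t \<in> S" "open S" by (auto simp: T_def S_def)
    have "\<exists>g. \<forall>x\<in>S. (\<lambda>n. f n x) sums g x \<and> (g has_derivative (\<lambda>h. h *\<^sub>R A (u x))) (at x within S)"
    proof (rule has_derivative_series[OF _ _ _ tS(1)])
      show "convex S" by (simp add: S_def convex_real_interval)
      show "(f n has_derivative (\<lambda>h. h *\<^sub>R f' n t)) (at t within S)" for n t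
        using fd unfolding has_vector_derivative_def .
      show "(\<lambda>n. f n t) sums u t" using fsumm by (simp add: u_def summable_sums)
      fix e :: real assume e: "e > 0"
      have Sum: "(\<Sum>i<Suc n. h *\<^sub>R f' i s) = h *\<^sub>R A (\<Sum>i<n. f i s)" for n h s
        by (subst sum.lessThan_Suc_shift) (simp add: f'_def A.sum scaleR_sum_right)
      have "\<forall>\<^sub>F n in sequentially. \<forall>s\<in>S. dist (\<Sum>i<n. f i s) (u s) < e / (K + 1)"
        using uniform_limitD[OF ul[of T]] e K unfolding S_def by (simp add: add_nonneg_pos)
      then have "\<forall>\<^sub>F n in sequentially. \<forall>s\<in>S. \<forall>h. norm ((\<Sum>i<Suc n. h *\<^sub>R f' i s) - h *\<^sub>R A (u s)) \<le> e * norm h"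
      proof eventually_elim
        case (elim n)
        show ?case
        proof (intro ballI allI)
          fix s h assume s: "s \<in> S"
          have d: "norm ((\<Sum>i<n. f i s) - u s) \<le> e / (K + 1)" using elim s by (auto simp: dist_norm less_imp_le)
          have "norm ((\<Sum>i<Suc n. h *\<^sub>R f' i s) - h *\<^sub>R A (u s)) = \<bar>h\<bar> * norm (A ((\<Sum>i<n. f i s) - u s))"
            unfolding Sum by (simp add: A.diff flip: scaleR_diff_right)
          also have "\<dots> \<le> \<bar>h\<bar> * (norm ((\<Sum>i<n. f i s) - u s) * K)" by (intro mult_left_mono K) auto
          also have "\<dots> \<le> \<bar>h\<bar> * (e / (K + 1) * (K + 1))" using d K e by (intro mult_left_mono mult_mono) auto
          finally show "norm ((\<Sum>i<Suc n. h *\<^sub>R f' i s) - h *\<^sub>R A (u s)) \<le> e * norm h"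
            using K by (simp add: mult.commute)
        qed
      qed
      then show "\<forall>\<^sub>F n in sequentially. \<forall>s\<in>S. \<forall>h. norm ((\<Sum>i<n. h *\<^sub>R f' i s) - h *\<^sub>R A (u s)) \<le> e * norm h"
        by (rule eventually_sequentially_Suc[THEN iffD1])
    qed
    then obtain g where g: "\<And>x. x \<in> S \<Longrightarrow> (\<lambda>n. f n x) sums g x"
        "\<And>x. x \<in> S \<Longrightarrow> (g has_derivative (\<lambda>h. h *\<^sub>R A (u x))) (at x within S)" by blast
    have "g s = u s" if "s \<in> S" for s using g(1)[OF that] by (simp add: u_def sums_unique)
    then have "(u has_derivative (\<lambda>h. h *\<^sub>R A (u t))) (at t within S)"
      by (intro has_derivative_transform[OF tS(1) _ g(2)[OF tS(1)]]) simp
    then show ?thesis by (simp add: at_within_open[OF tS] has_vector_derivative_def)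
  qed
  moreover have "u 0 = x"
  proof -
    have "(\<lambda>n. f n 0) = (\<lambda>n. if n = 0 then x else 0)" by (auto simp: f_def)
    then show ?thesis using sums_unique[OF sums_single[of 0 "\<lambda>_. x"]] by (simp add: u_def)
  qed
  ultimately show thesis using that by blast
qed

text \<open>
  The derivative is taken within \<open>{0..}\<close> because semigroup orbits live on that half line.
\<close>

lemma real_growth_bound:
  fixes f :: "real \<Rightarrow> real"
  assumes d: "\<And>t. 0 \<le> t \<Longrightarrow> (f has_vector_derivative f' t) (at t within {0..})"
    and c: "\<And>t. 0 \<le> t \<Longrightarrow> f' t \<le> c" and t: "0 \<le> t"
  shows "f t \<le> f 0 + c * t"
proof -
  have "\<exists>s\<in>{0..t}. f t - f 0 = (t - 0) *\<^sub>R f' s"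
  proof (rule mvt_very_simple[OF t, of f "\<lambda>s h. h *\<^sub>R f' s"])
    fix s assume "0 \<le> s" "s \<le> t"
    then show "(f has_derivative (\<lambda>h. h *\<^sub>R f' s)) (at s within {0..t})"
      using has_derivative_subset[of f _ s "{0..}" "{0..t}"] d[of s]
      by (simp add: has_vector_derivative_def)
  qed
  then obtain s where s: "0 \<le> s" "f t - f 0 = t * f' s" by auto
  have "t * f' s \<le> t * c" using c s t by (intro mult_left_mono) auto
  then show ?thesis using s by (simp add: mult.commute)
qed

lemma has_vector_derivative_norm_sq:
  fixes u :: "real \<Rightarrow> 'a::real_inner"
  assumes "(u has_vector_derivative u') (at t within S)"
  shows "((\<lambda>t. (norm (u t))\<^sup>2) has_vector_derivative 2 * inner (u t) u') (at t within S)"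
  using bounded_bilinear.has_vector_derivative[OF bounded_bilinear_inner assms assms]
  by (simp add: power2_norm_eq_inner inner_commute)

lemma dissipative_orbit_norm_le:
  fixes u :: "real \<Rightarrow> 'a::real_inner"
  assumes d: "\<And>t. 0 \<le> t \<Longrightarrow> (u has_vector_derivative u' t) (at t within {0..})"
    and dis: "\<And>t. 0 \<le> t \<Longrightarrow> inner (u t) (u' t) \<le> 0" and t: "0 \<le> t"
  shows "norm (u t) \<le> norm (u 0)"
proof -
  have "(norm (u t))\<^sup>2 \<le> (norm (u 0))\<^sup>2 + 0 * t"
    by (rule real_growth_bound[OF has_vector_derivative_norm_sq[OF d] _ t]) (use dis in auto)
  then show ?thesis by (simp add: power2_le_iff_abs_le)
qed

lemma generator_eq_Some:
  "generator U x = Some y \<longleftrightarrow> ((\<lambda>t. (U t x - x) /\<^sub>R t) \<longlongrightarrow> y) (at_right 0)"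
  proof -
  have "Lim (at_right 0) (\<lambda>t. (U t x - x) /\<^sub>R t) = z"
    if "((\<lambda>t. (U t x - x) /\<^sub>R t) \<longlongrightarrow> z) (at_right 0)" for z
    using that by (intro tendsto_Lim) auto
  then show ?thesis unfolding generator_def by (cases "\<exists>z. ((\<lambda>t. (U t x - x) /\<^sub>R t) \<longlongrightarrow> z) (at_right 0)") auto
qed

lemma has_vector_derivative_shift_left:
  assumes "(f has_vector_derivative y) (at (c + t) within S')" "(\<lambda>s. c + s) ` S \<subseteq> S'"
  shows "((\<lambda>s. f (c + s)) has_vector_derivative y) (at (t::real) within S)"
proof -
  have "((\<lambda>s. c + s) has_vector_derivative 1) (at t within S)"
    by (auto intro!: derivative_eq_intros)
  from vector_diff_chain_within[OF this has_vector_derivative_within_subset[OF assms]]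
  show ?thesis by (simp add: o_def)
qed

lemma derivative_at_right_0:
  fixes f :: "real \<Rightarrow> 'a::real_normed_vector"
  assumes "(f has_vector_derivative y) (at t within {0..})" "0 \<le> t"
  shows "((\<lambda>h. (f (t + h) - f t) /\<^sub>R h) \<longlongrightarrow> y) (at_right 0)"
proof -
  have "((\<lambda>h. f (t + h)) has_vector_derivative y) (at 0 within {0..})"
    by (rule has_vector_derivative_shift_left[where S'="{0..}"]) (use assms in auto)
  then have "((\<lambda>h. (1 / norm (h - 0)) *\<^sub>R (f (t + h) - (f (t + 0) + (h - 0) *\<^sub>R y))) \<longlongrightarrow> 0) (at 0 within {0..})"
    unfolding has_vector_derivative_def has_derivative_within by blast
  then have "((\<lambda>h. (1 / norm (h - 0)) *\<^sub>R (f (t + h) - (f (t + 0) + (h - 0) *\<^sub>R y))) \<longlongrightarrow> 0) (at_right 0)"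
    by (rule tendsto_within_subset) auto
  then have "((\<lambda>h. (1 / norm (h - 0)) *\<^sub>R (f (t + h) - (f (t + 0) + (h - 0) *\<^sub>R y)) + y) \<longlongrightarrow> 0 + y) (at_right 0)"
    by (intro tendsto_add tendsto_const)
  moreover have "\<forall>\<^sub>F h in at_right 0. (1 / norm (h - 0)) *\<^sub>R (f (t + h) - (f (t + 0) + (h - 0) *\<^sub>R y)) + y
      = (f (t + h) - f t) /\<^sub>R h"
    using eventually_at_right_less[of 0]
  proof eventually_elim
    case (elim h)
    have "(1 / norm (h - 0)) *\<^sub>R (f (t + h) - (f (t + 0) + (h - 0) *\<^sub>R y)) + y
        = (1 / h) *\<^sub>R ((f (t + h) - f t) - h *\<^sub>R y) + y"
      using elim by (simp add: diff_diff_eq)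
    also have "\<dots> = (1 / h) *\<^sub>R (f (t + h) - f t) - y + y"
      using elim by (subst scaleR_diff_right) simp
    finally show ?case by (simp add: inverse_eq_divide)
  qed
  ultimately have "((\<lambda>h. (f (t + h) - f t) /\<^sub>R h) \<longlongrightarrow> 0 + y) (at_right 0)"
    by (rule Lim_transform_eventually)
  then show ?thesis by simp
qed

lemma integral_derivative:
  fixes f :: "real \<Rightarrow> 'a::banach"
  assumes "continuous_on {0..} f" "0 \<le> t"
  shows "((\<lambda>t. integral {0..t} f) has_vector_derivative f t) (at t within {0..})"
proof -
  have "((\<lambda>t. integral {0..t} f) has_vector_derivative f t) (at t within {0..t + 1})"
    using assms by (intro integral_has_vector_derivative) (auto intro: continuous_on_subset)
  moreover have "at t within {0..t + 1} = at t within {0..}"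
    by (rule at_within_nhd[of _ "{..<t + 1}"]) auto
  ultimately show ?thesis by simp
qed

text \<open>
  The generator is defined by right derivatives at \<open>0\<close>. Two-sided derivatives of orbits at later
  times come from the integral \<open>F(t)\<close> of \<open>s \<mapsto> U(s) x\<close> over \<open>{0..t}\<close>: the semigroup law gives
  \<open>U(h) F(t) - F(t) = (F(t + h) - F(t)) - F(h)\<close>, so \<open>F(t)\<close> lies in the domain of the generator, which maps it to
  \<open>U(t) x - x\<close>. Hence \<open>F(t) = R (U(t) x - x)\<close>, and as \<open>R\<close> commutes with \<open>U(t)\<close>, the orbit of \<open>R x\<close> is \<open>R x + F(t)\<close>.
\<close>

lemma orbit_of_inverse_generator:
  fixes R :: "'a::complex_hilbert \<Rightarrow> 'a"
  assumes U: "c0_semigroup U" and gen: "\<And>p q. generator U p = Some q \<longleftrightarrow> p = R q"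
    and t: "0 \<le> t"
  shows "U t (R q) = R (U t q)"
    and "((\<lambda>s. U s (R q)) has_vector_derivative U t q) (at t within {0..})"
proof -
  have bl: "bounded_linear (U t)" if "t \<ge> 0" for t using U that by (auto simp: c0_semigroup_def)
  have Us: "U (s + t) x = U s (U t x)" if "s \<ge> 0" "t \<ge> 0" for s t x
    using U that by (auto simp: c0_semigroup_def)
  have U0: "U 0 x = x" for x using U by (simp add: c0_semigroup_def)
  have cont: "continuous_on {0..} (\<lambda>t. U t x)" for x using U by (simp add: c0_semigroup_def)
  have comm: "U t (R q) = R (U t q)" if t: "0 \<le> t" for t q
  proof -
    have "((\<lambda>h. U t ((U h (R q) - R q) /\<^sub>R h)) \<longlongrightarrow> U t q) (at_right 0)"
      using gen[of "R q" q] by (intro bounded_linear.tendsto[OF bl[OF t]]) (simp add: generator_eq_Some)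
    moreover have "\<forall>\<^sub>F h in at_right 0. U t ((U h (R q) - R q) /\<^sub>R h) = (U h (U t (R q)) - U t (R q)) /\<^sub>R h"
      using eventually_at_right_less[of 0]
    proof eventually_elim
      case (elim h)
      have "U t (U h (R q)) = U h (U t (R q))" using Us[of t h] Us[of h t] t elim by (simp add: add.commute)
      then show ?case by (simp add: linear_simps(2,5)[OF bl[OF t]])
    qed
    ultimately have "((\<lambda>h. (U h (U t (R q)) - U t (R q)) /\<^sub>R h) \<longlongrightarrow> U t q) (at_right 0)"
      by (rule Lim_transform_eventually)
    then show ?thesis using gen by (simp flip: generator_eq_Some)
  qed
  show "U t (R q) = R (U t q)" by (rule comm[OF t])
  define F where "F = (\<lambda>x t. integral {0..t} (\<lambda>s. U s x))"
  have Fd: "((\<lambda>t. F x t) has_vector_derivative U t x) (at t within {0..})" if "0 \<le> t" for x t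
    unfolding F_def by (rule integral_derivative[OF cont that])
  have F0: "F x 0 = 0" for x by (simp add: F_def)
  have shift: "U h (F x t) = F x (t + h) - F x h" if h: "0 \<le> h" and t: "0 \<le> t" for h x t
  proof (rule has_integral_unique)
    have "((\<lambda>s. U s x) has_integral F x t) {0..t}"
      unfolding F_def by (intro integrable_integral integrable_continuous_interval continuous_on_subset[OF cont]) auto
    from has_integral_linear[OF this bl[OF h]]
    show "((\<lambda>s. U h (U s x)) has_integral U h (F x t)) {0..t}" by (simp add: o_def)
    have "((\<lambda>s. U h (U s x)) has_integral F x (h + t) - F x (h + 0)) {0..t}"
    proof (rule fundamental_theorem_of_calculus[OF t])
      fix s assume s: "s \<in> {0..t}"
      have "((\<lambda>s. F x (h + s)) has_vector_derivative U (h + s) x) (at s within {0..t})"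
        by (rule has_vector_derivative_shift_left[OF Fd]) (use s h in auto)
      then show "((\<lambda>s. F x (h + s)) has_vector_derivative U h (U s x)) (at s within {0..t})"
        using Us[of h s] s h by simp
    qed
    then show "((\<lambda>s. U h (U s x)) has_integral F x (t + h) - F x h) {0..t}" by (simp add: add.commute)
  qed
  have R: "F x t = R (U t x - x)" if t: "0 \<le> t" for x t
  proof -
    have "((\<lambda>h. (F x (t + h) - F x t) /\<^sub>R h - (F x (0 + h) - F x 0) /\<^sub>R h) \<longlongrightarrow> U t x - U 0 x) (at_right 0)"
      by (intro tendsto_diff derivative_at_right_0 Fd) (use t in auto)
    moreover have "\<forall>\<^sub>F h in at_right 0. (F x (t + h) - F x t) /\<^sub>R h - (F x (0 + h) - F x 0) /\<^sub>R h = (U h (F x t) - F x t) /\<^sub>R h"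
      using eventually_at_right_less[of 0]
    proof eventually_elim
      case (elim h)
      have "(F x (t + h) - F x t) - F x h = U h (F x t) - F x t" using shift[of h t x] t elim by simp
      then show ?case by (simp add: F0 flip: scaleR_diff_right)
    qed
    ultimately have "((\<lambda>h. (U h (F x t) - F x t) /\<^sub>R h) \<longlongrightarrow> U t x - U 0 x) (at_right 0)"
      by (rule Lim_transform_eventually)
    then have "generator U (F x t) = Some (U t x - x)" by (simp add: generator_eq_Some U0)
    then show ?thesis by (simp add: gen)
  qed
  (* R inherits additivity from the generator whose inverse it is. *)
  have Radd: "R (x + y) = R x + R y" for x y
  proof -
    have "generator U (R x + R y) = Some (x + y)"
    proof -
      have "((\<lambda>t. (U t (R x) - R x) /\<^sub>R t + (U t (R y) - R y) /\<^sub>R t) \<longlongrightarrow> x + y) (at_right 0)"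
        using gen[of "R x" x] gen[of "R y" y] by (intro tendsto_add) (simp_all add: generator_eq_Some)
      moreover have "\<forall>\<^sub>F t in at_right 0. (U t (R x) - R x) /\<^sub>R t + (U t (R y) - R y) /\<^sub>R t
          = (U t (R x + R y) - (R x + R y)) /\<^sub>R t"
        using eventually_at_right_less[of 0]
      proof eventually_elim
        case (elim t)
        have "(U t (R x) - R x) + (U t (R y) - R y) = U t (R x + R y) - (R x + R y)"
          using linear_simps(1)[OF bl[of t], of "R x" "R y"] elim by simp
        then show ?case by (simp flip: scaleR_add_right)
      qed
      ultimately show ?thesis unfolding generator_eq_Some by (rule Lim_transform_eventually)
    qed
    then show ?thesis by (simp add: gen)
  qed
  have eq: "U s (R q) = R q + F q s" if "0 \<le> s" for s
    using Radd[of "U s q - q" q] by (simp add: R[OF that] comm[OF that])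
  have "((\<lambda>s. R q + F q s) has_vector_derivative U t q) (at t within {0..})"
    using Fd[OF t] by (auto intro!: derivative_eq_intros)
  then show "((\<lambda>s. U s (R q)) has_vector_derivative U t q) (at t within {0..})"
    by (rule has_vector_derivative_transform[rotated 2]) (use t in \<open>simp_all add: eq\<close>)
qed

section \<open>The semigroup generated by the inverse of a dissipative operator\<close>

text \<open>
  A bounded dissipative \<open>R\<close> with dense range plays the role of the inverse of the generator. The
  approximating generators are \<open>(R - e)\<^sup>-\<^sup>1\<close> for \<open>e > 0\<close>; they are bounded and dissipative, and their semigroups
  converge to the one generated by \<open>R\<^sup>-\<^sup>1\<close>.
\<close>

locale dissipative_inverse =
  fixes R :: "'a::complex_hilbert \<Rightarrow> 'a"
  assumes R_bounded_clinear: "bounded_clinear R"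
    and R_dissipative: "\<And>x. inner x (R x) \<le> 0"
    and R_dense: "closure (range R) = UNIV"
begin

lemma R_bounded_linear: "bounded_linear R"
  using R_bounded_clinear by (simp add: bounded_clinear_def)

interpretation R: bounded_linear R by (rule R_bounded_linear)

text \<open>
  Since \<open>R = A\<^sup>-\<^sup>1\<close>, one has \<open>(R - e)\<^sup>-\<^sup>1 = A (1 - e A)\<^sup>-\<^sup>1\<close>, the Yosida approximation of \<open>A\<close>.
\<close>

definition yosida :: "real \<Rightarrow> 'a \<Rightarrow> 'a" where
  "yosida e x = inv (\<lambda>v. R v - e *\<^sub>R v) x"

lemma shifted_bij:
  assumes e: "e > 0"
  shows "bij (\<lambda>v. R v - e *\<^sub>R v)" "e * norm v \<le> norm (R v - e *\<^sub>R v)"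
proof -
  have bl: "bounded_linear (\<lambda>v. e *\<^sub>R v - R v)"
    by (intro bounded_linear_intros R_bounded_linear)
  have co: "e * (norm v)\<^sup>2 \<le> inner v (e *\<^sub>R v - R v)" for v
    using R_dissipative[of v] by (simp add: inner_diff_right power2_norm_eq_inner)
  have *: "R v - e *\<^sub>R v = - (e *\<^sub>R v - R v)" for v by simp
  have "bij (uminus \<circ> (\<lambda>v. e *\<^sub>R v - R v))"
    by (intro bij_comp coercive_bij(1)[OF bl e co] bij_uminus)
  then show "bij (\<lambda>v. R v - e *\<^sub>R v)" by (simp add: o_def)
  show "e * norm v \<le> norm (R v - e *\<^sub>R v)"
    using coercive_bij(2)[OF bl e co, of v] by (simp add: norm_minus_commute)
qed

context
  fixes e :: real
  assumes e: "e > 0"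
begin

lemma yosida_right: "R (yosida e x) - e *\<^sub>R yosida e x = x"
  unfolding yosida_def using surj_f_inv_f[OF bij_is_surj[OF shifted_bij(1)[OF e]], of x] .

lemma yosida_left: "yosida e (R v - e *\<^sub>R v) = v"
  unfolding yosida_def using inv_f_f[OF bij_is_inj[OF shifted_bij(1)[OF e]], of v] .

lemma yosida_eqI: "R v - e *\<^sub>R v = x \<Longrightarrow> yosida e x = v"
  using yosida_left by blast

lemma yosida_norm: "e * norm (yosida e x) \<le> norm x"
  using shifted_bij(2)[OF e, of "yosida e x"] by (simp add: yosida_right)

lemma yosida_bounded_linear: "bounded_linear (yosida e)"
proof (rule bounded_linear_intro[where K="1/e"])
  show "yosida e (x + y) = yosida e x + yosida e y" for x y
    by (rule yosida_eqI) (simp add: R.add scaleR_add_right yosida_right add_diff_add)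
  show "yosida e (r *\<^sub>R x) = r *\<^sub>R yosida e x" for r x
    by (rule yosida_eqI) (metis R.scaleR yosida_right scaleR_left_commute scaleR_right_diff_distrib)
  show "norm (yosida e x) \<le> norm x * (1 / e)" for x
    using yosida_norm[of x] e by (simp add: field_simps)
qed

lemma yosida_scaleC: "yosida e (a *\<^sub>C x) = a *\<^sub>C yosida e x"
proof (rule yosida_eqI)
  have "R (a *\<^sub>C yosida e x) - e *\<^sub>R (a *\<^sub>C yosida e x) = a *\<^sub>C (R (yosida e x) - e *\<^sub>R yosida e x)"
    using R_bounded_clinear
    by (simp add: bounded_clinear_def scaleC_scaleR linear_simps(2)[OF bounded_linear_scaleC])
  then show "R (a *\<^sub>C yosida e x) - e *\<^sub>R (a *\<^sub>C yosida e x) = a *\<^sub>C x" by (simp add: yosida_right)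
qed

lemma yosida_R: "yosida e (R x) = R (yosida e x)"
proof (rule yosida_eqI)
  have "R (R (yosida e x)) - e *\<^sub>R R (yosida e x) = R (R (yosida e x) - e *\<^sub>R yosida e x)"
    by (simp add: R.diff R.scaleR)
  then show "R (R (yosida e x)) - e *\<^sub>R R (yosida e x) = R x" by (simp add: yosida_right)
qed

lemma yosida_dissipative: "inner x (yosida e x) \<le> 0"
proof -
  define v where "v = yosida e x"
  have "inner (R v - e *\<^sub>R v) v = inner v (R v) - e * (norm v)\<^sup>2"
    by (simp add: inner_diff_left power2_norm_eq_inner inner_commute[of "R v"])
  also have "\<dots> \<le> 0 - e * 0" using R_dissipative[of v] e by (intro diff_mono mult_left_mono) auto
  finally show ?thesis using yosida_right[of x] by (simp add: v_def)
qed

end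

definition orbit :: "real \<Rightarrow> real \<Rightarrow> 'a \<Rightarrow> 'a" where
  "orbit e t x = (SOME u. u 0 = x \<and> (\<forall>t. (u has_vector_derivative yosida e (u t)) (at t))) t"

context
  fixes e :: real
  assumes e: "e > 0"
begin

lemma orbit_props:
  "orbit e 0 x = x" "((\<lambda>t. orbit e t x) has_vector_derivative yosida e (orbit e t x)) (at t)"
proof -
  have "\<exists>u. u 0 = x \<and> (\<forall>t. (u has_vector_derivative yosida e (u t)) (at t))"
    using bounded_ode_exists[OF yosida_bounded_linear[OF e]] by metis
  from someI_ex[OF this] show "orbit e 0 x = x"
    "((\<lambda>t. orbit e t x) has_vector_derivative yosida e (orbit e t x)) (at t)"
    unfolding orbit_def by auto
qed

lemma orbit_derivative_within:
  "((\<lambda>t. orbit e t x) has_vector_derivative yosida e (orbit e t x)) (at t within S)"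
  by (rule has_vector_derivative_at_within[OF orbit_props(2)])

lemma orbit_norm: "0 \<le> t \<Longrightarrow> norm (orbit e t x) \<le> norm x"
  using dissipative_orbit_norm_le[OF orbit_derivative_within, of x t] yosida_dissipative[OF e]
  by (simp add: orbit_props(1))

text \<open>
  Dissipativity makes solutions unique, and every algebraic law of the approximating semigroups
  follows by recognising both sides as solutions with the same initial value.
\<close>

lemma orbit_unique:
  assumes d: "\<And>t. 0 \<le> t \<Longrightarrow> (u has_vector_derivative yosida e (u t)) (at t within {0..})" and t: "0 \<le> t"
  shows "u t = orbit e t (u 0)"
proof -
  have "norm (u t - orbit e t (u 0)) \<le> norm (u 0 - orbit e 0 (u 0))"
  proof (rule dissipative_orbit_norm_le[of "\<lambda>t. u t - orbit e t (u 0)", OF _ _ t])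
    show "((\<lambda>t. u t - orbit e t (u 0)) has_vector_derivative yosida e (u t - orbit e t (u 0))) (at t within {0..})"
      if "0 \<le> t" for t
      unfolding linear_simps(2)[OF yosida_bounded_linear[OF e]]
      by (intro has_vector_derivative_diff d that orbit_derivative_within)
  qed (rule yosida_dissipative[OF e])
  then show ?thesis by (simp add: orbit_props(1))
qed

lemma orbit_commute:
  assumes P: "bounded_linear P" "\<And>x. P (yosida e x) = yosida e (P x)" and t: "0 \<le> t"
  shows "P (orbit e t x) = orbit e t (P x)"
proof -
  have "((\<lambda>t. P (orbit e t x)) has_vector_derivative yosida e (P (orbit e t x))) (at t within {0..})" for t
    using bounded_linear.has_vector_derivative[OF P(1) orbit_derivative_within] by (simp add: P(2))
  from orbit_unique[OF this t] show ?thesis by (simp add: orbit_props(1))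
qed

lemma orbit_add: "0 \<le> t \<Longrightarrow> orbit e t (x + y) = orbit e t x + orbit e t y"
  using orbit_unique[of "\<lambda>t. orbit e t x + orbit e t y" t]
  by (simp add: orbit_props(1) linear_simps(1)[OF yosida_bounded_linear[OF e]]
      has_vector_derivative_add orbit_derivative_within)

lemma orbit_scaleC: "0 \<le> t \<Longrightarrow> orbit e t (a *\<^sub>C x) = a *\<^sub>C orbit e t x"
  using orbit_commute[OF bounded_linear_scaleC] yosida_scaleC[OF e] by metis

lemma orbit_R: "0 \<le> t \<Longrightarrow> orbit e t (R x) = R (orbit e t x)"
  using orbit_commute[OF R_bounded_linear] yosida_R[OF e] by metis

lemma orbit_yosida: "0 \<le> t \<Longrightarrow> orbit e t (yosida e x) = yosida e (orbit e t x)"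
  using orbit_commute[OF yosida_bounded_linear[OF e]] by metis

lemma orbit_semigroup: "0 \<le> s \<Longrightarrow> 0 \<le> t \<Longrightarrow> orbit e (t + s) x = orbit e s (orbit e t x)"
  using orbit_unique[of "\<lambda>s. orbit e (t + s) x" s,
      OF has_vector_derivative_shift_left[OF orbit_derivative_within[where S=UNIV]]]
  by simp

lemma orbit_continuous: "continuous_on S (\<lambda>t. orbit e t x)"
  by (intro continuous_at_imp_continuous_on ballI has_vector_derivative_continuous[OF orbit_props(2)])

text \<open>
  The orbit is the derivative of \<open>R - e\<close> applied to it. This form survives the limit \<open>e \<rightarrow> 0\<close>,
  whereas the generators themselves do not converge on all vectors.
\<close>

lemma orbit_integral:
  assumes t: "0 \<le> t"
  shows "((\<lambda>s. orbit e s x) has_integral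
     (R (orbit e t x) - e *\<^sub>R orbit e t x) - (R x - e *\<^sub>R x)) {0..t}"
proof -
  have "((\<lambda>s. R (orbit e s x) - e *\<^sub>R orbit e s x) has_vector_derivative
      R (yosida e (orbit e s x)) - e *\<^sub>R yosida e (orbit e s x)) (at s within {0..t})" for s
    by (intro has_vector_derivative_diff bounded_linear.has_vector_derivative[OF R_bounded_linear]
        bounded_linear.has_vector_derivative[OF bounded_linear_scaleR_right] orbit_derivative_within)
  then show ?thesis
    using fundamental_theorem_of_calculus[OF t, of "\<lambda>s. R (orbit e s x) - e *\<^sub>R orbit e s x" "\<lambda>s. orbit e s x"]
    by (simp add: yosida_right[OF e] orbit_props(1))
qed

end

text \<open>
  For two parameters let \<open>v\<^sub>e\<close> and \<open>v\<^sub>d\<close> be the velocities of the orbits of \<open>R z\<close>. The difference of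
  the orbits is \<open>R (v\<^sub>e - v\<^sub>d) - (e v\<^sub>e - d v\<^sub>d)\<close>, so dissipativity of \<open>R\<close> leaves only the second term in the
  derivative of its squared norm; that term is small because the velocities stay below \<open>2 \<parallel>z\<parallel>\<close>.
\<close>

lemma orbit_cauchy_range:
  assumes e: "e > 0" and d: "d > 0" and t: "0 \<le> t"
  shows "(norm (orbit e t (R z) - orbit d t (R z)))\<^sup>2 \<le> 16 * (e + d) * (norm z)\<^sup>2 * t"
proof -
  define v where "v = (\<lambda>e t. yosida e (orbit e t (R z)))"
  have vn: "norm (v e t) \<le> 2 * norm z" if e: "e > 0" and t: "0 \<le> t" for e t
  proof -
    have "yosida e (R z) = z + e *\<^sub>R yosida e z"
      using yosida_left[OF e, of z] linear_simps(2,5)[OF yosida_bounded_linear[OF e]] by (simp add: diff_eq_eq)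
    then have "norm (yosida e (R z)) \<le> 2 * norm z"
      using yosida_norm[OF e, of z] norm_triangle_ineq[of z "e *\<^sub>R yosida e z"] e by simp
    then show ?thesis
      using orbit_norm[OF e t, of "yosida e (R z)"] by (simp add: v_def orbit_yosida[OF e t])
  qed
  have "(norm (orbit e t (R z) - orbit d t (R z)))\<^sup>2
      \<le> (norm (orbit e 0 (R z) - orbit d 0 (R z)))\<^sup>2 + 16 * (e + d) * (norm z)\<^sup>2 * t"
  proof (rule real_growth_bound[OF has_vector_derivative_norm_sq _ t])
    show "((\<lambda>t. orbit e t (R z) - orbit d t (R z)) has_vector_derivative v e t - v d t) (at t within {0..})" for t
      unfolding v_def by (intro has_vector_derivative_diff orbit_derivative_within e d)
    fix t :: real assume t: "0 \<le> t"
    define w where "w = v e t - v d t"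
    have wn: "norm w \<le> 4 * norm z"
      using norm_triangle_ineq4[of "v e t" "v d t"] vn[OF e t] vn[OF d t] by (simp add: w_def)
    have o: "orbit e t (R z) - orbit d t (R z) = R w - (e *\<^sub>R v e t - d *\<^sub>R v d t)"
      using yosida_right[OF e, of "orbit e t (R z)"] yosida_right[OF d, of "orbit d t (R z)"]
      by (simp add: v_def w_def R.diff algebra_simps)
    have "norm (e *\<^sub>R v e t - d *\<^sub>R v d t) \<le> e * norm (v e t) + d * norm (v d t)"
      using norm_triangle_ineq4[of "e *\<^sub>R v e t" "d *\<^sub>R v d t"] e d by simp
    also have "\<dots> \<le> e * (2 * norm z) + d * (2 * norm z)"
      using vn[OF e t] vn[OF d t] e d by (intro add_mono mult_left_mono) auto
    finally have en: "norm (e *\<^sub>R v e t - d *\<^sub>R v d t) \<le> 2 * (e + d) * norm z" by (simp add: algebra_simps)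
    have "inner (orbit e t (R z) - orbit d t (R z)) w = inner w (R w) - inner (e *\<^sub>R v e t - d *\<^sub>R v d t) w"
      unfolding o by (simp add: inner_diff_left inner_commute[of w])
    also have "\<dots> \<le> 0 + norm (e *\<^sub>R v e t - d *\<^sub>R v d t) * norm w"
      using R_dissipative[of w] norm_cauchy_schwarz[of "- (e *\<^sub>R v e t - d *\<^sub>R v d t)" w]
      unfolding inner_minus_left norm_minus_cancel by linarith
    also have "\<dots> \<le> 0 + (2 * (e + d) * norm z) * (4 * norm z)"
      using e d by (intro add_mono mult_mono en wn) auto
    finally show "2 * inner (orbit e t (R z) - orbit d t (R z)) (v e t - v d t) \<le> 16 * (e + d) * (norm z)\<^sup>2"
      by (simp add: w_def power2_eq_square algebra_simps)
  qed
  then show ?thesis by (simp add: orbit_props(1) e d)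
qed

definition flow :: "real \<Rightarrow> 'a \<Rightarrow> 'a" where
  "flow t x = lim (\<lambda>n. orbit (inverse (real (Suc n))) t x)"

text \<open>
  Orbits starting in the range of \<open>R\<close> converge by the previous estimate. All orbit maps are
  contractions and the range is dense, so the remaining orbits converge too.
\<close>

lemma flow_uniform_limit:
  assumes T: "0 \<le> T"
  shows "uniform_limit {0..T} (\<lambda>n t. orbit (inverse (real (Suc n))) t x) (\<lambda>t. flow t x) sequentially"
proof -
  have "uniformly_Cauchy_on {0..T} (\<lambda>n t. orbit (inverse (real (Suc n))) t x)"
  proof (rule uniformly_Cauchy_onI)
    fix eps :: real assume eps: "eps > 0"
    have "x \<in> closure (range R)" by (simp add: R_dense)
    then obtain z where z: "dist (R z) x < eps / 4"
      using closure_approachable[of x "range R"] eps by (metis (no_types, lifting) imageE zero_less_divide_iff zero_less_numeral)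
    define c where "c = 32 * (norm z)\<^sup>2 * T"
    have c: "c \<ge> 0" by (simp add: c_def T)
    obtain N where N: "c / (eps / 2)\<^sup>2 < real N" using reals_Archimedean2 by blast
    have cN: "c * inverse (real (Suc N)) < (eps / 2)\<^sup>2"
    proof -
      have "c / (eps / 2)\<^sup>2 < real (Suc N)" using N by simp
      then show ?thesis using eps by (simp add: field_simps)
    qed
    have "dist (orbit (inverse (real (Suc m))) t x) (orbit (inverse (real (Suc n))) t x) < eps"
      if t: "t \<in> {0..T}" and mn: "m \<ge> N" "n \<ge> N" for t m n
    proof -
      define e where "e = inverse (real (Suc m))"
      define d where "d = inverse (real (Suc n))"
      have ed: "e > 0" "d > 0" "e \<le> inverse (real (Suc N))" "d \<le> inverse (real (Suc N))"
        using mn by (auto simp: e_def d_def intro: le_imp_inverse_le)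
      have t0: "0 \<le> t" "t \<le> T" using t by auto
      have near: "norm (orbit a t x - orbit a t (R z)) < eps / 4" if "a > 0" for a
      proof -
        have "orbit a t x = orbit a t (x - R z) + orbit a t (R z)"
          using orbit_add[OF that t0(1), of "x - R z" "R z"] by simp
        then show ?thesis using orbit_norm[OF that t0(1), of "x - R z"] z by (simp add: dist_norm norm_minus_commute)
      qed
      have "(norm (orbit e t (R z) - orbit d t (R z)))\<^sup>2 \<le> 16 * (e + d) * (norm z)\<^sup>2 * t"
        by (rule orbit_cauchy_range[OF ed(1,2) t0(1)])
      also have "\<dots> \<le> 16 * (inverse (real (Suc N)) + inverse (real (Suc N))) * (norm z)\<^sup>2 * T"
        using ed t0 by (intro mult_mono add_mono) auto
      also have "\<dots> = c * inverse (real (Suc N))" by (simp add: c_def)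
      also have "\<dots> < (eps / 2)\<^sup>2" by (rule cN)
      finally have "norm (orbit e t (R z) - orbit d t (R z)) < eps / 2"
        using eps by (intro power_less_imp_less_base[of _ 2 "eps / 2"]) auto
      moreover have "norm (orbit e t x - orbit d t x) = norm ((orbit e t x - orbit e t (R z))
          + (orbit e t (R z) - orbit d t (R z)) - (orbit d t x - orbit d t (R z)))" by simp
      ultimately have "norm (orbit e t x - orbit d t x) < eps"
        using near[OF ed(1)] near[OF ed(2)]
          norm_triangle_ineq4[of "(orbit e t x - orbit e t (R z)) + (orbit e t (R z) - orbit d t (R z))" "orbit d t x - orbit d t (R z)"]
          norm_triangle_ineq[of "orbit e t x - orbit e t (R z)" "orbit e t (R z) - orbit d t (R z)"]
        by linarith
      then show ?thesis by (simp add: dist_norm e_def d_def)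
    qed
    then show "\<exists>M. \<forall>t\<in>{0..T}. \<forall>m\<ge>M. \<forall>n\<ge>M.
        dist (orbit (inverse (real (Suc m))) t x) (orbit (inverse (real (Suc n))) t x) < eps" by blast
  qed
  then show ?thesis
    unfolding flow_def uniformly_convergent_uniform_limit_iff[symmetric] by (rule Cauchy_uniformly_convergent)
qed

lemma flow_limit:
  assumes t: "0 \<le> t"
  shows "(\<lambda>n. orbit (inverse (real (Suc n))) t x) \<longlonglongrightarrow> flow t x"
  by (rule tendsto_uniform_limitI[OF flow_uniform_limit[OF t]]) (simp add: t)

lemma flow_norm: "0 \<le> t \<Longrightarrow> norm (flow t x) \<le> norm x"
  by (rule LIMSEQ_le_const2[OF tendsto_norm[OF flow_limit]]) (auto intro!: exI[of _ 0] orbit_norm)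

lemma flow_0: "flow 0 x = x"
  using flow_limit[of 0 x] by (simp add: orbit_props(1) LIMSEQ_const_iff)

lemma flow_add: "0 \<le> t \<Longrightarrow> flow t (x + y) = flow t x + flow t y"
  using LIMSEQ_unique[OF flow_limit[of t "x + y"]] tendsto_add[OF flow_limit[of t x] flow_limit[of t y]]
  by (simp add: orbit_add)

lemma flow_scaleC: "0 \<le> t \<Longrightarrow> flow t (a *\<^sub>C x) = a *\<^sub>C flow t x"
  using LIMSEQ_unique[OF flow_limit[of t "a *\<^sub>C x"]] bounded_linear.tendsto[OF bounded_linear_scaleC flow_limit[of t x], of a]
  by (simp add: orbit_scaleC)

lemma flow_R: "0 \<le> t \<Longrightarrow> flow t (R x) = R (flow t x)"
  using LIMSEQ_unique[OF flow_limit[of t "R x"]] bounded_linear.tendsto[OF R_bounded_linear flow_limit[of t x]]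
  by (simp add: orbit_R)

lemma flow_bounded_linear: "0 \<le> t \<Longrightarrow> bounded_linear (flow t)"
  using flow_add flow_scaleC[of t "complex_of_real r" for r] flow_norm
  by (intro bounded_linear_intro[where K=1]) (auto simp: scaleC_complex_of_real)

lemma flow_semigroup:
  assumes s: "0 \<le> s" and t: "0 \<le> t"
  shows "flow (s + t) x = flow s (flow t x)"
proof -
  let ?e = "\<lambda>n. inverse (real (Suc n))"
  have "(\<lambda>n. orbit (?e n) s (orbit (?e n) t x - flow t x)) \<longlonglongrightarrow> 0"
  proof (rule Lim_null_comparison)
    show "\<forall>\<^sub>F n in sequentially. norm (orbit (?e n) s (orbit (?e n) t x - flow t x)) \<le> norm (orbit (?e n) t x - flow t x)"
      using orbit_norm[OF _ s] by simp
    show "(\<lambda>n. norm (orbit (?e n) t x - flow t x)) \<longlonglongrightarrow> 0"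
      using flow_limit[OF t, of x] by (simp add: LIM_zero tendsto_norm_zero)
  qed
  from tendsto_add[OF this flow_limit[OF s, of "flow t x"]]
  have "(\<lambda>n. orbit (?e n) s (orbit (?e n) t x)) \<longlonglongrightarrow> flow s (flow t x)"
    by (simp flip: orbit_add[OF _ s])
  then have "(\<lambda>n. orbit (?e n) (t + s) x) \<longlonglongrightarrow> flow s (flow t x)"
    using s t by (simp add: orbit_semigroup)
  then show ?thesis using LIMSEQ_unique[OF flow_limit[of "t + s" x]] s t by (simp add: add.commute)
qed

lemma flow_continuous: "continuous_on {0..} (\<lambda>t. flow t x)"
proof -
  have c: "continuous_on {0..T} (\<lambda>t. flow t x)" if "0 \<le> T" for T
  proof (rule uniform_limit_theorem[OF _ flow_uniform_limit[OF that]])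
    show "\<forall>\<^sub>F n in sequentially. continuous_on {0..T} (\<lambda>t. orbit (inverse (real (Suc n))) t x)"
      by (auto intro!: always_eventually orbit_continuous)
  qed simp
  show ?thesis
    unfolding continuous_on_eq_continuous_within
  proof
    fix t :: real assume "t \<in> {0..}"
    then have "continuous (at t within {0..t + 1}) (\<lambda>t. flow t x)"
      using c[of "t + 1"] by (auto simp: continuous_on_eq_continuous_within)
    moreover have "at t within {0..t + 1} = at t within {0..}"
      by (rule at_within_nhd[of _ "{..<t + 1}"]) auto
    ultimately show "continuous (at t within {0..}) (\<lambda>t. flow t x)" by simp
  qed
qed

lemma flow_integral:
  assumes t: "0 \<le> t"
  shows "((\<lambda>s. flow s x) has_integral R (flow t x - x)) {0..t}"
proof -
  let ?e = "\<lambda>n. inverse (real (Suc n))"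
  obtain I J where I: "\<And>n. ((\<lambda>s. orbit (?e n) s x) has_integral I n) {0..t}"
    and J: "((\<lambda>s. flow s x) has_integral J) {0..t}" "I \<longlonglongrightarrow> J"
    by (rule uniform_limit_integral[OF flow_uniform_limit[OF t]])
       (auto intro!: orbit_continuous)
  have "I n = (R (orbit (?e n) t x) - ?e n *\<^sub>R orbit (?e n) t x) - (R x - ?e n *\<^sub>R x)" for n
    by (rule has_integral_unique[OF I orbit_integral[OF _ t]]) simp
  then have "I = (\<lambda>n. (R (orbit (?e n) t x) - ?e n *\<^sub>R orbit (?e n) t x) - (R x - ?e n *\<^sub>R x))" by auto
  moreover have "\<dots> \<longlonglongrightarrow> (R (flow t x) - 0 *\<^sub>R flow t x) - (R x - 0 *\<^sub>R x)"
    by (intro tendsto_intros R.tendsto flow_limit[OF t] LIMSEQ_inverse_real_of_nat)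
  ultimately have "J = R (flow t x) - R x" using LIMSEQ_unique[OF J(2)] by simp
  then show ?thesis using J(1) by (simp add: R.diff)
qed

lemma flow_c0_semigroup: "c0_semigroup flow"
  unfolding c0_semigroup_def
  using flow_bounded_linear flow_scaleC flow_0 flow_semigroup flow_continuous by (auto simp: fun_eq_iff)

text \<open>
  By \<open>flow_integral\<close>, \<open>R (U(t) x - x) / t\<close> is the mean of the orbit over \<open>{0..t}\<close> and tends to
  \<open>x\<close>. If the difference quotient of \<open>x = p\<close> converges to \<open>q\<close>, then this mean converges to \<open>R q\<close>,
  so \<open>p = R q\<close>. Conversely, as \<open>R\<close> commutes with the flow, the mean for \<open>x = q\<close> is the difference quotient of
  \<open>R q\<close>.
\<close>

lemma flow_generator: "generator flow p = Some q \<longleftrightarrow> p = R q"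
proof -
  have d: "((\<lambda>t. (R (flow t x - x)) /\<^sub>R t) \<longlongrightarrow> x) (at_right 0)" for x
  proof -
    have "((\<lambda>h. (integral {0..0 + h} (\<lambda>s. flow s x) - integral {0..0} (\<lambda>s. flow s x)) /\<^sub>R h) \<longlongrightarrow> flow 0 x) (at_right 0)"
      by (rule derivative_at_right_0[OF integral_derivative[OF flow_continuous]]) auto
    moreover have "\<forall>\<^sub>F h in at_right 0. (integral {0..0 + h} (\<lambda>s. flow s x) - integral {0..0} (\<lambda>s. flow s x)) /\<^sub>R h
        = (R (flow h x - x)) /\<^sub>R h"
      using eventually_at_right_less[of 0]
      by eventually_elim (simp add: integral_unique[OF flow_integral])
    ultimately show ?thesis by (simp add: flow_0 Lim_transform_eventually)
  qed
  show ?thesis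
  proof
    assume "generator flow p = Some q"
    then have "((\<lambda>t. R ((flow t p - p) /\<^sub>R t)) \<longlongrightarrow> R q) (at_right 0)"
      by (intro R.tendsto) (simp add: generator_eq_Some)
    then show "p = R q" using d[of p] tendsto_unique[of "at_right (0::real)"] by (force simp: R.scaleR)
  next
    assume p: "p = R q"
    have "\<forall>\<^sub>F t in at_right 0. (R (flow t q - q)) /\<^sub>R t = (flow t p - p) /\<^sub>R t"
      using eventually_at_right_less[of 0] by eventually_elim (simp add: p flow_R R.diff)
    then show "generator flow p = Some q"
      unfolding generator_eq_Some by (rule Lim_transform_eventually[OF d])
  qed
qed

lemma generates:
  assumes A: "\<And>p q. A p = Some q \<longleftrightarrow> p = R q"
  shows "c0_semigroup (exp_semigroup A)" "generator (exp_semigroup A) = A"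
proof -
  have "generator flow = A" by (rule map_eqI) (simp add: flow_generator A)
  then have "\<exists>U. c0_semigroup U \<and> generator U = A" using flow_c0_semigroup by blast
  from someI_ex[OF this] show "c0_semigroup (exp_semigroup A)" "generator (exp_semigroup A) = A"
    by (auto simp: exp_semigroup_def)
qed

end

section \<open>Spectrum and growth in terms of the inverse of the generator\<close>

lemma vector_growth_bound:
  fixes u :: "real \<Rightarrow> 'a::real_inner"
  assumes d: "\<And>t. 0 \<le> t \<Longrightarrow> (u has_vector_derivative u' t) (at t within {0..})"
    and c: "\<And>t. 0 \<le> t \<Longrightarrow> norm (u' t) \<le> c" and t: "0 \<le> t"
  shows "norm (u t - u 0) \<le> c * t"
proof (cases "u t = u 0")
  case True
  have "0 \<le> c" using c[of 0] norm_ge_zero order_trans by blast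
  then show ?thesis using True t by simp
next
  case False
  define w where "w = u t - u 0"
  have "inner w (u t) \<le> inner w (u 0) + (norm w * c) * t"
  proof (rule real_growth_bound[OF _ _ t])
    show "((\<lambda>t. inner w (u t)) has_vector_derivative inner w (u' t)) (at t within {0..})" if "0 \<le> t" for t
      by (rule bounded_linear.has_vector_derivative[OF bounded_linear_inner_right d[OF that]])
    show "inner w (u' t) \<le> norm w * c" if "0 \<le> t" for t
      using norm_cauchy_schwarz[of w "u' t"] mult_left_mono[OF c[OF that], of "norm w"] by simp
  qed
  then have "norm w * norm w \<le> norm w * (c * t)"
    by (simp add: w_def inner_diff_right flip: power2_norm_eq_inner power2_eq_square)
      (simp add: power2_norm_eq_inner inner_diff_right mult.assoc)
  then show ?thesis using False by (simp add: w_def)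
qed

text \<open>
  With \<open>R = A\<^sup>-\<^sup>1\<close> and \<open>p = R q\<close> this says \<open>\<parallel>(A - l) p\<parallel> \<le> e \<parallel>p\<parallel>\<close> for some \<open>p \<noteq> 0\<close>.
\<close>

definition approx_eigenvalue :: "('a::complex_hilbert \<Rightarrow> 'a) \<Rightarrow> real \<Rightarrow> bool" where
  "approx_eigenvalue R l \<longleftrightarrow> (\<forall>e>0. \<exists>q. R q \<noteq> 0 \<and> norm (q - l *\<^sub>R R q) \<le> e * norm (R q))"

lemma approx_eigenvalue_in_spectrum:
  assumes A: "\<And>p q. A p = Some q \<longleftrightarrow> p = R q" and l: "approx_eigenvalue R l"
  shows "complex_of_real l \<in> spectrum A"
proof -
  have "\<not> (\<forall>x\<in>dom A. norm x \<le> b * norm (A \<cdot> x - complex_of_real l *\<^sub>C x))" for b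
  proof
    assume *: "\<forall>x\<in>dom A. norm x \<le> b * norm (A \<cdot> x - complex_of_real l *\<^sub>C x)"
    have "1 / (2 * (\<bar>b\<bar> + 1)) > 0" by (simp add: add_nonneg_pos)
    then obtain q where q: "R q \<noteq> 0" "norm (q - l *\<^sub>R R q) \<le> (1 / (2 * (\<bar>b\<bar> + 1))) * norm (R q)"
      using l unfolding approx_eigenvalue_def by blast
    have Aq: "A (R q) = Some q" using A by simp
    then have "norm (R q) \<le> b * norm (q - l *\<^sub>R R q)"
      using *[rule_format, of "R q"] by (auto simp: scaleC_complex_of_real)
    also have "\<dots> \<le> (\<bar>b\<bar> + 1) * ((1 / (2 * (\<bar>b\<bar> + 1))) * norm (R q))"
      using q(2) by (intro mult_mono) auto
    also have "\<dots> = norm (R q) / 2" by (simp add: field_simps add_nonneg_pos)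
    finally show False using q(1) by simp
  qed
  then show ?thesis unfolding spectrum_def by blast
qed

text \<open>
  The orbit of an approximate eigenvector \<open>p\<close> stays close to \<open>e\<^sup>l\<^sup>t p\<close> for a long time, hence cannot
  decay at a rate faster than \<open>l\<close>.
\<close>

lemma approx_eigenvalue_le_growth:
  fixes R :: "'a::complex_hilbert \<Rightarrow> 'a"
  assumes U: "c0_semigroup U" and gen: "\<And>p q. generator U p = Some q \<longleftrightarrow> p = R q"
    and l: "approx_eigenvalue R l"
    and b: "\<And>t. 0 \<le> t \<Longrightarrow> onorm (U t) \<le> c * exp (\<beta> * t)"
  shows "l \<le> \<beta>"
proof (rule ccontr)
  assume "\<not> l \<le> \<beta>"
  then have bl: "\<beta> < l" by simp
  have blU: "bounded_linear (U t)" if "0 \<le> t" for t using U that by (auto simp: c0_semigroup_def)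
  have nU: "norm (U t x) \<le> c * exp (\<beta> * t) * norm x" if "0 \<le> t" for t x
    using onorm[OF blU[OF that], of x] mult_right_mono[OF b[OF that] norm_ge_zero[of x]] by simp
  have c0: "0 \<le> c" using b[of 0] onorm_pos_le[OF blU[of 0]] by simp
  (* At this time the assumed bound, rescaled by exp (- l t), is at most 1 / 2. *)
  define t where "t = ln (2 * c + 1) / (l - \<beta>)"
  have t: "0 \<le> t" using c0 bl by (simp add: t_def)
  have ect: "exp (- l * t) * (c * exp (\<beta> * t)) \<le> 1 / 2"
  proof -
    have "exp (- l * t) * exp (\<beta> * t) = exp (- ((l - \<beta>) * t))"
      by (simp add: algebra_simps flip: exp_add)
    also have "\<dots> = 1 / (2 * c + 1)" using bl c0 by (simp add: t_def exp_minus inverse_eq_divide)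
    finally have "exp (- l * t) * (c * exp (\<beta> * t)) = c / (2 * c + 1)" by (simp add: mult.left_commute)
    moreover have "c / (2 * c + 1) \<le> 1 / 2" using c0 by (simp add: field_simps)
    ultimately show ?thesis by simp
  qed
  (* With this accuracy the rescaled orbit moves by at most a quarter of its initial norm up to
     time t, but it would have to lose half of it. *)
  define e where "e = 1 / (4 * (c * t + 1))"
  have ct: "0 \<le> c * t" using c0 t by simp
  have "e > 0" using ct by (simp add: e_def add_nonneg_pos)
  then obtain q where q: "R q \<noteq> 0" "norm (q - l *\<^sub>R R q) \<le> e * norm (R q)"
    using l unfolding approx_eigenvalue_def by blast
  define h where "h = q - l *\<^sub>R R q"
  define v where "v = (\<lambda>t. exp (- l * t) *\<^sub>R U t (R q))"
  have "norm (v t - v 0) \<le> (c * norm h) * t"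
  proof (rule vector_growth_bound[OF _ _ t])
    fix t :: real assume t: "0 \<le> t"
    have "((\<lambda>t. exp (- l * t)) has_real_derivative - l * exp (- l * t)) (at t within {0..})"
      by (auto intro!: derivative_eq_intros)
    then have "(v has_vector_derivative exp (- l * t) *\<^sub>R U t q + (- l * exp (- l * t)) *\<^sub>R U t (R q)) (at t within {0..})"
      unfolding v_def by (rule has_vector_derivative_scaleR) (rule orbit_of_inverse_generator(2)[OF U gen t])
    moreover have "exp (- l * t) *\<^sub>R U t q + (- l * exp (- l * t)) *\<^sub>R U t (R q) = exp (- l * t) *\<^sub>R U t h"
      by (simp add: h_def linear_simps(2,5)[OF blU[OF t]] scaleR_diff_right mult.commute)
    ultimately show "(v has_vector_derivative exp (- l * t) *\<^sub>R U t h) (at t within {0..})" by simp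
    have "norm (exp (- l * t) *\<^sub>R U t h) \<le> exp (- l * t) * (c * exp (\<beta> * t) * norm h)"
      using nU[OF t, of h] by simp
    also have "\<dots> = exp ((\<beta> - l) * t) * (c * norm h)"
      by (simp add: left_diff_distrib exp_diff exp_minus field_simps)
    also have "\<dots> \<le> 1 * (c * norm h)"
      using bl t c0 by (intro mult_right_mono) (auto simp: mult_nonpos_nonneg)
    finally show "norm (exp (- l * t) *\<^sub>R U t h) \<le> c * norm h" by simp
  qed
  moreover have "v 0 = R q" using U by (simp add: v_def c0_semigroup_def)
  moreover have "norm (v t) \<le> 1 / 2 * norm (R q)"
  proof -
    have "norm (v t) \<le> exp (- l * t) * (c * exp (\<beta> * t) * norm (R q))"
      using nU[OF t, of "R q"] by (simp add: v_def)
    also have "\<dots> \<le> 1 / 2 * norm (R q)"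
      using mult_right_mono[OF ect norm_ge_zero[of "R q"]] by (simp add: mult_ac)
    finally show ?thesis .
  qed
  moreover have "(c * norm h) * t \<le> 1 / 4 * norm (R q)"
  proof -
    have "(c * norm h) * t = (c * t) * norm h" by simp
    also have "\<dots> \<le> (c * t + 1) * (e * norm (R q))"
      using q(2) ct unfolding h_def by (intro mult_mono) auto
    also have "\<dots> = 1 / 4 * norm (R q)" using ct by (simp add: e_def field_simps add_nonneg_pos)
    finally show ?thesis .
  qed
  moreover have "norm (R q) \<le> norm (v t) + norm (v t - R q)"
    using norm_triangle_ineq4[of "v t" "v t - R q"] by simp
  ultimately have "norm (R q) \<le> 3 / 4 * norm (R q)" by (simp only:)
  then show False using q(1) by simp
qed

lemma resolvent_point:
  fixes R :: "'a::complex_hilbert \<Rightarrow> 'a"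
  assumes A: "\<And>p q. A p = Some q \<longleftrightarrow> p = R q" and R: "bounded_linear R"
    and surj: "\<And>h. \<exists>q. q - l *\<^sub>C R q = h"
    and low: "\<And>q. norm q \<le> b * norm (q - l *\<^sub>C R q)"
  shows "l \<notin> spectrum A"
proof -
  interpret R: bounded_linear R by fact
  have dom: "dom A = range R" by (rule dom_eq_range[OF A])
  have AR: "A \<cdot> (R q) = q" for q using A[of "R q" q] by simp
  obtain K where K: "K \<ge> 0" "\<And>q. norm (R q) \<le> norm q * K" using R.nonneg_bounded by blast
  have "inj_on (\<lambda>x. A \<cdot> x - l *\<^sub>C x) (dom A)"
  proof (rule inj_onI)
    fix p p' assume pp: "p \<in> dom A" "p' \<in> dom A" "A \<cdot> p - l *\<^sub>C p = A \<cdot> p' - l *\<^sub>C p'"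
    then obtain q q' where q: "p = R q" "p' = R q'" by (auto simp: dom)
    have "(q - q') - l *\<^sub>C R (q - q') = (A \<cdot> p - l *\<^sub>C p) - (A \<cdot> p' - l *\<^sub>C p')"
      by (simp add: q AR R.diff linear_simps(2)[OF bounded_linear_scaleC])
    then have "norm (q - q') \<le> 0" using low[of "q - q'"] pp(3) by simp
    then show "p = p'" using q by simp
  qed
  moreover have "(\<lambda>x. A \<cdot> x - l *\<^sub>C x) ` dom A = UNIV"
  proof -
    have "h \<in> (\<lambda>x. A \<cdot> x - l *\<^sub>C x) ` dom A" for h
    proof -
      obtain q where "q - l *\<^sub>C R q = h" using surj by blast
      then show ?thesis by (intro image_eqI[of _ _ "R q"]) (auto simp: AR dom)
    qed
    then show ?thesis by blast
  qed
  moreover have "norm x \<le> (K * b) * norm (A \<cdot> x - l *\<^sub>C x)" if x: "x \<in> dom A" for x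
  proof -
    obtain q where q: "x = R q" using x unfolding dom by blast
    have "norm (R q) \<le> norm q * K" by (rule K)
    also have "\<dots> \<le> (b * norm (q - l *\<^sub>C R q)) * K" by (intro mult_right_mono low K)
    finally show ?thesis by (simp add: q AR mult_ac)
  qed
  ultimately show ?thesis unfolding spectrum_def bij_betw_def by blast
qed

lemma inner_scaleC_right: "inner x (a *\<^sub>C y) = Re (a * cinner x y)"
  by (simp add: cinner_scaleC_right flip: Re_cinner)

lemma cinner_self_symmetric:
  assumes "bounded_clinear F" "symmetric F"
  shows "cinner x (F x) = complex_of_real (inner x (F x))"
proof -
  have "cinner x (F x) = cnj (cinner x (F x))"
    using cinner_symmetric[OF assms, of x x] cinner_commute[of x "F x"] by metis
  then have "Im (cinner x (F x)) = 0" by (metis cnj.simps(2) equal_neg_zero)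
  then show ?thesis by (simp add: complex_eq_iff Re_cinner)
qed

section \<open>The damped system in bounded form\<close>

text \<open>
  \<open>B\<close> is the inverse of \<open>K\<^sup>1\<^sup>/\<^sup>2\<close>, \<open>Mh\<close> is \<open>M\<^sup>1\<^sup>/\<^sup>2\<close> with inverse \<open>Q\<close>. Vectors of the domain of
  \<open>K\<^sup>1\<^sup>/\<^sup>2\<close> are written \<open>B x\<close>, so that \<open>\<parallel>x\<parallel>\<^sup>2\<close> is the stiffness form.
\<close>

locale damped_system =
  fixes B Mh Q C :: "'a::complex_hilbert \<Rightarrow> 'a"
  assumes B: "bounded_clinear B" "symmetric B" "closure (range B) = UNIV"
    and Mh: "bounded_clinear Mh" "symmetric Mh"
    and Q: "bounded_linear Q" "\<And>x. Q (Mh x) = x" "\<And>x. Mh (Q x) = x"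
    and C: "bounded_clinear C" "symmetric C" "\<And>x. 0 \<le> inner x (C x)"
begin

lemma bounded_ops: "bounded_linear B" "bounded_linear Mh" "bounded_linear C"
  using B(1) Mh(1) C(1) by (simp_all add: bounded_clinear_def)

lemma scaleC_ops: "B (a *\<^sub>C x) = a *\<^sub>C B x" "Mh (a *\<^sub>C x) = a *\<^sub>C Mh x" "C (a *\<^sub>C x) = a *\<^sub>C C x"
  using B(1) Mh(1) C(1) by (simp_all add: bounded_clinear_def)

lemma symmetric_ops: "inner (B x) y = inner x (B y)" "inner (Mh x) y = inner x (Mh y)" "inner (C x) y = inner x (C y)"
  using B(2) Mh(2) C(2) by (simp_all add: symmetric_def)

interpretation B: bounded_linear B by (rule bounded_ops)
interpretation Mh: bounded_linear Mh by (rule bounded_ops)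
interpretation C: bounded_linear C by (rule bounded_ops)
interpretation scaleC: bounded_linear "\<lambda>x::'a. a *\<^sub>C x" for a by (rule bounded_linear_scaleC)

text \<open>
  The inverse of the phase space operator: solving \<open>A (x, y) = (f, h)\<close> for \<open>y = Mh (B f)\<close> and
  then for \<open>x\<close>.
\<close>

definition phase_inverse :: "'a \<times> 'a \<Rightarrow> 'a \<times> 'a" where
  "phase_inverse q = (- B (C (B (fst q))) - B (Mh (snd q)), Mh (B (fst q)))"

lemma phase_inverse_bounded_linear: "bounded_linear phase_inverse"
  unfolding phase_inverse_def
  by (intro bounded_linear_Pair bounded_linear_sub bounded_linear_minus
      bounded_linear_compose[OF bounded_ops(1)] bounded_linear_compose[OF bounded_ops(2)] bounded_linear_compose[OF bounded_ops(3)]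
      bounded_linear_fst bounded_linear_snd)

lemma phase_inverse_bounded_clinear: "bounded_clinear phase_inverse"
  unfolding bounded_clinear_def
  using phase_inverse_bounded_linear
  by (auto simp: phase_inverse_def scaleC_prod_def scaleC_ops scaleC.diff scaleC.neg)

sublocale inv: dissipative_inverse phase_inverse
proof
  show "bounded_clinear phase_inverse" by (rule phase_inverse_bounded_clinear)
  show "inner q (phase_inverse q) \<le> 0" for q
  proof -
    have "inner q (phase_inverse q) = - inner (B (fst q)) (C (B (fst q)))"
      by (simp add: phase_inverse_def inner_prod_def inner_diff_right symmetric_ops inner_commute[of "Mh (snd q)"])
        (metis inner_commute symmetric_ops(1,2))
    then show ?thesis using C(3) by simp
  qed
  have "range phase_inverse = range B \<times> Mh ` range B"
  proof (intro set_eqI iffI)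
    fix p assume "p \<in> range phase_inverse"
    then obtain q where "p = phase_inverse q" by blast
    moreover have "- B (C (B (fst q))) - B (Mh (snd q)) = B (- C (B (fst q)) - Mh (snd q))"
      by (simp add: B.diff B.neg)
    ultimately show "p \<in> range B \<times> Mh ` range B" by (auto simp: phase_inverse_def)
  next
    fix p assume "p \<in> range B \<times> Mh ` range B"
    then obtain a f where p: "p = (B a, Mh (B f))" by auto
    have "p = phase_inverse (f, Q (- a - C (B f)))"
      by (simp add: p phase_inverse_def Q(3) B.diff B.neg)
    then show "p \<in> range phase_inverse" by blast
  qed
  moreover have "closure (Mh ` range B) = UNIV"
  proof -
    have "UNIV = Mh ` closure (range B)" unfolding B(3) using Q(3) by (metis surj_def)
    then show ?thesis using closure_bounded_linear_image_subset[OF bounded_ops(2), of "range B"] by blast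
  qed
  ultimately show "closure (range phase_inverse) = UNIV" by (simp add: closure_Times B(3))
qed

definition cform :: "'a \<Rightarrow> real" where "cform u = inner u (C u)"
definition mform :: "'a \<Rightarrow> real" where "mform u = (norm (Mh u))\<^sup>2"
definition qform :: "real \<Rightarrow> 'a \<Rightarrow> real" where
  "qform r x = (norm x)\<^sup>2 + r * cform (B x) + r\<^sup>2 * mform (B x)"

text \<open>
  This is \<open>B (K + l C + l\<^sup>2 M) B\<close>, a bounded operator; \<open>qform\<close> is its form for real \<open>l\<close>.
\<close>

definition pencil :: "complex \<Rightarrow> 'a \<Rightarrow> 'a" where
  "pencil l x = x + l *\<^sub>C B (C (B x)) + l\<^sup>2 *\<^sub>C B (Mh (Mh (B x)))"

lemma cform_nonneg: "0 \<le> cform u" using C(3) by (simp add: cform_def)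
lemma mform_nonneg: "0 \<le> mform u" by (simp add: mform_def)

lemma cform_bound: obtains c where "c \<ge> 0" "\<And>u. cform u \<le> c * (norm u)\<^sup>2"
proof -
  obtain K where K: "K \<ge> 0" "\<And>x. norm (C x) \<le> norm x * K" using C.nonneg_bounded by blast
  have "cform u \<le> K * (norm u)\<^sup>2" for u
    using norm_cauchy_schwarz[of u "C u"] mult_left_mono[OF K(2)[of u] norm_ge_zero[of u]]
    by (simp add: cform_def power2_eq_square mult_ac)
  with K that show thesis by blast
qed

lemma mform_lower: obtains m where "m > 0" "\<And>u. m * (norm u)\<^sup>2 \<le> mform u"
proof -
  obtain K where K: "K > 0" "\<And>x. norm (Q x) \<le> norm x * K" using bounded_linear.pos_bounded[OF Q(1)] by blast
  have "(1 / K\<^sup>2) * (norm u)\<^sup>2 \<le> mform u" for u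
  proof -
    have "(norm u)\<^sup>2 \<le> (norm (Mh u) * K)\<^sup>2" using K(2)[of "Mh u"] Q(2) by (simp add: power_mono)
    then show ?thesis using K(1) by (simp add: mform_def power_mult_distrib field_simps)
  qed
  with K that[of "1 / K\<^sup>2"] show thesis by simp
qed

lemma pencil_bounded_clinear: "bounded_clinear (pencil l)"
proof -
  have "bounded_linear (pencil l)"
    unfolding pencil_def
    by (intro bounded_linear_add bounded_linear_compose[OF bounded_linear_scaleC]
        bounded_linear_compose[OF bounded_ops(1)] bounded_linear_compose[OF bounded_ops(2)] bounded_linear_compose[OF bounded_ops(3)]
        bounded_linear_ident)
  then show ?thesis
    by (auto simp: bounded_clinear_def pencil_def scaleC_ops scaleC_add_right scaleC_scaleC mult.commute)
qed

lemma pencil_of_real: "pencil (complex_of_real r) x = x + r *\<^sub>R B (C (B x)) + r\<^sup>2 *\<^sub>R B (Mh (Mh (B x)))"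
  unfolding pencil_def by (simp add: scaleC_complex_of_real flip: of_real_power)

lemma inner_pencil_of_real: "inner x (pencil (complex_of_real r) x) = qform r x"
  unfolding pencil_of_real qform_def cform_def mform_def
  by (simp add: inner_add_right symmetric_ops power2_norm_eq_inner flip: symmetric_ops(1))

lemma pencil_symmetric: "symmetric (pencil (complex_of_real r))"
  by (simp add: symmetric_def pencil_of_real inner_add_left inner_add_right symmetric_ops)

lemma inner_BCB: "cinner x (B (C (B x))) = complex_of_real (cform (B x))"
proof -
  have "bounded_clinear (\<lambda>x. B (C (B x)))" "symmetric (\<lambda>x. B (C (B x)))"
    using bounded_linear_compose[OF bounded_ops(1) bounded_linear_compose[OF bounded_ops(3) bounded_ops(1)]]
    by (auto simp: bounded_clinear_def symmetric_def scaleC_ops symmetric_ops o_def)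
  from cinner_self_symmetric[OF this, of x] show ?thesis by (simp add: cform_def flip: symmetric_ops(1))
qed

lemma inner_BMB: "cinner x (B (Mh (Mh (B x)))) = complex_of_real (mform (B x))"
proof -
  have "bounded_clinear (\<lambda>x. B (Mh (Mh (B x))))" "symmetric (\<lambda>x. B (Mh (Mh (B x))))"
    using bounded_linear_compose[OF bounded_ops(1) bounded_linear_compose[OF bounded_ops(2) bounded_linear_compose[OF bounded_ops(2) bounded_ops(1)]]]
    by (auto simp: bounded_clinear_def symmetric_def scaleC_ops symmetric_ops o_def)
  from cinner_self_symmetric[OF this, of x] show ?thesis
    by (simp add: mform_def power2_norm_eq_inner symmetric_ops flip: symmetric_ops(1))
qed

lemma cinner_pencil:
  "cinner x (pencil l x) = complex_of_real ((norm x)\<^sup>2) + l * complex_of_real (cform (B x)) + l\<^sup>2 * complex_of_real (mform (B x))"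
proof -
  have "cinner x x = complex_of_real ((norm x)\<^sup>2)"
    using cinner_self_symmetric[of "\<lambda>x. x" x] by (simp add: bounded_clinear_def symmetric_def power2_norm_eq_inner bounded_linear_ident)
  then show ?thesis unfolding pencil_def cinner_add_right cinner_scaleC_right inner_BCB inner_BMB by simp
qed

text \<open>
  With \<open>x = K\<^sup>1\<^sup>/\<^sup>2 u\<close>, \<open>y = M\<^sup>1\<^sup>/\<^sup>2 u'\<close> and \<open>u(t) = e\<^sup>r\<^sup>t z(t)\<close> this is, up to the factor \<open>2 e\<^sup>2\<^sup>r\<^sup>t\<close>,
  the energy of \<open>z\<close>: \<open>qform\<close> is the potential energy of the shifted system, the square is the kinetic energy.
\<close>

definition energy :: "real \<Rightarrow> 'a \<times> 'a \<Rightarrow> real" where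
  "energy r p = qform r (fst p) + (norm (snd p - r *\<^sub>R Mh (B (fst p))))\<^sup>2"

text \<open>
  The following two properties of \<open>g\<close> express that no quadratic polynomial \<open>r \<mapsto> qform r x\<close> has a root with real
  part above \<open>g\<close>.
\<close>

context
  fixes g :: real
  assumes g1: "\<And>x. 0 \<le> cform (B x) + 2 * g * mform (B x)"
    and g2: "\<And>x. 0 \<le> qform g x"
begin

text \<open>
  Expanding around \<open>g\<close> gives \<open>qform r x \<ge> (r - g)\<^sup>2 mform (B x)\<close>, which controls \<open>\<parallel>B x\<parallel>\<^sup>2\<close>. As
  \<open>qform r x\<close> differs from \<open>\<parallel>x\<parallel>\<^sup>2\<close> by a form bounded in terms of \<open>\<parallel>B x\<parallel>\<^sup>2\<close>, a weighted sum of the two lower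
  bounds controls \<open>\<parallel>x\<parallel>\<^sup>2\<close>.
\<close>

lemma qform_coercive:
  assumes r: "g < r"
  obtains th where "th > 0" "\<And>x. th * (norm x)\<^sup>2 \<le> qform r x"
proof -
  obtain c where c: "c \<ge> 0" "\<And>u. cform u \<le> c * (norm u)\<^sup>2" using cform_bound by blast
  obtain m where m: "m > 0" "\<And>u. m * (norm u)\<^sup>2 \<le> mform u" using mform_lower by blast
  define d where "d = (r - g)\<^sup>2 * m"
  define L where "L = \<bar>r\<bar> * c"
  have d: "d > 0" and L: "L \<ge> 0" using r m c by (auto simp: d_def L_def)
  have 1: "d * (norm (B x))\<^sup>2 \<le> qform r x" for x
  proof -
    have "qform r x = qform g x + (r - g) * (cform (B x) + 2 * g * mform (B x)) + (r - g)\<^sup>2 * mform (B x)"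
      by (simp add: qform_def power2_eq_square algebra_simps)
    moreover have "(r - g) * (cform (B x) + 2 * g * mform (B x)) \<ge> 0" using g1[of x] r by simp
    moreover have "d * (norm (B x))\<^sup>2 \<le> (r - g)\<^sup>2 * mform (B x)"
      using mult_left_mono[OF m(2)[of "B x"], of "(r - g)\<^sup>2"] by (simp add: d_def mult.assoc)
    ultimately show ?thesis using g2[of x] by linarith
  qed
  have 2: "(norm x)\<^sup>2 - L * (norm (B x))\<^sup>2 \<le> qform r x" for x
  proof -
    have "- (r * cform (B x)) \<le> \<bar>r\<bar> * cform (B x)"
      using mult_right_mono[OF abs_ge_minus_self[of r] cform_nonneg[of "B x"]] by simp
    also have "\<dots> \<le> L * (norm (B x))\<^sup>2"
      using mult_left_mono[OF c(2)[of "B x"], of "\<bar>r\<bar>"] by (simp add: L_def mult.assoc)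
    finally have "- (r * cform (B x)) \<le> L * (norm (B x))\<^sup>2" .
    moreover have "0 \<le> r\<^sup>2 * mform (B x)" by (simp add: mform_nonneg)
    ultimately show ?thesis unfolding qform_def by linarith
  qed
  show thesis
  proof (rule that[of "d / (L + d)"])
    show "d / (L + d) > 0" using d L by simp
    fix x
    have "L * (d * (norm (B x))\<^sup>2) \<le> L * qform r x" by (intro mult_left_mono 1 L)
    moreover have "d * ((norm x)\<^sup>2 - L * (norm (B x))\<^sup>2) \<le> d * qform r x"
      using d by (intro mult_left_mono 2) auto
    ultimately have "d * (norm x)\<^sup>2 \<le> (L + d) * qform r x" by (simp add: algebra_simps)
    then show "d / (L + d) * (norm x)\<^sup>2 \<le> qform r x" using d L by (simp add: field_simps)
  qed
qed

text \<open>
  Put \<open>l = r + \<mu>\<close> with \<open>r > g\<close> real and \<open>Re \<mu> > 0\<close>. In powers of \<open>\<mu>\<close> the form of the pencil has the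
  coefficients \<open>mform\<close>, \<open>cform + 2 r mform\<close> and \<open>qform r\<close>, all nonnegative and the last one coercive. After
  multiplication by the conjugate of \<open>\<mu>\<close> the three terms have nonnegative real parts, so the product is coercive.
\<close>

lemma pencil_invertible:
  assumes l: "g < Re l"
  obtains k where "k > 0" "\<And>x. k * norm x \<le> norm (pencil l x)" "\<And>y. \<exists>x. pencil l x = y"
proof -
  define r where "r = (Re l + g) / 2"
  define mu where "mu = l - complex_of_real r"
  have r: "g < r" and mu: "Re mu > 0" using l by (auto simp: r_def mu_def field_simps)
  have lmu: "l = mu + complex_of_real r" by (simp add: mu_def)
  obtain th where th: "th > 0" "\<And>x. th * (norm x)\<^sup>2 \<le> qform r x" using qform_coercive[OF r] by blast
  define T where "T = (\<lambda>x. cnj mu *\<^sub>C pencil l x)"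
  have blT: "bounded_linear T" unfolding T_def
    using pencil_bounded_clinear[of l] by (intro bounded_linear_compose[OF bounded_linear_scaleC]) (simp add: bounded_clinear_def)
  have co: "(Re mu * th) * (norm x)\<^sup>2 \<le> inner x (T x)" for x
  proof -
    let ?k = "(norm x)\<^sup>2" and ?c = "cform (B x)" and ?m = "mform (B x)"
    have "inner x (T x) = Re (cnj mu * (complex_of_real ?k + l * complex_of_real ?c + l\<^sup>2 * complex_of_real ?m))"
      unfolding T_def inner_scaleC_right cinner_pencil ..
    also have "\<dots> = ((Re mu)\<^sup>2 + (Im mu)\<^sup>2) * (Re mu * ?m + (?c + 2 * r * ?m)) + Re mu * qform r x"
      unfolding lmu qform_def by (simp add: power2_eq_square algebra_simps)
    also have "\<dots> \<ge> 0 + Re mu * (th * ?k)"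
    proof (intro add_mono mult_left_mono mult_nonneg_nonneg)
      have "?c + 2 * r * ?m = (?c + 2 * g * ?m) + 2 * (r - g) * ?m" by (simp add: algebra_simps)
      moreover have "0 \<le> 2 * (r - g) * ?m" using r mform_nonneg by simp
      moreover have "0 \<le> Re mu * ?m" using mu mform_nonneg by simp
      ultimately show "0 \<le> Re mu * ?m + (?c + 2 * r * ?m)" using g1[of x] by linarith
    qed (use mu th in auto)
    finally show ?thesis by (simp add: mult.assoc)
  qed
  have pos: "Re mu * th > 0" using mu th by simp
  have mu0: "mu \<noteq> 0" using mu by auto
  show thesis
  proof (rule that[of "Re mu * th / cmod mu"])
    show "Re mu * th / cmod mu > 0" using pos mu0 by simp
    show "Re mu * th / cmod mu * norm x \<le> norm (pencil l x)" for x
      using coercive_bij(2)[OF blT pos co, of x] mu0 by (simp add: T_def norm_scaleC field_simps)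
    show "\<exists>x. pencil l x = y" for y
    proof -
      obtain x where "T x = cnj mu *\<^sub>C y" using coercive_bij(1)[OF blT pos co] by (metis bij_pointE)
      then have "inverse (cnj mu) *\<^sub>C T x = inverse (cnj mu) *\<^sub>C (cnj mu *\<^sub>C y)" by simp
      then have "pencil l x = y" using mu0 by (simp add: T_def scaleC_scaleC)
      then show ?thesis by blast
    qed
  qed
qed

text \<open>
  Eliminating the second component from \<open>q - l R q = h\<close>, where \<open>R\<close> is \<open>phase_inverse\<close>, leaves an
  equation for the pencil.
\<close>

lemma right_half_plane_resolvent:
  assumes A: "\<And>p q. A p = Some q \<longleftrightarrow> p = phase_inverse q" and l: "g < Re l"
  shows "l \<notin> spectrum A"
proof -
  obtain k where k: "k > 0" "\<And>x. k * norm x \<le> norm (pencil l x)" "\<And>y. \<exists>x. pencil l x = y"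
    using pencil_invertible[OF l] by blast
  obtain b1 where b1: "b1 \<ge> 0" "\<And>x. norm (B (Mh x)) \<le> norm x * b1"
    using bounded_linear.nonneg_bounded[OF bounded_linear_compose[OF bounded_ops(1) bounded_ops(2)]] by (auto simp: o_def)
  obtain b2 where b2: "b2 \<ge> 0" "\<And>x. norm (Mh (B x)) \<le> norm x * b2"
    using bounded_linear.nonneg_bounded[OF bounded_linear_compose[OF bounded_ops(2) bounded_ops(1)]] by (auto simp: o_def)
  have step: "pencil l f = fst h - l *\<^sub>C B (Mh (snd h)) \<and> v = snd h + l *\<^sub>C Mh (B f)
      \<longleftrightarrow> (f, v) - l *\<^sub>C phase_inverse (f, v) = h" for f v h
  proof -
    have eq: "(f, v) - l *\<^sub>C phase_inverse (f, v) = (f + l *\<^sub>C B (C (B f)) + l *\<^sub>C B (Mh v), v - l *\<^sub>C Mh (B f))"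
      by (simp add: phase_inverse_def scaleC_prod_def scaleC.diff scaleC.neg)
    moreover have "l *\<^sub>C B (Mh (snd h + l *\<^sub>C Mh (B f))) = l *\<^sub>C B (Mh (snd h)) + l\<^sup>2 *\<^sub>C B (Mh (Mh (B f)))"
      by (simp add: Mh.add B.add scaleC_ops scaleC_add_right scaleC_scaleC power2_eq_square)
    ultimately show ?thesis
      unfolding eq by (subst prod_eq_iff) (auto simp: pencil_def algebra_simps)
  qed
  show ?thesis
  proof (rule resolvent_point[OF A phase_inverse_bounded_linear])
    fix h :: "'a \<times> 'a"
    obtain f where "pencil l f = fst h - l *\<^sub>C B (Mh (snd h))" using k(3) by blast
    then show "\<exists>q. q - l *\<^sub>C phase_inverse q = h" using step by blast
  next
    fix q :: "'a \<times> 'a"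
    define h where "h = q - l *\<^sub>C phase_inverse q"
    obtain f v where q: "q = (f, v)" by (cases q)
    have f: "pencil l f = fst h - l *\<^sub>C B (Mh (snd h))" and v: "v = snd h + l *\<^sub>C Mh (B f)"
      using step[of f h v] by (auto simp: h_def q)
    have n1: "norm (fst h) \<le> norm h" and n2: "norm (snd h) \<le> norm h"
      by (metis norm_fst_le prod.collapse) (metis norm_snd_le prod.collapse)
    have "k * norm f \<le> norm (fst h) + norm (l *\<^sub>C B (Mh (snd h)))"
      using k(2)[of f] norm_triangle_ineq4[of "fst h" "l *\<^sub>C B (Mh (snd h))"] by (simp add: f)
    also have "\<dots> \<le> norm h + cmod l * (norm h * b1)"
    proof (intro add_mono n1)
      have "norm (B (Mh (snd h))) \<le> norm h * b1"
        using b1(2)[of "snd h"] mult_right_mono[OF n2 b1(1)] by linarith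
      then show "norm (l *\<^sub>C B (Mh (snd h))) \<le> cmod l * (norm h * b1)"
        by (simp add: norm_scaleC mult_left_mono)
    qed
    finally have nf: "norm f \<le> ((1 + cmod l * b1) / k) * norm h" using k(1) by (simp add: field_simps)
    have "norm v \<le> norm (snd h) + norm (l *\<^sub>C Mh (B f))" unfolding v by (rule norm_triangle_ineq)
    also have "\<dots> \<le> norm h + cmod l * ((((1 + cmod l * b1) / k) * norm h) * b2)"
    proof (intro add_mono n2)
      have "norm (Mh (B f)) \<le> (((1 + cmod l * b1) / k) * norm h) * b2"
        using b2(2)[of f] mult_right_mono[OF nf b2(1)] by linarith
      then show "norm (l *\<^sub>C Mh (B f)) \<le> cmod l * ((((1 + cmod l * b1) / k) * norm h) * b2)"
        unfolding norm_scaleC by (rule mult_left_mono) simp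
    qed
    finally have nv: "norm v \<le> norm h + cmod l * ((((1 + cmod l * b1) / k) * norm h) * b2)" .
    have "norm q \<le> norm f + norm v" unfolding q by (rule norm_Pair_le)
    also have "\<dots> \<le> ((1 + cmod l * b1) / k + 1 + cmod l * (((1 + cmod l * b1) / k) * b2)) * norm h"
      using nf nv by (simp add: algebra_simps)
    finally show "norm q \<le> ((1 + cmod l * b1) / k + 1 + cmod l * (((1 + cmod l * b1) / k) * b2)) * norm (q - l *\<^sub>C phase_inverse q)"
      by (simp add: h_def)
  qed
qed

lemma energy_lower:
  assumes r: "g < r"
  obtains k where "k > 0" "\<And>p. k * (norm p)\<^sup>2 \<le> energy r p"
proof -
  obtain th where th: "th > 0" "\<And>x. th * (norm x)\<^sup>2 \<le> qform r x" using qform_coercive[OF r] by blast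
  obtain b where b: "b \<ge> 0" "\<And>x. norm (r *\<^sub>R Mh (B x)) \<le> norm x * b"
    using bounded_linear.nonneg_bounded[OF bounded_linear_compose[OF bounded_linear_scaleR_right bounded_linear_compose[OF bounded_ops(2) bounded_ops(1)]], of r]
    by (auto simp: o_def)
  define s where "s = 1 / (2 + (1 + 2 * b\<^sup>2) / th)"
  have den: "2 + (1 + 2 * b\<^sup>2) / th > 0" using th by (simp add: add_pos_nonneg)
  show thesis
  proof (rule that[of s])
    show "s > 0" unfolding s_def using den by simp
    fix p :: "'a \<times> 'a"
    obtain x y where p: "p = (x, y)" by (cases p)
    define w where "w = y - r *\<^sub>R Mh (B x)"
    have E: "energy r p = qform r x + (norm w)\<^sup>2" by (simp add: energy_def p w_def)
    have "norm y \<le> norm w + norm x * b"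
      using norm_triangle_ineq[of w "r *\<^sub>R Mh (B x)"] b(2)[of x] by (simp add: w_def)
    then have "(norm y)\<^sup>2 \<le> (norm w + norm x * b)\<^sup>2" by (simp add: power_mono)
    also have "\<dots> \<le> 2 * (norm w)\<^sup>2 + 2 * (norm x * b)\<^sup>2"
      using zero_le_power2[of "norm w - norm x * b"] by (simp add: power2_sum power2_diff)
    finally have y: "(norm y)\<^sup>2 \<le> 2 * (norm w)\<^sup>2 + 2 * b\<^sup>2 * (norm x)\<^sup>2" by (simp add: power_mult_distrib mult_ac)
    have q0: "0 \<le> qform r x" using th(2)[of x] th(1) by (meson less_imp_le mult_nonneg_nonneg order_trans zero_le_power2)
    have x: "(norm x)\<^sup>2 \<le> qform r x / th" using th by (simp add: field_simps)
    have "(norm p)\<^sup>2 = (norm x)\<^sup>2 + (norm y)\<^sup>2" by (simp add: p norm_Pair)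
    also have "\<dots> \<le> 2 * (norm w)\<^sup>2 + (1 + 2 * b\<^sup>2) * (norm x)\<^sup>2" using y by (simp add: algebra_simps)
    also have "\<dots> \<le> 2 * (norm w)\<^sup>2 + (1 + 2 * b\<^sup>2) * (qform r x / th)"
      using x by (intro add_left_mono mult_left_mono) auto
    also have "\<dots> \<le> (2 + (1 + 2 * b\<^sup>2) / th) * (qform r x + (norm w)\<^sup>2)"
      using th q0 by (simp add: field_simps)
    finally show "s * (norm p)\<^sup>2 \<le> energy r p" unfolding s_def E using den by (simp add: field_simps)
  qed
qed

text \<open>
  For an orbit through \<open>phase_inverse q\<close> the velocity is \<open>q\<close>, so the left side is half the derivative of
  the energy. The difference of both sides is the damping form of the shifted system, \<open>cform + 2 r mform\<close>, at
  \<open>w = u' - r u\<close>.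
\<close>

lemma energy_dissipation:
  assumes r: "g < r"
  shows "inner (fst q) (pencil (complex_of_real r) (fst (phase_inverse q)))
      + inner (snd (phase_inverse q) - r *\<^sub>R Mh (B (fst (phase_inverse q)))) (snd q - r *\<^sub>R Mh (B (fst q)))
    \<le> r * energy r (phase_inverse q)"
proof -
  define f where "f = fst q"
  define h where "h = snd q"
  define x where "x = fst (phase_inverse q)"
  define w where "w = B f - r *\<^sub>R B x"
  have y: "snd (phase_inverse q) = Mh (B f)" by (simp add: phase_inverse_def f_def)
  have xdef: "x = - B (C (B f)) - B (Mh h)" by (simp add: x_def phase_inverse_def f_def h_def)
  have Px: "pencil (complex_of_real r) x = B (- C w - Mh h + r\<^sup>2 *\<^sub>R Mh (Mh (B x)))"
  proof -
    have "pencil (complex_of_real r) x = (- B (C (B f)) - B (Mh h)) + r *\<^sub>R B (C (B x)) + r\<^sup>2 *\<^sub>R B (Mh (Mh (B x)))"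
      unfolding pencil_of_real xdef ..
    then show ?thesis by (simp add: w_def B.add B.diff B.neg B.scaleR C.diff C.scaleR)
  qed
  have "inner f (pencil (complex_of_real r) x) + inner (Mh (B f) - r *\<^sub>R Mh (B x)) (h - r *\<^sub>R Mh (B f))
      - r * energy r (phase_inverse q)
    = inner (f - r *\<^sub>R x) (pencil (complex_of_real r) x) + inner (Mh w) (h - r *\<^sub>R Mh (B f)) - r * inner (Mh w) (Mh w)"
    unfolding energy_def y x_def[symmetric] inner_pencil_of_real[symmetric]
    by (simp add: w_def inner_diff_left Mh.diff Mh.scaleR power2_norm_eq_inner algebra_simps)
  also have "inner (f - r *\<^sub>R x) (pencil (complex_of_real r) x) = inner w (- C w - Mh h + r\<^sup>2 *\<^sub>R Mh (Mh (B x)))"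
    unfolding Px by (simp add: w_def B.diff B.scaleR flip: symmetric_ops(1))
  also have "inner (Mh w) (h - r *\<^sub>R Mh (B f)) = inner w (Mh h - r *\<^sub>R Mh (Mh (B f)))"
    by (simp add: symmetric_ops Mh.diff Mh.scaleR)
  also have "inner w (- C w - Mh h + r\<^sup>2 *\<^sub>R Mh (Mh (B x))) + inner w (Mh h - r *\<^sub>R Mh (Mh (B f))) - r * inner (Mh w) (Mh w)
      = - inner w (C w) - r * inner w (Mh (Mh w)) - r * inner (Mh w) (Mh w)"
    by (simp add: w_def Mh.diff Mh.scaleR inner_add_right inner_diff_right power2_eq_square algebra_simps)
  also have "\<dots> = - (cform w + 2 * r * mform w)"
    by (simp add: cform_def mform_def power2_norm_eq_inner flip: symmetric_ops(2))
  also have "\<dots> \<le> 0"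
  proof -
    have "w = B (f - r *\<^sub>R x)" by (simp add: w_def B.diff B.scaleR)
    then have "0 \<le> cform w + 2 * g * mform w" using g1 by simp
    also have "\<dots> \<le> cform w + 2 * r * mform w" using r mform_nonneg[of w] by (simp add: mult_right_mono)
    finally show ?thesis by simp
  qed
  finally show ?thesis by (simp add: f_def h_def x_def y)
qed

end

end

context damped_system
begin

interpretation B: bounded_linear B by (rule bounded_ops)
interpretation Mh: bounded_linear Mh by (rule bounded_ops)
interpretation C: bounded_linear C by (rule bounded_ops)

lemma energy_upper:
  obtains k where "k \<ge> 0" "\<And>p. energy r p \<le> k * (norm p)\<^sup>2"
proof -
  have "bounded_linear (pencil (complex_of_real r))"
    using pencil_bounded_clinear by (simp add: bounded_clinear_def)
  then obtain a where a: "a \<ge> 0" "\<And>x. norm (pencil (complex_of_real r) x) \<le> norm x * a"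
    using bounded_linear.nonneg_bounded by blast
  have "bounded_linear (\<lambda>p. snd p - r *\<^sub>R Mh (B (fst p)))"
    by (intro bounded_linear_sub bounded_linear_snd bounded_linear_compose[OF bounded_linear_scaleR_right]
        bounded_linear_compose[OF bounded_ops(2)] bounded_linear_compose[OF bounded_ops(1)] bounded_linear_fst)
  then obtain b where b: "b \<ge> 0" "\<And>p. norm (snd p - r *\<^sub>R Mh (B (fst p))) \<le> norm p * b"
    using bounded_linear.nonneg_bounded by blast
  have "energy r p \<le> (a + b\<^sup>2) * (norm p)\<^sup>2" for p
  proof -
    have f: "norm (fst p) \<le> norm p" by (metis norm_fst_le prod.collapse)
    have "qform r (fst p) \<le> norm (fst p) * norm (pencil (complex_of_real r) (fst p))"
      unfolding inner_pencil_of_real[symmetric] by (rule norm_cauchy_schwarz)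
    also have "\<dots> \<le> norm p * (norm p * a)"
      using a f by (intro mult_mono order_trans[OF a(2)] mult_right_mono) auto
    finally have 1: "qform r (fst p) \<le> a * (norm p)\<^sup>2" by (simp add: power2_eq_square mult_ac)
    have "(norm (snd p - r *\<^sub>R Mh (B (fst p))))\<^sup>2 \<le> (norm p * b)\<^sup>2" by (intro power_mono b) auto
    then show ?thesis using 1 by (simp add: energy_def power_mult_distrib algebra_simps)
  qed
  moreover have "a + b\<^sup>2 \<ge> 0" using a by simp
  ultimately show thesis using that by blast
qed

lemma energy_derivative:
  assumes p: "(p has_vector_derivative p') (at t within S)"
  shows "((\<lambda>t. energy r (p t)) has_vector_derivative
     2 * (inner (fst p') (pencil (complex_of_real r) (fst (p t)))
        + inner (snd (p t) - r *\<^sub>R Mh (B (fst (p t)))) (snd p' - r *\<^sub>R Mh (B (fst p'))))) (at t within S)"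
proof -
  let ?P = "pencil (complex_of_real r)"
  have blP: "bounded_linear ?P" using pencil_bounded_clinear by (simp add: bounded_clinear_def)
  have f: "((\<lambda>t. fst (p t)) has_vector_derivative fst p') (at t within S)"
    and s: "((\<lambda>t. snd (p t)) has_vector_derivative snd p') (at t within S)"
    using bounded_linear.has_vector_derivative[OF bounded_linear_fst p]
      bounded_linear.has_vector_derivative[OF bounded_linear_snd p] by auto
  have "((\<lambda>t. inner (fst (p t)) (?P (fst (p t)))) has_vector_derivative
      inner (fst (p t)) (?P (fst p')) + inner (fst p') (?P (fst (p t)))) (at t within S)"
    by (rule bounded_bilinear.has_vector_derivative[OF bounded_bilinear_inner f
          bounded_linear.has_vector_derivative[OF blP f]])
  moreover have "inner (fst (p t)) (?P (fst p')) = inner (fst p') (?P (fst (p t)))"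
    using pencil_symmetric[of r] unfolding symmetric_def by (metis inner_commute)
  ultimately have 1: "((\<lambda>t. qform r (fst (p t))) has_vector_derivative
      2 * inner (fst p') (?P (fst (p t)))) (at t within S)"
    by (simp add: inner_pencil_of_real)
  have "((\<lambda>t. snd (p t) - r *\<^sub>R Mh (B (fst (p t)))) has_vector_derivative
      snd p' - r *\<^sub>R Mh (B (fst p'))) (at t within S)"
    by (intro has_vector_derivative_diff s bounded_linear.has_vector_derivative[OF bounded_linear_scaleR_right]
        bounded_linear.has_vector_derivative[OF bounded_ops(2)] bounded_linear.has_vector_derivative[OF bounded_ops(1)] f)
  from has_vector_derivative_add[OF 1 has_vector_derivative_norm_sq[OF this]]
  show ?thesis unfolding energy_def by (simp add: distrib_left)
qed

text \<open>
  The energy at rate \<open>r\<close> grows at most like \<open>e\<^sup>2\<^sup>r\<^sup>t\<close> and is equivalent to the squared norm. This bounds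
  orbits starting in the domain of the generator, and the others by density.
\<close>

lemma semigroup_growth:
  assumes g1: "\<And>x. 0 \<le> cform (B x) + 2 * g * mform (B x)" and g2: "\<And>x. 0 \<le> qform g x"
    and r: "g < r"
    and U: "c0_semigroup U" and gen: "\<And>p q. generator U p = Some q \<longleftrightarrow> p = phase_inverse q"
  shows "\<exists>c. \<forall>t\<ge>0. onorm (U t) \<le> c * exp (r * t)"
proof -
  obtain k where k: "k > 0" "\<And>p. k * (norm p)\<^sup>2 \<le> energy r p" using energy_lower[OF g1 g2 r] by blast
  obtain K where K: "K \<ge> 0" "\<And>p. energy r p \<le> K * (norm p)\<^sup>2" using energy_upper by blast
  have blU: "bounded_linear (U t)" if "0 \<le> t" for t using U that by (auto simp: c0_semigroup_def)
  have range: "norm (U t (phase_inverse q)) \<le> (sqrt (K / k) * exp (r * t)) * norm (phase_inverse q)" if t: "0 \<le> t" for t q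
  proof -
    let ?p = "\<lambda>t. U t (phase_inverse q)"
    have "exp (- 2 * r * t) *\<^sub>R energy r (?p t) \<le> exp (- 2 * r * 0) *\<^sub>R energy r (?p 0) + 0 * t"
    proof (rule real_growth_bound[OF _ _ t])
      fix t :: real assume t: "0 \<le> t"
      let ?D = "inner (fst (U t q)) (pencil (complex_of_real r) (fst (?p t)))
        + inner (snd (?p t) - r *\<^sub>R Mh (B (fst (?p t)))) (snd (U t q) - r *\<^sub>R Mh (B (fst (U t q))))"
      have "((\<lambda>t. exp (- 2 * r * t)) has_real_derivative - 2 * r * exp (- 2 * r * t)) (at t within {0..})"
        by (auto intro!: derivative_eq_intros)
      then show "((\<lambda>t. exp (- 2 * r * t) *\<^sub>R energy r (?p t)) has_vector_derivative
          exp (- 2 * r * t) *\<^sub>R (2 * ?D) + (- 2 * r * exp (- 2 * r * t)) *\<^sub>R energy r (?p t)) (at t within {0..})"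
        by (rule has_vector_derivative_scaleR)
           (rule energy_derivative[OF orbit_of_inverse_generator(2)[OF U gen t]])
      have "?D \<le> r * energy r (?p t)"
        unfolding orbit_of_inverse_generator(1)[OF U gen t] by (rule energy_dissipation[OF g1 g2 r])
      then have "exp (- 2 * r * t) * (2 * ?D) \<le> exp (- 2 * r * t) * (2 * (r * energy r (?p t)))"
        by (intro mult_left_mono) auto
      then show "exp (- 2 * r * t) *\<^sub>R (2 * ?D) + (- 2 * r * exp (- 2 * r * t)) *\<^sub>R energy r (?p t) \<le> 0"
        by (simp add: mult_ac)
    qed
    then have e: "exp (- 2 * r * t) * energy r (?p t) \<le> energy r (phase_inverse q)"
      using U by (simp add: c0_semigroup_def)
    have "exp (2 * r * t) * (exp (- 2 * r * t) * energy r (?p t)) \<le> exp (2 * r * t) * energy r (phase_inverse q)"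
      by (intro mult_left_mono e) auto
    then have "energy r (?p t) \<le> exp (2 * r * t) * energy r (phase_inverse q)"
      by (simp add: mult.assoc[symmetric] flip: exp_add)
    also have "\<dots> \<le> exp (2 * r * t) * (K * (norm (phase_inverse q))\<^sup>2)" by (intro mult_left_mono K) auto
    finally have "k * (norm (?p t))\<^sup>2 \<le> exp (2 * r * t) * (K * (norm (phase_inverse q))\<^sup>2)" using k(2) order_trans by blast
    then have "(norm (?p t))\<^sup>2 \<le> (K / k) * exp (2 * r * t) * (norm (phase_inverse q))\<^sup>2"
      using k(1) by (simp add: field_simps)
    also have "\<dots> = ((sqrt (K / k) * exp (r * t)) * norm (phase_inverse q))\<^sup>2"
      using k K by (simp add: power_mult_distrib exp_double[symmetric] mult_ac)
    finally show ?thesis by (rule power2_le_imp_le) (use k K in simp)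
  qed
  have "onorm (U t) \<le> sqrt (K / k) * exp (r * t)" if t: "0 \<le> t" for t
  proof (rule onorm_bound)
    show "0 \<le> sqrt (K / k) * exp (r * t)" using k K by simp
    fix x
    have "closed {x. norm (U t x) \<le> (sqrt (K / k) * exp (r * t)) * norm x}"
      by (intro closed_Collect_le continuous_intros linear_continuous_on blU[OF t])
    then have "closure (range phase_inverse) \<subseteq> {x. norm (U t x) \<le> (sqrt (K / k) * exp (r * t)) * norm x}"
      using range[OF t] by (intro closure_minimal) auto
    then show "norm (U t x) \<le> (sqrt (K / k) * exp (r * t)) * norm x"
      using inv.R_dense by auto
  qed
  then show ?thesis by blast
qed

text \<open>
  If the pencil at \<open>g\<close> nearly annihilates \<open>x\<close>, then \<open>q = (x, g M\<^sup>1\<^sup>/\<^sup>2 B x)\<close>, the shape of an eigenvector of the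
  phase space operator for the eigenvalue \<open>g\<close>, satisfies \<open>q - g R q = (pencil g x, 0)\<close>, where \<open>R\<close> is
  \<open>phase_inverse\<close>.
\<close>

lemma approx_eigenvalue_phase_inverse:
  assumes g2: "\<And>x. 0 \<le> qform g x" and ap: "\<And>e. 0 < e \<Longrightarrow> \<exists>x. x \<noteq> 0 \<and> qform g x \<le> e * (norm x)\<^sup>2"
  shows "approx_eigenvalue phase_inverse g"
  unfolding approx_eigenvalue_def
proof (intro allI impI)
  fix e :: real assume e: "e > 0"
  let ?P = "pencil (complex_of_real g)"
  have blP: "bounded_linear ?P" using pencil_bounded_clinear by (simp add: bounded_clinear_def)
  obtain s where s: "s > 0" "\<And>x. norm (?P x) \<le> s * norm x"
    using bounded_linear.pos_bounded[OF blP] by (metis mult.commute)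
  (* The bound 1 / 2 lets the residual be absorbed, which gives norm q \<le> 2 |g| norm (R q) for
     R = phase_inverse; the other one turns that into the accuracy e relative to norm (R q). *)
  define eta where "eta = min (1 / 2) (e / (2 * (\<bar>g\<bar> + 1)))"
  have g1: "2 * (\<bar>g\<bar> + 1) > 0" by (simp add: add_nonneg_pos)
  have eta: "eta > 0" using e g1 by (simp add: eta_def)
  have eta2: "eta \<le> 1 / 2" and "eta \<le> e / (2 * (\<bar>g\<bar> + 1))"
    unfolding eta_def by (rule min.cobounded1, rule min.cobounded2)
  then have eta3: "eta * (2 * (\<bar>g\<bar> + 1)) \<le> e" using g1 by (simp only: pos_le_divide_eq)
  obtain x where x: "x \<noteq> 0" "qform g x \<le> (eta\<^sup>2 / s) * (norm x)\<^sup>2"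
    using ap[of "eta\<^sup>2 / s"] eta s by auto
  have "(norm (?P x))\<^sup>2 \<le> s * inner x (?P x)"
    by (rule norm_sq_le_form[OF blP pencil_symmetric _ s]) (simp add: inner_pencil_of_real g2)
  also have "\<dots> \<le> s * ((eta\<^sup>2 / s) * (norm x)\<^sup>2)"
    using s x by (intro mult_left_mono) (auto simp: inner_pencil_of_real)
  also have "\<dots> = (eta * norm x)\<^sup>2" using s by (simp add: power_mult_distrib)
  finally have Px: "norm (?P x) \<le> eta * norm x" by (rule power2_le_imp_le) (use eta in simp)
  define q where "q = (x, g *\<^sub>R Mh (B x))"
  have "q - g *\<^sub>R phase_inverse q = (?P x, 0)"
    by (simp add: q_def phase_inverse_def pencil_of_real B.scaleR Mh.scaleR scaleR_diff_right power2_eq_square)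
  then have "norm (q - g *\<^sub>R phase_inverse q) \<le> eta * norm x" using Px by simp
  also have "\<dots> \<le> eta * norm q"
    unfolding q_def using eta by (intro mult_left_mono norm_fst_le) auto
  finally have res: "norm (q - g *\<^sub>R phase_inverse q) \<le> eta * norm q" .
  have "norm q \<le> norm (q - g *\<^sub>R phase_inverse q) + norm (g *\<^sub>R phase_inverse q)"
    using norm_triangle_ineq[of "q - g *\<^sub>R phase_inverse q" "g *\<^sub>R phase_inverse q"] by simp
  also have "\<dots> \<le> 1 / 2 * norm q + \<bar>g\<bar> * norm (phase_inverse q)"
    using res mult_right_mono[OF eta2 norm_ge_zero[of q]] by simp
  finally have qn: "norm q \<le> 2 * \<bar>g\<bar> * norm (phase_inverse q)" by simp
  have "norm q > 0" using x by (simp add: q_def zero_prod_def)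
  then have ne: "phase_inverse q \<noteq> 0" using qn by auto
  have "norm (q - g *\<^sub>R phase_inverse q) \<le> eta * (2 * \<bar>g\<bar> * norm (phase_inverse q))"
    using eta by (intro order_trans[OF res] mult_left_mono qn) auto
  also have "\<dots> \<le> (eta * (2 * (\<bar>g\<bar> + 1))) * norm (phase_inverse q)"
    using eta by (simp add: algebra_simps)
  also have "\<dots> \<le> e * norm (phase_inverse q)" using eta3 by (intro mult_right_mono) auto
  finally show "\<exists>q. phase_inverse q \<noteq> 0 \<and> norm (q - g *\<^sub>R phase_inverse q) \<le> e * norm (phase_inverse q)" using ne by blast
qed

lemma type_and_spectral_bound:
  assumes g1: "\<And>x. 0 \<le> cform (B x) + 2 * g * mform (B x)" and g2: "\<And>x. 0 \<le> qform g x"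
    and ap: "\<And>e. 0 < e \<Longrightarrow> \<exists>x. x \<noteq> 0 \<and> qform g x \<le> e * (norm x)\<^sup>2"
    and A: "\<And>p q. A p = Some q \<longleftrightarrow> p = phase_inverse q"
  shows "semigroup_type A = ereal g" "(SUP l\<in>spectrum A. ereal (Re l)) = ereal g"
proof -
  have U: "c0_semigroup (exp_semigroup A)" and gen: "\<And>p q. generator (exp_semigroup A) p = Some q \<longleftrightarrow> p = phase_inverse q"
    using inv.generates[OF A] A by auto
  note ae = approx_eigenvalue_phase_inverse[OF g2 ap]
  show "semigroup_type A = ereal g"
    unfolding semigroup_type_def
  proof (rule antisym)
    show "Inf {ereal \<beta> |\<beta>. \<exists>c. \<forall>t\<ge>0. onorm (exp_semigroup A t) \<le> c * exp (\<beta> * t)} \<le> ereal g"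
    proof (rule ereal_le_epsilon2)
      fix e :: real assume "0 < e"
      then have "\<exists>c. \<forall>t\<ge>0. onorm (exp_semigroup A t) \<le> c * exp ((g + e) * t)"
        by (intro semigroup_growth[OF g1 g2 _ U gen]) auto
      then show "Inf {ereal \<beta> |\<beta>. \<exists>c. \<forall>t\<ge>0. onorm (exp_semigroup A t) \<le> c * exp (\<beta> * t)} \<le> ereal g + ereal e"
        by (intro Inf_lower) auto
    qed
    show "ereal g \<le> Inf {ereal \<beta> |\<beta>. \<exists>c. \<forall>t\<ge>0. onorm (exp_semigroup A t) \<le> c * exp (\<beta> * t)}"
    proof (rule Inf_greatest)
      fix b assume "b \<in> {ereal \<beta> |\<beta>. \<exists>c. \<forall>t\<ge>0. onorm (exp_semigroup A t) \<le> c * exp (\<beta> * t)}"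
      then obtain \<beta> c where b: "b = ereal \<beta>" "\<And>t. 0 \<le> t \<Longrightarrow> onorm (exp_semigroup A t) \<le> c * exp (\<beta> * t)"
        by blast
      show "ereal g \<le> b" unfolding b(1) ereal_less_eq by (rule approx_eigenvalue_le_growth[OF U gen ae b(2)])
    qed
  qed
  show "(SUP l\<in>spectrum A. ereal (Re l)) = ereal g"
  proof (rule antisym)
    show "(SUP l\<in>spectrum A. ereal (Re l)) \<le> ereal g"
      using right_half_plane_resolvent[OF g1 g2 A] by (intro SUP_least) (force simp: not_less[symmetric])
    show "ereal g \<le> (SUP l\<in>spectrum A. ereal (Re l))"
      using approx_eigenvalue_in_spectrum[OF A ae] by (intro SUP_upper2[of "complex_of_real g"]) auto
  qed
qed

end

section \<open>The roots of the quadratic polynomials\<close>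

definition larger_root :: "real \<Rightarrow> real \<Rightarrow> real \<Rightarrow> real" where
  "larger_root m c k = Re ((- complex_of_real c +
     csqrt ((complex_of_real c)\<^sup>2 - 4 * complex_of_real m * complex_of_real k)) / (2 * complex_of_real m))"

text \<open>
  For a negative discriminant the root is nonreal and its real part is \<open>- c / (2 m)\<close>; the maximum
  covers this case.
\<close>

lemma larger_root_eq:
  "larger_root m c k = (- c + sqrt (max 0 (c\<^sup>2 - 4 * m * k))) / (2 * m)"
proof -
  have "(complex_of_real c)\<^sup>2 - 4 * complex_of_real m * complex_of_real k = complex_of_real (c\<^sup>2 - 4 * m * k)"
    by simp
  moreover have "Re (csqrt (complex_of_real d)) = sqrt (max 0 d)" for d
    by (simp add: max_def)
  moreover have "2 * complex_of_real m = complex_of_real (2 * m)" by simp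
  ultimately show ?thesis unfolding larger_root_def by (simp only: Re_divide_of_real plus_complex.sel uminus_complex.sel Re_complex_of_real)
qed

lemma larger_root_bounds:
  assumes m: "m > 0" and g: "larger_root m c k \<le> g"
  shows "0 \<le> c + 2 * g * m" "0 \<le> k + g * c + g\<^sup>2 * m"
proof -
  define d where "d = c\<^sup>2 - 4 * m * k"
  have s: "sqrt (max 0 d) \<le> c + 2 * g * m"
    using g m by (simp add: larger_root_eq d_def field_simps)
  then show 1: "0 \<le> c + 2 * g * m" by (meson max.cobounded1 order_trans real_sqrt_ge_zero)
  have "(sqrt (max 0 d))\<^sup>2 \<le> (c + 2 * g * m)\<^sup>2" by (rule power_mono[OF s]) simp
  then have "d \<le> (c + 2 * g * m)\<^sup>2" by simp
  then have "0 \<le> 4 * m * (k + g * c + g\<^sup>2 * m)"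
    by (simp add: d_def power2_eq_square algebra_simps)
  then show "0 \<le> k + g * c + g\<^sup>2 * m" using m by (simp add: zero_le_mult_iff)
qed

lemma larger_root_nonpos:
  assumes "m > 0" "0 \<le> c" "0 \<le> k"
  shows "larger_root m c k \<le> 0"
proof -
  have "sqrt (max 0 (c\<^sup>2 - 4 * m * k)) \<le> c"
    using assms by (intro real_le_lsqrt) auto
  then show ?thesis using assms by (simp add: larger_root_eq divide_le_0_iff)
qed

text \<open>
  A real part strictly above the vertex \<open>- c / (2 m)\<close> belongs to a real root.
\<close>

lemma quadratic_at_larger_root:
  assumes m: "m > 0" and "- c / (2 * m) < larger_root m c k"
  shows "k + larger_root m c k * c + (larger_root m c k)\<^sup>2 * m = 0"
proof -
  define d where "d = c\<^sup>2 - 4 * m * k"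
  define p where "p = larger_root m c k"
  have "- c / (2 * m) < (- c + sqrt (max 0 d)) / (2 * m)"
    using assms(2) by (simp only: larger_root_eq d_def)
  then have "sqrt (max 0 d) > 0" unfolding divide_less_cancel using m by linarith
  then have d: "d > 0" by (auto simp: max_def split: if_splits)
  have "2 * m * p + c = sqrt d" using m d by (simp add: p_def larger_root_eq d_def)
  then have "(2 * m * p + c)\<^sup>2 = d" using d by simp
  then have "4 * m * (k + p * c + p\<^sup>2 * m) = 0" by (simp add: d_def power2_eq_square algebra_simps)
  then show ?thesis using m by (simp add: p_def)
qed

context damped_system
begin

text \<open>
  The gap assumption forces all \<open>x\<close> whose root has real part close to \<open>g\<close> to have a real root \<open>p\<close>. There
  \<open>qform p x = 0\<close>, and \<open>qform g x\<close> is then of the order of \<open>g - p\<close>.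
\<close>

lemma growth_rate_properties:
  assumes inj: "\<And>x. B x = 0 \<Longrightarrow> x = 0" and nontriv: "\<exists>x::'a. x \<noteq> 0"
    and G: "G = (SUP x\<in>- {0}. ereal (larger_root (mform (B x)) (cform (B x)) ((norm x)\<^sup>2)))"
    and gap: "G > - (INF u\<in>- {0}. ereal (cform u / (2 * mform u)))"
  obtains g where "G = ereal g" "\<And>x. 0 \<le> cform (B x) + 2 * g * mform (B x)" "\<And>x. 0 \<le> qform g x"
    "\<And>e. 0 < e \<Longrightarrow> \<exists>x. x \<noteq> 0 \<and> qform g x \<le> e * (norm x)\<^sup>2"
proof -
  interpret B: bounded_linear B by (rule bounded_ops)
  let ?p = "\<lambda>x. larger_root (mform (B x)) (cform (B x)) ((norm x)\<^sup>2)"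
  have mpos: "mform u > 0" if "u \<noteq> 0" for u
    using that Q(2)[of u] linear_simps(3)[OF Q(1)] by (auto simp: mform_def)
  have mB: "mform (B x) > 0" if "x \<noteq> 0" for x using that inj mpos by blast
  obtain x0 :: 'a where x0: "x0 \<noteq> 0" using nontriv by blast
  have "ereal (?p x0) \<le> G" unfolding G using x0 by (intro SUP_upper) auto
  moreover have "G \<le> 0" unfolding G
    using mB cform_nonneg by (intro SUP_least) (auto intro!: larger_root_nonpos)
  ultimately obtain g where g: "G = ereal g" by (cases G) auto
  have g0: "g \<le> 0" using \<open>G \<le> 0\<close> g by simp
  have pg: "?p x \<le> g" if "x \<noteq> 0" for x
  proof -
    have "ereal (?p x) \<le> G" unfolding G using that by (intro SUP_upper) auto
    then show ?thesis by (simp add: g)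
  qed
  have zero: "cform 0 = 0" "mform 0 = 0" "B 0 = 0"
    using linear_simps(3)[OF bounded_ops(2)] by (simp_all add: cform_def mform_def B.zero)
  show thesis
  proof (rule that[OF g])
    show "0 \<le> cform (B x) + 2 * g * mform (B x)" for x
      using larger_root_bounds(1)[OF mB pg, of x] zero by (cases "x = 0") auto
    show "0 \<le> qform g x" for x
      using larger_root_bounds(2)[OF mB pg, of x] zero by (cases "x = 0") (auto simp: qform_def)
    fix e :: real assume e: "e > 0"
    obtain c where c: "c \<ge> 0" "\<And>u. cform u \<le> c * (norm u)\<^sup>2" using cform_bound by blast
    obtain b where b: "b \<ge> 0" "\<And>x. norm (B x) \<le> norm x * b" using B.nonneg_bounded by blast
    (* A root within d below g yields a value of qform g of at most d c b^2 times the squared norm. *)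
    define d where "d = e / (c * b\<^sup>2 + 1)"
    have cb: "c * b\<^sup>2 \<ge> 0" using c by simp
    have d: "d > 0" using e cb by (simp add: d_def add_nonneg_pos)
    have "max (- (INF u\<in>- {0}. ereal (cform u / (2 * mform u)))) (ereal (g - d)) < G"
      using gap d g by simp
    then obtain x where x: "x \<noteq> 0" "- (INF u\<in>- {0}. ereal (cform u / (2 * mform u))) < ereal (?p x)" "g - d < ?p x"
      unfolding G less_SUP_iff by auto
    have "B x \<noteq> 0" using x(1) inj by blast
    then have "(INF u\<in>- {0}. ereal (cform u / (2 * mform u))) \<le> ereal (cform (B x) / (2 * mform (B x)))"
      by (intro INF_lower) auto
    then have "- ereal (cform (B x) / (2 * mform (B x))) \<le> - (INF u\<in>- {0}. ereal (cform u / (2 * mform u)))"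
      by (simp only: ereal_minus_le_minus)
    then have "- ereal (cform (B x) / (2 * mform (B x))) < ereal (?p x)" using x(2) by (rule order_le_less_trans)
    then have lt: "- cform (B x) / (2 * mform (B x)) < ?p x" by simp
    define p where "p = ?p x"
    have q0: "(norm x)\<^sup>2 + p * cform (B x) + p\<^sup>2 * mform (B x) = 0"
      unfolding p_def by (rule quadratic_at_larger_root[OF mB[OF x(1)] lt])
    have p: "p \<le> g" "g - d < p" using pg[OF x(1)] x(3) by (simp_all add: p_def)
    have "qform g x = (g - p) * ((g + p) * mform (B x) + cform (B x))"
      using q0 by (simp add: qform_def power2_eq_square algebra_simps)
    also have "\<dots> \<le> d * (c * (norm (B x))\<^sup>2)"
    proof -
      have "(g + p) * mform (B x) \<le> 0" using g0 p mform_nonneg by (intro mult_nonpos_nonneg) auto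
      then have "(g - p) * ((g + p) * mform (B x) + cform (B x)) \<le> (g - p) * (c * (norm (B x))\<^sup>2)"
        using p c(2)[of "B x"] by (intro mult_left_mono) auto
      also have "\<dots> \<le> d * (c * (norm (B x))\<^sup>2)" using p c by (intro mult_right_mono) auto
      finally show ?thesis .
    qed
    also have "\<dots> \<le> d * (c * (norm x * b)\<^sup>2)"
      using d c b by (intro mult_left_mono power_mono) auto
    also have "\<dots> \<le> (d * (c * b\<^sup>2 + 1)) * (norm x)\<^sup>2"
      using d by (simp add: power_mult_distrib algebra_simps)
    also have "d * (c * b\<^sup>2 + 1) = e" using cb by (simp add: d_def add_nonneg_pos)
    finally show "\<exists>x. x \<noteq> 0 \<and> qform g x \<le> e * (norm x)\<^sup>2" using x(1) by blast
  qed
qed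

end

section \<open>The phase space operator\<close>

lemma phase_space_op_eq_Some:
  assumes ds: "damped_system B Mh Q F"
    and Kh: "\<And>x y. sqrt_op K x = Some y \<longleftrightarrow> x = B y"
    and M: "\<And>x. sqrt_op M x = Some (Mh x)" and Cop: "\<And>x. C x = Some (F x)"
  shows "phase_space_op M C K p = Some q \<longleftrightarrow> p = damped_system.phase_inverse B Mh F q"
proof -
  interpret damped_system B Mh Q F by fact
  have lin: "B (a + b) = B a + B b" "B (- a) = - B a" "Mh (a + b) = Mh a + Mh b" "Mh (- a) = - Mh a" for a b
    using linear_simps[OF bounded_ops(1)] linear_simps[OF bounded_ops(2)] by auto
  have Qlin: "Q (a + b) = Q a + Q b" "Q (- a) = - Q a" for a b
    using linear_simps[OF Q(1)] by auto
  have Mi: "inverse_op (sqrt_op M) y = Some x \<longleftrightarrow> x = Q y" for x y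
  proof (subst inverse_op_eq_Some)
    show "x = y" if "sqrt_op M x = Some z" "sqrt_op M y = Some z" for x y z
      using that Q(2) by (metis M option.inject)
  qed (use Q(2,3) in \<open>auto simp: M\<close>)
  then have Mi': "inverse_op (sqrt_op M) y = Some (Q y)" for y by simp
  have KhB: "sqrt_op K (B y) = Some y" for y using Kh by simp
  have dom: "dom (sqrt_op K) = range B" by (rule dom_eq_range[OF Kh])
  have op: "phase_space_op M C K (B a, Mh (B f)) = Some (f, - Q a - Q (F (B f)))" for a f
    by (simp add: phase_space_op_def Let_def dom M Mi' KhB Cop Q(2) image_image)
  have none: "phase_space_op M C K p = None" if "p \<notin> range B \<times> Mh ` range B" for p
    using that by (cases p) (auto simp: phase_space_op_def Let_def dom M)
  show ?thesis
  proof
    assume *: "phase_space_op M C K p = Some q"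
    then obtain a f where p: "p = (B a, Mh (B f))" using none[of p] by (cases "p \<in> range B \<times> Mh ` range B") auto
    have q: "q = (f, - Q a - Q (F (B f)))" using * op[of a f] p by simp
    have "Mh (- Q a - Q (F (B f))) = - a - F (B f)"
      using linear_simps[OF bounded_ops(2)] Q(3) by simp
    then show "p = phase_inverse q" unfolding p q phase_inverse_def
      using linear_simps[OF bounded_ops(1)] by simp
  next
    assume p: "p = phase_inverse q"
    (* This shape exhibits p as an element of the domain of the phase space operator. *)
    have "p = (B (- F (B (fst q)) - Mh (snd q)), Mh (B (fst q)))"
      using linear_simps[OF bounded_ops(1)] by (simp add: p phase_inverse_def)
    then have "phase_space_op M C K p = Some (fst q, - Q (- F (B (fst q)) - Mh (snd q)) - Q (F (B (fst q))))"
      using op by simp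
    also have "- Q (- F (B (fst q)) - Mh (snd q)) - Q (F (B (fst q))) = snd q"
      using linear_simps[OF Q(1)] Q(2) by simp
    finally show "phase_space_op M C K p = Some q" by simp
  qed
qed

theorem corollary1:
  fixes M C K :: "'a::complex_hilbert \<rightharpoonup> 'a"
  assumes "\<exists>x::'a. x \<noteq> 0"
    and "selfadjoint_op M" and "posdef_op M" and "bounded_op M"
    and "selfadjoint_op C" and "posdef_op C" and "bounded_op C"
    and "selfadjoint_op K" and "posdef_op K"
    and "gamma M C K >
           - (INF x \<in> - {0}. ereal (Re (cinner x (C \<cdot> x) / (2 * cinner x (M \<cdot> x)))))"
  shows "gamma M C K = semigroup_type (phase_space_op M C K)
       \<and> semigroup_type (phase_space_op M C K)
           = (SUP l \<in> spectrum (phase_space_op M C K). ereal (Re l))"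
proof -
  obtain B where B: "bounded_clinear B" "symmetric B" "closure (range B) = UNIV"
    and Kh: "\<And>x y. sqrt_op K x = Some y \<longleftrightarrow> x = B y"
    using sqrt_op_inverse[OF assms(8,9)] by metis
  obtain Mh Q where Mh: "bounded_clinear Mh" "symmetric Mh"
    and Q: "bounded_linear Q" "\<And>x. Q (Mh x) = x" "\<And>x. Mh (Q x) = x"
    and sM: "\<And>x. sqrt_op M x = Some (Mh x)" and M: "\<And>x. M x = Some (Mh (Mh x))"
    using sqrt_op_bounded[OF assms(2-4)] by metis
  obtain F where F: "bounded_clinear F" "symmetric F" and Cop: "\<And>x. C x = Some (F x)"
    using selfadjoint_bounded[OF assms(5,7)] by metis
  have Fpos: "0 \<le> inner x (F x)" for x
  proof -
    obtain c where "c > 0" "\<forall>x\<in>dom C. c * (norm x)\<^sup>2 \<le> Re (cinner x (C \<cdot> x))"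
      using assms(6) unfolding posdef_op_def by blast
    then have "c * (norm x)\<^sup>2 \<le> inner x (F x)" by (metis Cop Re_cinner domI option.sel)
    then show ?thesis using \<open>c > 0\<close> by (meson less_imp_le mult_nonneg_nonneg order_trans zero_le_power2)
  qed
  interpret damped_system B Mh Q F by (intro damped_system.intro B Mh Q F Fpos)
  have cC: "cinner u (F u) = complex_of_real (cform u)" for u
    using cinner_self_symmetric[OF F] by (simp add: cform_def)
  have cM: "cinner u (Mh (Mh u)) = complex_of_real (mform u)" for u
  proof -
    have "bounded_clinear (\<lambda>x. Mh (Mh x))" "symmetric (\<lambda>x. Mh (Mh x))"
      using bounded_linear_compose[OF bounded_ops(2) bounded_ops(2)] by (auto simp: bounded_clinear_def symmetric_def scaleC_ops symmetric_ops o_def)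
    from cinner_self_symmetric[OF this, of u] show ?thesis
      by (simp add: mform_def power2_norm_eq_inner symmetric_ops)
  qed
  have KhB: "sqrt_op K (B y) = Some y" for y using Kh by simp
  have B0: "B 0 = 0" using linear_simps(3)[OF bounded_ops(1)] .
  have inj: "x = 0" if "B x = 0" for x using KhB[of x] KhB[of 0] that B0 by simp
  have dom: "dom (sqrt_op K) - {0} = B ` (- {0})"
    unfolding dom_eq_range[OF Kh] using inj B0 by auto
  have G: "gamma M C K = (SUP x\<in>- {0}. ereal (larger_root (mform (B x)) (cform (B x)) ((norm x)\<^sup>2)))"
    unfolding gamma_def dom image_image by (simp add: Cop M cC cM KhB larger_root_def)
  have quotient: "Re (cinner u (C \<cdot> u) / (2 * cinner u (M \<cdot> u))) = cform u / (2 * mform u)" for u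
  proof -
    have "cinner u (C \<cdot> u) / (2 * cinner u (M \<cdot> u)) = complex_of_real (cform u / (2 * mform u))"
      by (simp add: Cop M cC cM)
    then show ?thesis by (simp only: Re_complex_of_real)
  qed
  have A: "phase_space_op M C K p = Some q \<longleftrightarrow> p = phase_inverse q" for p q
    by (rule phase_space_op_eq_Some[OF damped_system_axioms Kh sM Cop])
  show ?thesis
  proof (rule growth_rate_properties[OF inj assms(1) G assms(10)[unfolded quotient]])
    fix g
    assume g: "gamma M C K = ereal g"
      and g_props: "\<And>x. 0 \<le> cform (B x) + 2 * g * mform (B x)" "\<And>x. 0 \<le> qform g x"
        "\<And>e. 0 < e \<Longrightarrow> \<exists>x. x \<noteq> 0 \<and> qform g x \<le> e * (norm x)\<^sup>2"
    show ?thesis using type_and_spectral_bound[OF g_props A] g by simp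
  qed
qed

end
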